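(* Let $N\ge1$ be a fixed integer and let $p_1,\ldots,p_N>0$ with $\sum_{j=1}^Np_j=1$. Let $\mathbf{S}_n$ be a random walk on spider and $\mathbf{B}(t)$ a Brownian spider, both on $\mathbf{SP}(N)$ with leg probabilities $p_1,\ldots,p_N$. Then $$\liminf_{n\to\infty}\frac{T_M(n)}{n}=\limsup_{n\to\infty}\frac{T_m(n)}{n}=\frac1N\quad\text{almost surely}$$ and, similarly, $$\liminf_{t\to\infty}\frac{Z_M(t)}{t}=\limsup_{t\to\infty}\frac{Z_m(t)}{t}=\frac1N\quad\text{almost surely}.$$
   Context: Spider with $N$ legs: $\mathbf{SP}(N)=\{v(x,j):\ x\ge0,\ j=1,\ldots,N\}\subset\mathbb{C}$ with $v(x,j)=x\exp(2\pi i(j-1)/N)$; the body is $v(0)=v(0,1)=\cdots=v(0,N)=\mathbf{0}$, and $L_j=\{v(x,j):x>0\}$ is the $j$-th leg. Random walk on spider (RWS) with probabilities $p_1,\ldots,p_N$: the Markov chain $\mathbf{S}_n$ on $\mathbf{SP}(N)$ with $\mathbf{S}_0=\mathbf{0}$, $\mathbf{P}(\mathbf{S}_{n+1}=v(1,j)\mid\mathbf{S}_n=v(0))=p_j$, and $\mathbf{P}(\mathbf{S}_{n+1}=v(r\pm1,j)\mid\mathbf{S}_n=v(r,j))=1/2$ (each sign) for $r=1,2,\ldots$, $j=1,\ldots,N$. Brownian spider (BMS) with probabilities $p_1,\ldots,p_N$: let $B(\cdot)$ be a standard Brownian motion on the line, $J_1,J_2,\ldots$ a fixed enumeration of the excursion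 intervals away from zero of $|B(\cdot)|$, and $\kappa_1,\kappa_2,\ldots$ i.i.d., independent of $B(\cdot)$, with $P(\kappa_m=j)=p_j$. Then $\mathbf{B}(t)=\sum_{m\ge1}I\{t\in J_m\}\,v(|B(t)|,\kappa_m)$ if $B(t)\ne0$, and $\mathbf{B}(t)=\mathbf{0}$ if $B(t)=0$. Here $I\{\cdot\}$ is the indicator. Occupation times: $T(j,n)=\sum_{k=1}^nI\{\mathbf{S}_k\in L_j\}$, $Z(j,t)=\int_0^tI\{\mathbf{B}(s)\in L_j\}\,ds$, and $T_M(n)=\max_{1\le j\le N}T(j,n)$, $T_m(n)=\min_{1\le j\le N}T(j,n)$, $Z_M(t)=\max_{1\le j\le N}Z(j,t)$, $Z_m(t)=\min_{1\le j\le N}Z(j,t)$. *)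

theory Defs
  imports "HOL-Probability.Probability"
begin

section \<open>The spider\<close>

definition spider_point :: "nat \<Rightarrow> real \<Rightarrow> nat \<Rightarrow> complex" where
  "spider_point N x j = of_real x * exp (2 * of_real pi * \<i> * (of_nat j - 1) / of_nat N)"

definition spider :: "nat \<Rightarrow> complex set" where
  "spider N = {spider_point N x j | x j. x \<ge> 0 \<and> j \<in> {1..N}}"

definition leg :: "nat \<Rightarrow> nat \<Rightarrow> complex set" where
  "leg N j = {spider_point N x j | x. x > 0}"


section \<open>Random walk on the spider\<close>

text \<open>
  Conditional probabilities are constrained only when the conditioning event has positive
  probability; otherwise the quotient defining them is \<open>0\<close> by the convention on division.
\<close>

definition discrete_markov_chain :: "'a measure \<Rightarrow> (nat \<Rightarrow> 'a \<Rightarrow> 'b::topological_space) \<Rightarrow> bool" where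
  "discrete_markov_chain M S \<longleftrightarrow>
     (\<forall>n. S n \<in> borel_measurable M) \<and>
     (\<forall>n x y. \<P>(\<omega> in M. \<forall>i\<le>n. S i \<omega> = x i) > 0 \<longrightarrow>
        \<P>(\<omega> in M. S (Suc n) \<omega> = y \<bar> \<forall>i\<le>n. S i \<omega> = x i) =
        \<P>(\<omega> in M. S (Suc n) \<omega> = y \<bar> S n \<omega> = x n))"

definition random_walk_on_spider ::
    "'a measure \<Rightarrow> nat \<Rightarrow> (nat \<Rightarrow> real) \<Rightarrow> (nat \<Rightarrow> 'a \<Rightarrow> complex) \<Rightarrow> bool" where
  "random_walk_on_spider M N p S \<longleftrightarrow>
     prob_space M \<and>
     discrete_markov_chain M S \<and>
     (\<forall>n. \<forall>\<omega>\<in>space M. S n \<omega> \<in> spider N) \<and>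
     (\<forall>\<omega>\<in>space M. S 0 \<omega> = 0) \<and>
     (\<forall>n. \<forall>j\<in>{1..N}. \<P>(\<omega> in M. S n \<omega> = 0) > 0 \<longrightarrow>
        \<P>(\<omega> in M. S (Suc n) \<omega> = spider_point N 1 j \<bar> S n \<omega> = 0) = p j) \<and>
     (\<forall>n. \<forall>r\<ge>1. \<forall>j\<in>{1..N}. \<P>(\<omega> in M. S n \<omega> = spider_point N (real r) j) > 0 \<longrightarrow>
        \<P>(\<omega> in M. S (Suc n) \<omega> = spider_point N (real r + 1) j
              \<bar> S n \<omega> = spider_point N (real r) j) = 1 / 2 \<and>
        \<P>(\<omega> in M. S (Suc n) \<omega> = spider_point N (real r - 1) j
              \<bar> S n \<omega> = spider_point N (real r) j) = 1 / 2)"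


section \<open>Brownian motion and Brownian spider\<close>

text \<open>
  Processes in continuous time are total functions on \<^typ>\<open>real\<close>; only times \<open>t \<ge> 0\<close> matter.
\<close>

definition standard_brownian_motion :: "'a measure \<Rightarrow> (real \<Rightarrow> 'a \<Rightarrow> real) \<Rightarrow> bool" where
  "standard_brownian_motion M B \<longleftrightarrow>
     prob_space M \<and>
     (\<forall>t\<ge>0. B t \<in> borel_measurable M) \<and>
     (\<forall>\<omega>\<in>space M. B 0 \<omega> = 0) \<and>
     (\<forall>\<omega>\<in>space M. continuous_on {0..} (\<lambda>t. B t \<omega>)) \<and>
     (\<forall>s t. 0 \<le> s \<and> s < t \<longrightarrow>
        distributed M lborel (\<lambda>\<omega>. B t \<omega> - B s \<omega>) (normal_density 0 (sqrt (t - s)))) \<and>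
     (\<forall>n (\<tau> :: nat \<Rightarrow> real). 0 \<le> \<tau> 0 \<and> (\<forall>i<n. \<tau> i \<le> \<tau> (Suc i)) \<longrightarrow>
        prob_space.indep_vars M (\<lambda>_. borel) (\<lambda>i \<omega>. B (\<tau> (Suc i)) \<omega> - B (\<tau> i) \<omega>) {..<n})"

definition generated_events ::
    "'a measure \<Rightarrow> 'b measure \<Rightarrow> 'i set \<Rightarrow> ('i \<Rightarrow> 'a \<Rightarrow> 'b) \<Rightarrow> 'a set set" where
  "generated_events M K I X =
     sets (vimage_algebra (space M) (\<lambda>\<omega>. \<lambda>i\<in>I. X i \<omega>) (\<Pi>\<^sub>M i\<in>I. K))"

definition excursion_intervals :: "(real \<Rightarrow> real) \<Rightarrow> real set set" where
  "excursion_intervals f = components {t. 0 \<le> t \<and> \<bar>f t\<bar> \<noteq> 0}"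

text \<open>
  The enumeration has to be determined measurably by the path of \<open>B\<close>: otherwise it could depend
  on the leg labels, or \<open>\<omega> \<mapsto> W t \<omega>\<close> could fail to be a random variable. Almost every path has
  infinitely many excursions, but not necessarily every one.
\<close>

definition excursion_enumeration ::
    "'a measure \<Rightarrow> (real \<Rightarrow> 'a \<Rightarrow> real) \<Rightarrow> (nat \<Rightarrow> 'a \<Rightarrow> real set) \<Rightarrow> bool" where
  "excursion_enumeration M B J \<longleftrightarrow>
     (AE \<omega> in M. bij_betw (\<lambda>m. J m \<omega>) {1..} (excursion_intervals (\<lambda>t. B t \<omega>))) \<and>
     (\<forall>m\<ge>1. \<forall>t\<ge>0. {\<omega>\<in>space M. t \<in> J m \<omega>} \<in> generated_events M borel {0..} B)"

definition brownian_spider ::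
    "'a measure \<Rightarrow> nat \<Rightarrow> (nat \<Rightarrow> real) \<Rightarrow> (real \<Rightarrow> 'a \<Rightarrow> complex) \<Rightarrow> bool" where
  "brownian_spider M N p W \<longleftrightarrow>
     (\<exists>B J \<kappa>.
        standard_brownian_motion M B \<and>
        excursion_enumeration M B J \<and>
        prob_space.indep_vars M (\<lambda>_. count_space UNIV) \<kappa> {1::nat..} \<and>
        (\<forall>m\<ge>1. \<forall>\<omega>\<in>space M. \<kappa> m \<omega> \<in> {1..N}) \<and>
        (\<forall>m\<ge>1. \<forall>j\<in>{1..N}. \<P>(\<omega> in M. \<kappa> m \<omega> = j) = p j) \<and>
        prob_space.indep_set M
          (generated_events M (count_space UNIV) {1..} \<kappa>) (generated_events M borel {0..} B) \<and>
        (\<forall>t\<ge>0. \<forall>\<omega>\<in>space M.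
           W t \<omega> = (if B t \<omega> \<noteq> 0
             then (\<Sum>m. indicator (J (Suc m) \<omega>) t * spider_point N \<bar>B t \<omega>\<bar> (\<kappa> (Suc m) \<omega>))
             else 0)))"


section \<open>Occupation times\<close>

text \<open>The functions below take a single trajectory as argument.\<close>

definition walk_occ :: "nat \<Rightarrow> (nat \<Rightarrow> complex) \<Rightarrow> nat \<Rightarrow> nat \<Rightarrow> real" where
  "walk_occ N s j n = (\<Sum>k=1..n. indicator (leg N j) (s k))"

definition walk_occ_max :: "nat \<Rightarrow> (nat \<Rightarrow> complex) \<Rightarrow> nat \<Rightarrow> real" where
  "walk_occ_max N s n = (MAX j\<in>{1..N}. walk_occ N s j n)"

definition walk_occ_min :: "nat \<Rightarrow> (nat \<Rightarrow> complex) \<Rightarrow> nat \<Rightarrow> real" where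
  "walk_occ_min N s n = (MIN j\<in>{1..N}. walk_occ N s j n)"

definition brownian_occ :: "nat \<Rightarrow> (real \<Rightarrow> complex) \<Rightarrow> nat \<Rightarrow> real \<Rightarrow> real" where
  "brownian_occ N w j t = (LINT s:{0..t}|lborel. indicator (leg N j) (w s))"

definition brownian_occ_max :: "nat \<Rightarrow> (real \<Rightarrow> complex) \<Rightarrow> real \<Rightarrow> real" where
  "brownian_occ_max N w t = (MAX j\<in>{1..N}. brownian_occ N w j t)"

definition brownian_occ_min :: "nat \<Rightarrow> (real \<Rightarrow> complex) \<Rightarrow> real \<Rightarrow> real" where
  "brownian_occ_min N w t = (MIN j\<in>{1..N}. brownian_occ N w j t)"

end

theory Submission
  imports Defs
begin

text \<open>
  The occupation times of the legs add up to the total time minus a negligible time spent at the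
  body, so the maximum is asymptotically at least \<open>1 / N\<close> and the minimum at most \<open>1 / N\<close> of the total.
  It remains to find arbitrarily late times at which all legs have been visited almost equally long.
  For this, both spiders are viewed as a signed process with independent increments (simple random
  walk or Brownian motion) whose excursions from zero carry independent labels. Look at the time
  windows between \<open>2 ^ (k ^ 2)\<close> and \<open>2 ^ ((k + 1) ^ 2)\<close>, each of which dwarfs the past. With a probability
  bounded below, and hence infinitely often, the process makes \<open>N\<close> excursions in such a window,
  of alternating signs and each lasting almost \<open>1 / N\<close> of the window. Given the signed process, these
  excursions bear the labels \<open>1, \<dots>, N\<close> with a fixed positive probability, independently
  for different windows, so this too happens infinitely often.
\<close>

section \<open>Oscillations of processes with independent increments\<close>

text \<open>Alternating signs make the labels of the bumps independent: on its way from a positive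
  to a negative value the path meets zero, so bumps of opposite sign lie in different excursions.
  Hence only increments over deterministic time intervals have to be prescribed, and zeros or
  stopping times need not be tracked. One obstacle is that the position at the start of a window
  depends on the past. The increments inside the window do not, and the position is eventually small
  compared with the scale of the window, so prescribed increments do prescribe signs. Another
  obstacle concerns the walk: it is given by its transition probabilities alone, and its probability
  space may carry neither a signed walk nor independent labels. A concrete model with these
  ingredients is therefore built on a product space, and the result is transferred by equality of
  laws. The gaps between the bumps have relative length \<theta>, and the bumps take a share
  \<open>1 / (N + (N + 1) * \<theta>)\<close> each; \<theta> tends to zero only at the very
  end.\<close>

definition generated_algebra :: "'a set \<Rightarrow> 'i set \<Rightarrow> ('i \<Rightarrow> 'a \<Rightarrow> real) \<Rightarrow> 'a measure" where
  "generated_algebra \<Omega> I X = sigma \<Omega> {X i -` A \<inter> \<Omega> | i A. i \<in> I \<and> A \<in> sets borel}"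

lemma space_generated_algebra [simp]: "space (generated_algebra \<Omega> I X) = \<Omega>"
  unfolding generated_algebra_def by (rule space_measure_of) auto

lemma sets_generated_algebra:
  "sets (generated_algebra \<Omega> I X) = sigma_sets \<Omega> {X i -` A \<inter> \<Omega> | i A. i \<in> I \<and> A \<in> sets borel}"
  unfolding generated_algebra_def by (rule sets_measure_of) auto

lemma measurable_generated_algebra:
  assumes "i \<in> I"
  shows "X i \<in> borel_measurable (generated_algebra \<Omega> I X)"
proof (rule measurableI)
  fix A :: "real set" assume "A \<in> sets borel"
  with assms show "X i -` A \<inter> space (generated_algebra \<Omega> I X) \<in> sets (generated_algebra \<Omega> I X)"
    unfolding sets_generated_algebra space_generated_algebra by (intro sigma_sets.Basic) auto
qed simp

lemma sets_generated_algebra_subset: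
  assumes "\<And>i. i \<in> I \<Longrightarrow> X i \<in> borel_measurable L" "space L = \<Omega>"
  shows "sets (generated_algebra \<Omega> I X) \<subseteq> sets L"
  unfolding sets_generated_algebra using assms
  by (intro sets.sigma_sets_subset'[of _ L, simplified]) (auto dest: measurable_sets)

text \<open>If \<open>g t\<close> lay outside \<open>C\<close>, right continuity would keep
  \<open>g\<close> outside \<open>C\<close> on some interval to the right of \<open>t\<close>, and
  this interval contains a rational.\<close>

lemma right_continuous_closed:
  fixes g :: "real \<Rightarrow> real"
  assumes "continuous (at_right t) g" "closed C" "t < v"
    and "\<And>q. q \<in> \<rat> \<Longrightarrow> t < q \<Longrightarrow> q < v \<Longrightarrow> g q \<in> C"
  shows "g t \<in> C"
proof (rule ccontr)
  assume "g t \<notin> C"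
  have "eventually (\<lambda>x. g x \<in> - C) (at_right t)"
    using assms(1,2) \<open>g t \<notin> C\<close> unfolding continuous_within
    by (intro topological_tendstoD[where l = "g t"]) auto
  then obtain b where b: "b > t" "\<And>y. y > t \<Longrightarrow> y < b \<Longrightarrow> g y \<notin> C"
    unfolding eventually_at_right_field by auto
  obtain q where "q \<in> \<rat>" "t < q" "q < min b v"
    using Rats_dense_in_real[of t "min b v"] b(1) assms(3) by auto
  with b(2)[of q] assms(4)[of q] show False by auto
qed

text \<open>Turns a condition over an uncountable interval into countably many: rational times
  suffice by right continuity, except that \<open>v\<close> has no point of the interval to its
  right and is added by hand.\<close>

lemma sets_right_continuous_closed:
  fixes g :: "real \<Rightarrow> 'a \<Rightarrow> real"
  assumes "\<And>t. t \<in> {u..v} \<Longrightarrow> g t \<in> borel_measurable L"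
    and "\<And>\<omega> t. \<omega> \<in> space L \<Longrightarrow> t \<in> {u..v} \<Longrightarrow> continuous (at_right t) (\<lambda>t. g t \<omega>)"
    and "closed C"
  shows "{\<omega>\<in>space L. \<forall>t\<in>{u..v}. g t \<omega> \<in> C} \<in> sets L"
proof -
  have "{\<omega>\<in>space L. \<forall>t\<in>{u..v}. g t \<omega> \<in> C} =
    {\<omega>\<in>space L. \<forall>t\<in>({u..v} \<inter> \<rat>) \<union> ({u..v} \<inter> {v}). g t \<omega> \<in> C}" (is "?A = ?B")
  proof
    show "?B \<subseteq> ?A"
    proof safe
      fix \<omega> t assume \<omega>: "\<omega> \<in> space L" "\<forall>t\<in>({u..v} \<inter> \<rat>) \<union> ({u..v} \<inter> {v}). g t \<omega> \<in> C" and t: "t \<in> {u..v}"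
      show "g t \<omega> \<in> C"
      proof (cases "t = v")
        case False
        with t have "t < v" by auto
        with assms(2)[OF \<omega>(1) t] \<omega> t show ?thesis
          by (intro right_continuous_closed[where t = t and v = v and C = C and g = "\<lambda>t. g t \<omega>"] assms(3)) auto
      qed (use \<omega> t in auto)
    qed
  qed auto
  also have "\<dots> = {\<omega>\<in>space L. \<forall>t\<in>{u..v} \<inter> \<rat>. g t \<omega> \<in> C} \<inter> {\<omega>\<in>space L. \<forall>t\<in>{u..v} \<inter> {v}. g t \<omega> \<in> C}"
    by auto
  also have "\<dots> \<in> sets L"
  proof (intro sets.Int)
    have "C \<in> sets borel" using assms(3) by auto
    then have *: "{\<omega>\<in>space L. g t \<omega> \<in> C} \<in> sets L" if "t \<in> {u..v}" for t
      using measurable_sets[OF assms(1)[OF that], of C] by (simp add: vimage_def Int_def conj_commute)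
    show "{\<omega>\<in>space L. \<forall>t\<in>{u..v} \<inter> \<rat>. g t \<omega> \<in> C} \<in> sets L"
      using countable_rat by (intro sets.sets_Collect_countable_All' *) auto
    show "{\<omega>\<in>space L. \<forall>t\<in>{u..v} \<inter> {v}. g t \<omega> \<in> C} \<in> sets L"
      by (intro sets.sets_Collect_countable_All' *) auto
  qed
  finally show ?thesis .
qed

text \<open>The common abstraction of Brownian motion and of simple random walk run in continuous
  time by rounding times down. The latter explains the form of the assumptions: paths are only right
  continuous, \<open>cheb\<close> has a \<open>+ 1\<close> because rounding can lengthen a time span
  by up to one, and \<open>lower\<close> speaks of long spans only, as a central limit theorem
  does.\<close>

locale indep_increments = prob_space M for M :: "'a measure" +
  fixes Y :: "real \<Rightarrow> 'a \<Rightarrow> real"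
  assumes rv: "\<And>t. t \<ge> 0 \<Longrightarrow> Y t \<in> borel_measurable M"
    and start: "\<And>\<omega>. \<omega> \<in> space M \<Longrightarrow> Y 0 \<omega> = 0"
    and right_cont: "\<And>\<omega> t. \<omega> \<in> space M \<Longrightarrow> t \<ge> 0 \<Longrightarrow> continuous (at_right t) (\<lambda>t. Y t \<omega>)"
    and indep: "\<And>s A C. s \<ge> 0 \<Longrightarrow> A \<in> sets (generated_algebra (space M) {0..s} Y) \<Longrightarrow>
          C \<in> sets (generated_algebra (space M) {s..} (\<lambda>t \<omega>. Y t \<omega> - Y s \<omega>)) \<Longrightarrow>
          prob (A \<inter> C) = prob A * prob C"
    and cheb: "\<And>s t a. 0 \<le> s \<Longrightarrow> s \<le> t \<Longrightarrow> a > 0 \<Longrightarrow>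
          prob {\<omega>\<in>space M. \<bar>Y t \<omega> - Y s \<omega>\<bar> \<ge> a} \<le> (t - s + 1) / a\<^sup>2"
    and lower: "\<And>a b. a < b \<Longrightarrow> \<exists>d>0. \<exists>H>0. \<forall>s t. 0 \<le> s \<longrightarrow> t - s \<ge> H \<longrightarrow>
          prob {\<omega>\<in>space M. a * sqrt (t - s) < Y t \<omega> - Y s \<omega> \<and> Y t \<omega> - Y s \<omega> < b * sqrt (t - s)} \<ge> d"
begin

abbreviation "past s \<equiv> generated_algebra (space M) {0..s} Y"
abbreviation "future s \<equiv> generated_algebra (space M) {s..} (\<lambda>t \<omega>. Y t \<omega> - Y s \<omega>)"

lemma past_measurable: "0 \<le> t \<Longrightarrow> t \<le> s \<Longrightarrow> Y t \<in> borel_measurable (past s)"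
  by (rule measurable_generated_algebra) auto

lemma future_measurable:
  assumes "s \<le> t" "s \<le> u"
  shows "(\<lambda>\<omega>. Y t \<omega> - Y u \<omega>) \<in> borel_measurable (future s)"
proof -
  have "(\<lambda>\<omega>. (Y t \<omega> - Y s \<omega>) - (Y u \<omega> - Y s \<omega>)) \<in> borel_measurable (future s)"
    using assms by (intro borel_measurable_diff measurable_generated_algebra) auto
  then show ?thesis by simp
qed

lemma past_subset: "sets (past s) \<subseteq> events"
  by (rule sets_generated_algebra_subset) (auto intro: rv)

lemma past_mono: "s \<le> t \<Longrightarrow> sets (past s) \<subseteq> sets (past t)"
  by (rule sets_generated_algebra_subset) (auto intro: past_measurable)

lemma future_subset: "s \<ge> 0 \<Longrightarrow> sets (future s) \<subseteq> events"
  by (rule sets_generated_algebra_subset) (auto intro!: borel_measurable_diff rv)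

text \<open>Ottaviani's argument: decompose according to the first exceedance of level \<open>2 * a\<close>.\<close>

lemma maximal_inequality_finite:
  fixes \<tau> :: "nat \<Rightarrow> real"
  assumes \<tau>: "\<tau> 0 \<ge> 0" "mono \<tau>" and q: "q < 1"
    and bound: "\<And>i. i \<le> n \<Longrightarrow> prob {\<omega>\<in>space M. \<bar>Y (\<tau> n) \<omega> - Y (\<tau> i) \<omega>\<bar> > a} \<le> q"
  shows "prob {\<omega>\<in>space M. \<exists>i\<le>n. \<bar>Y (\<tau> i) \<omega> - Y (\<tau> 0) \<omega>\<bar> > 2 * a} \<le> q / (1 - q)"
proof -
  have \<tau>0: "\<tau> i \<ge> 0" for i using \<tau> monoD[OF \<tau>(2), of 0 i] by simp
  define D where "D i \<omega> \<longleftrightarrow> \<bar>Y (\<tau> i) \<omega> - Y (\<tau> 0) \<omega>\<bar> > 2 * a" for i \<omega>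
  define A where "A i = {\<omega>\<in>space M. D i \<omega> \<and> (\<forall>j<i. \<not> D j \<omega>)}" for i
  define C where "C i = {\<omega>\<in>space M. \<not> \<bar>Y (\<tau> n) \<omega> - Y (\<tau> i) \<omega>\<bar> > a}" for i
  have A_past: "A i \<in> sets (past (\<tau> i))" for i
  proof -
    have [measurable]: "Y (\<tau> j) \<in> borel_measurable (past (\<tau> i))" if "j \<le> i" for j
      using that \<tau>0 monoD[OF \<tau>(2)] by (intro past_measurable) auto
    have D: "{\<omega>\<in>space (past (\<tau> i)). D j \<omega>} \<in> sets (past (\<tau> i))" if "j \<le> i" for j
      using that unfolding D_def by measurable
    have "A i = {\<omega>\<in>space (past (\<tau> i)). D i \<omega>} \<inter> {\<omega>\<in>space (past (\<tau> i)). \<forall>j\<in>{..<i}. \<not> D j \<omega>}"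
      by (auto simp: A_def)
    also have "\<dots> \<in> sets (past (\<tau> i))"
      by (intro sets.Int D sets.sets_Collect_finite_All sets.sets_Collect_neg) auto
    finally show ?thesis .
  qed
  then have [measurable]: "A i \<in> events" for i using past_subset by blast
  have C_future: "C i \<in> sets (future (\<tau> i))" if "i \<le> n" for i
  proof -
    have [measurable]: "(\<lambda>\<omega>. Y (\<tau> n) \<omega> - Y (\<tau> i) \<omega>) \<in> borel_measurable (future (\<tau> i))"
      using that monoD[OF \<tau>(2)] by (intro future_measurable) auto
    have "C i = {\<omega>\<in>space (future (\<tau> i)). \<not> \<bar>Y (\<tau> n) \<omega> - Y (\<tau> i) \<omega>\<bar> > a}"
      by (simp add: C_def)
    also have "\<dots> \<in> sets (future (\<tau> i))" by measurable
    finally show ?thesis .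
  qed
  have C_ev: "C i \<in> events" if "i \<le> n" for i
    using C_future[OF that] future_subset[OF \<tau>0] by blast
  have C_prob: "prob (C i) \<ge> 1 - q" if "i \<le> n" for i
  proof -
    have [measurable]: "Y (\<tau> j) \<in> borel_measurable M" for j using rv \<tau>0 by auto
    have "prob (C i) = 1 - prob {\<omega>\<in>space M. \<bar>Y (\<tau> n) \<omega> - Y (\<tau> i) \<omega>\<bar> > a}"
      unfolding C_def by (rule prob_neg) measurable
    with bound[OF that] show ?thesis by simp
  qed
  have disj: "disjoint_family_on A I" for I
    unfolding disjoint_family_on_def A_def by (auto, metis linorder_neqE_nat)
  have cover: "{\<omega>\<in>space M. \<exists>i\<le>n. D i \<omega>} = (\<Union>i\<le>n. A i)"
  proof (intro equalityI subsetI)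
    fix \<omega> assume "\<omega> \<in> {\<omega>\<in>space M. \<exists>i\<le>n. D i \<omega>}"
    then obtain i where i: "i \<le> n" "D i \<omega>" "\<omega> \<in> space M" by auto
    have "\<omega> \<in> A (LEAST i. D i \<omega>)"
      unfolding A_def using i(3) LeastI[of "\<lambda>i. D i \<omega>", OF i(2)] not_less_Least[of _ "\<lambda>i. D i \<omega>"]
      by blast
    moreover have "(LEAST i. D i \<omega>) \<le> n" using Least_le[of "\<lambda>i. D i \<omega>"] i by (meson le_trans)
    ultimately show "\<omega> \<in> (\<Union>i\<le>n. A i)" by auto
  qed (auto simp: A_def)
  have "prob (\<Union>i\<le>n. A i) * (1 - q) = (\<Sum>i\<le>n. prob (A i) * (1 - q))"
    by (subst finite_measure_finite_Union) (auto simp: disj sum_distrib_right)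
  also have "\<dots> \<le> (\<Sum>i\<le>n. prob (A i) * prob (C i))"
    using C_prob by (intro sum_mono mult_left_mono) auto
  also have "\<dots> = (\<Sum>i\<le>n. prob (A i \<inter> C i))"
    using indep[OF \<tau>0 A_past C_future] by (intro sum.cong) auto
  also have "\<dots> = prob (\<Union>i\<le>n. A i \<inter> C i)"
    using disj C_ev by (intro finite_measure_finite_Union[symmetric]) (auto simp: disjoint_family_on_def)
  \<comment> \<open>On \<open>A i\<close> the displacement exceeds \<open>2 * a\<close> at time
    \<open>\<tau> i\<close>, and on \<open>C i\<close> at most \<open>a\<close> of it is lost
    afterwards, so more than \<open>a\<close> remains at time \<open>\<tau> n\<close>.\<close>
  also have "\<dots> \<le> prob {\<omega>\<in>space M. \<bar>Y (\<tau> n) \<omega> - Y (\<tau> 0) \<omega>\<bar> > a}"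
  proof (rule finite_measure_mono)
    show "(\<Union>i\<le>n. A i \<inter> C i) \<subseteq> {\<omega>\<in>space M. \<bar>Y (\<tau> n) \<omega> - Y (\<tau> 0) \<omega>\<bar> > a}"
      unfolding A_def C_def D_def by auto
    have [measurable]: "Y (\<tau> j) \<in> borel_measurable M" for j using rv \<tau>0 by auto
    show "{\<omega>\<in>space M. \<bar>Y (\<tau> n) \<omega> - Y (\<tau> 0) \<omega>\<bar> > a} \<in> events" by measurable
  qed
  also have "\<dots> \<le> q" using bound[of 0] by simp
  finally have "prob {\<omega>\<in>space M. \<exists>i\<le>n. D i \<omega>} * (1 - q) \<le> q" unfolding cover .
  then show ?thesis using q unfolding D_def by (simp add: pos_le_divide_eq)
qed

lemma maximal_inequality_finite_set:
  assumes F: "finite F" "F \<subseteq> {u..v}" "u \<in> F" "v \<in> F" and u: "0 \<le> u" and q: "q < 1"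
    and bound: "\<And>t. t \<in> {u..v} \<Longrightarrow> prob {\<omega>\<in>space M. \<bar>Y v \<omega> - Y t \<omega>\<bar> > a} \<le> q"
  shows "prob {\<omega>\<in>space M. \<exists>t\<in>F. \<bar>Y t \<omega> - Y u \<omega>\<bar> > 2 * a} \<le> q / (1 - q)"
proof -
  define l where "l = sorted_list_of_set F"
  have l: "set l = F" "sorted l" "l \<noteq> []" using F by (auto simp: l_def)
  define n where "n = length l - 1"
  \<comment> \<open>Stopping the enumeration at its last index makes \<open>\<tau>\<close> monotone
    on all of the natural numbers.\<close>
  define \<tau> where "\<tau> i = l ! min i n" for i
  have len: "length l = Suc n" using l(3) by (simp add: n_def)
  have mono: "mono \<tau>"
    unfolding \<tau>_def using l(2) len by (intro monoI sorted_nth_mono) auto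
  have img: "F = \<tau> ` {..n}"
    unfolding l(1)[symmetric] set_conv_nth len \<tau>_def by (auto simp: less_Suc_eq_le image_iff min_def)
  have \<tau>F: "\<tau> i \<in> F" for i
    unfolding l(1)[symmetric] \<tau>_def by (rule nth_mem) (simp add: len)
  have "\<tau> 0 \<le> u"
    using img F(3) monoD[OF mono] by auto
  with \<tau>F[of 0] F(2) have \<tau>0: "\<tau> 0 = u" by force
  have "\<tau> n \<ge> v"
    using img F(4) monoD[OF mono] by auto
  with \<tau>F[of n] F(2) have \<tau>n: "\<tau> n = v" by force
  have "prob {\<omega>\<in>space M. \<exists>i\<le>n. \<bar>Y (\<tau> i) \<omega> - Y (\<tau> 0) \<omega>\<bar> > 2 * a} \<le> q / (1 - q)"
    using u \<tau>0 \<tau>n F(2) \<tau>F by (intro maximal_inequality_finite mono q) (auto simp: \<tau>n intro!: bound)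
  then show ?thesis unfolding img \<tau>0 by (simp add: Bex_def)
qed

text \<open>Finite sets containing both endpoints exhaust the countable set \<open>R\<close>;
  continuity of the measure from above passes to \<open>R\<close>, and right continuity passes from
  \<open>R\<close> to the whole interval. The endpoint \<open>v\<close> belongs to \<open>R\<close>
  because it cannot be approached from the right.\<close>

lemma maximal_inequality:
  assumes u: "0 \<le> u" "u \<le> v" and q: "q < 1"
    and bound: "\<And>t. t \<in> {u..v} \<Longrightarrow> prob {\<omega>\<in>space M. \<bar>Y v \<omega> - Y t \<omega>\<bar> > a} \<le> q"
  shows "prob {\<omega>\<in>space M. \<forall>t\<in>{u..v}. \<bar>Y t \<omega> - Y u \<omega>\<bar> \<le> 2 * a} \<ge> 1 - q / (1 - q)"
proof -
  define R where "R = {u,v} \<union> ({u..v} \<inter> \<rat>)"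
  have "countable R" unfolding R_def using countable_rat by auto
  define F where "F n = from_nat_into R ` {..n} \<union> {u,v}" for n
  have R: "R \<noteq> {}" by (auto simp: R_def)
  have F: "F n \<subseteq> R" for n
    using from_nat_into[OF R] unfolding F_def by (auto simp: R_def[THEN eqset_imp_iff])
  have UF: "(\<Union>n. F n) = R"
  proof
    show "R \<subseteq> (\<Union>n. F n)"
      using from_nat_into_surj[OF \<open>countable R\<close>] by (auto simp: F_def)
  qed (use F in auto)
  have RR: "R \<subseteq> {u..v}" using u by (auto simp: R_def)
  define A where "A n = {\<omega>\<in>space M. \<forall>t\<in>F n. \<bar>Y t \<omega> - Y u \<omega>\<bar> \<le> 2 * a}" for n
  have rv': "Y t \<in> borel_measurable M" if "t \<in> R" for t using that RR u rv by auto
  have A_ev: "A n \<in> events" for n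
  proof -
    have "{\<omega>\<in>space M. \<bar>Y t \<omega> - Y u \<omega>\<bar> \<le> 2 * a} \<in> events" if "t \<in> R" for t
    proof -
      have [measurable]: "Y t \<in> borel_measurable M" "Y u \<in> borel_measurable M"
        using rv'[OF that] rv'[of u] by (auto simp: R_def)
      show ?thesis by measurable
    qed
    then show ?thesis unfolding A_def using F[of n]
      by (intro sets.sets_Collect_finite_All) (auto simp: F_def)
  qed
  have A_prob: "prob (A n) \<ge> 1 - q / (1 - q)" for n
  proof -
    have "prob {\<omega>\<in>space M. \<exists>t\<in>F n. \<bar>Y t \<omega> - Y u \<omega>\<bar> > 2 * a} \<le> q / (1 - q)"
      using F[of n] RR u by (intro maximal_inequality_finite_set[where v = v] q bound) (auto simp: F_def)
    moreover have "{\<omega>\<in>space M. \<exists>t\<in>F n. \<bar>Y t \<omega> - Y u \<omega>\<bar> > 2 * a} = space M - A n"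
      by (auto simp: A_def not_le)
    ultimately show ?thesis using prob_compl[OF A_ev[of n]] by simp
  qed
  have "F m \<subseteq> F n" if "m \<le> n" for m n using that by (auto simp: F_def)
  then have "decseq A" unfolding decseq_def A_def by blast
  then have "(\<lambda>n. prob (A n)) \<longlonglongrightarrow> prob (\<Inter>n. A n)"
    using A_ev by (intro finite_Lim_measure_decseq) auto
  then have "prob (\<Inter>n. A n) \<ge> 1 - q / (1 - q)"
    using A_prob by (intro LIMSEQ_le_const) auto
  also have "(\<Inter>n. A n) = {\<omega>\<in>space M. \<forall>t\<in>{u..v}. \<bar>Y t \<omega> - Y u \<omega>\<bar> \<le> 2 * a}" (is "?L = ?R")
  proof
    show "?R \<subseteq> ?L" using F RR by (fastforce simp: A_def)
    have "\<bar>Y t \<omega> - Y u \<omega>\<bar> \<le> 2 * a" if \<omega>: "\<omega> \<in> ?L" and t: "t \<in> {u..v}" for \<omega> t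
    proof -
      have "\<forall>t\<in>R. \<bar>Y t \<omega> - Y u \<omega>\<bar> \<le> 2 * a" using \<omega> unfolding UF[symmetric] A_def by auto
      then have *: "Y t \<omega> - Y u \<omega> \<in> cball 0 (2 * a)" if "t \<in> R" for t
        using that unfolding mem_cball_0 real_norm_def by blast
      have sp: "\<omega> \<in> space M" using \<omega> by (auto simp: A_def)
      show "\<bar>Y t \<omega> - Y u \<omega>\<bar> \<le> 2 * a"
      proof (cases "t = v")
        case False
        with t have "t < v" by auto
        have "continuous (at_right t) (\<lambda>t. Y t \<omega> - Y u \<omega>)"
          using right_cont[OF sp, of t] t u by (intro continuous_diff continuous_const) auto
        moreover have "Y q \<omega> - Y u \<omega> \<in> cball 0 (2 * a)" if "q \<in> \<rat>" "t < q" "q < v" for q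
        proof (rule *)
          show "q \<in> R" using that t unfolding R_def by simp
        qed
        ultimately have "Y t \<omega> - Y u \<omega> \<in> cball 0 (2 * a)"
          using \<open>t < v\<close> by (rule_tac right_continuous_closed[OF _ closed_cball, where v = v])
        then show ?thesis by simp
      next
        case True
        then show ?thesis using *[of v] by (simp add: R_def)
      qed
    qed
    then show "?L \<subseteq> ?R" by (auto simp: A_def)
  qed
  finally show ?thesis .
qed

end

section \<open>Swings and rests: prescribing a path at the scale of one window\<close>

text \<open>In units of the scale, bump \<open>i\<close> occupies the interval from \<open>bump_start \<theta> i\<close> to \<open>bump_end \<theta> i\<close>: bump
  \<open>0\<close> is a single point that only serves to separate the window from the past, the others have length \<open>1\<close>,
  and each bump is preceded by a gap of length \<open>\<theta>\<close>.\<close>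

definition bump_end :: "real \<Rightarrow> nat \<Rightarrow> real" where
  "bump_end \<theta> i = \<theta> + real i * (1 + \<theta>)"

definition bump_start :: "real \<Rightarrow> nat \<Rightarrow> real" where
  "bump_start \<theta> i = bump_end \<theta> i - (if i = 0 then 0 else 1)"

lemma bump_0 [simp]: "bump_end \<theta> 0 = \<theta>" "bump_start \<theta> 0 = \<theta>"
  by (simp_all add: bump_end_def bump_start_def)

lemma bump_start_Suc: "bump_start \<theta> (Suc i) = bump_end \<theta> i + \<theta>"
  by (simp add: bump_end_def bump_start_def algebra_simps)

lemma bump_start_ge: "\<theta> \<ge> 0 \<Longrightarrow> bump_start \<theta> i \<ge> \<theta>"
  by (cases i) (auto simp: bump_start_Suc, auto simp: bump_end_def)

lemma bump_start_le_end: "bump_start \<theta> i \<le> bump_end \<theta> i"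
  by (simp add: bump_start_def)

lemma bump_end_mono: "\<theta> \<ge> 0 \<Longrightarrow> i \<le> j \<Longrightarrow> bump_end \<theta> i \<le> bump_end \<theta> j"
  unfolding bump_end_def by (intro add_left_mono mult_right_mono) auto

context indep_increments
begin

text \<open>The lower bound carries the path to the side of sign \<open>(-1) ^ i\<close>; the upper
  bound keeps the position under control for the later swings. Only the two ends of the gap before
  bump \<open>i\<close> enter, so the event concerns a single increment.\<close>

definition swing :: "real \<Rightarrow> nat \<Rightarrow> real \<Rightarrow> real \<Rightarrow> 'a set" where
  "swing \<theta> i w s = {\<omega>\<in>space M.
     8 * 3 ^ i * sqrt s < (-1) ^ i * (Y (w + bump_start \<theta> i * s) \<omega> - Y (w + (bump_start \<theta> i - \<theta>) * s) \<omega>) \<and>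
     (-1) ^ i * (Y (w + bump_start \<theta> i * s) \<omega> - Y (w + (bump_start \<theta> i - \<theta>) * s) \<omega>) < (8 * 3 ^ i + 1) * sqrt s}"

text \<open>The radius \<open>6 * sqrt s\<close> is twice \<open>3 * sqrt s\<close>: the maximal
  inequality doubles its level, and at level \<open>3 * sqrt s\<close> the bound of Chebyshev is
  small enough.\<close>

definition rest :: "real \<Rightarrow> nat \<Rightarrow> real \<Rightarrow> real \<Rightarrow> 'a set" where
  "rest \<theta> i w s = {\<omega>\<in>space M. \<forall>t\<in>{w + bump_start \<theta> i * s..w + bump_end \<theta> i * s}.
     \<bar>Y t \<omega> - Y (w + bump_start \<theta> i * s) \<omega>\<bar> \<le> 6 * sqrt s}"

definition oscillation :: "real \<Rightarrow> nat \<Rightarrow> real \<Rightarrow> real \<Rightarrow> 'a set" where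
  "oscillation \<theta> n w s = {\<omega>\<in>space M. \<forall>i\<le>n. \<omega> \<in> swing \<theta> i w s \<inter> rest \<theta> i w s}"

text \<open>Swings and rests each occur in two roles: as future events, they are independent of
  everything before their own time interval; as past events, they belong to what later swings and
  rests are independent of.\<close>

lemma swing_future:
  assumes "\<theta> > 0" "s > 0"
  shows "swing \<theta> i w s \<in> sets (future (w + (bump_start \<theta> i - \<theta>) * s))"
proof -
  have "w + (bump_start \<theta> i - \<theta>) * s \<le> w + bump_start \<theta> i * s"
    using assms by (simp add: mult_right_mono)
  then have [measurable]: "(\<lambda>\<omega>. Y (w + bump_start \<theta> i * s) \<omega> - Y (w + (bump_start \<theta> i - \<theta>) * s) \<omega>)
      \<in> borel_measurable (future (w + (bump_start \<theta> i - \<theta>) * s))"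
    by (intro future_measurable) auto
  have "swing \<theta> i w s = {\<omega>\<in>space (future (w + (bump_start \<theta> i - \<theta>) * s)).
     8 * 3 ^ i * sqrt s < (-1) ^ i * (Y (w + bump_start \<theta> i * s) \<omega> - Y (w + (bump_start \<theta> i - \<theta>) * s) \<omega>) \<and>
     (-1) ^ i * (Y (w + bump_start \<theta> i * s) \<omega> - Y (w + (bump_start \<theta> i - \<theta>) * s) \<omega>) < (8 * 3 ^ i + 1) * sqrt s}"
    by (simp add: swing_def)
  also have "\<dots> \<in> sets (future (w + (bump_start \<theta> i - \<theta>) * s))" by measurable
  finally show ?thesis .
qed

lemma swing_past:
  assumes "\<theta> > 0" "s > 0" "w \<ge> 0"
  shows "swing \<theta> i w s \<in> sets (past (w + bump_start \<theta> i * s))"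
proof -
  let ?a = "w + bump_start \<theta> i * s" and ?b = "w + (bump_start \<theta> i - \<theta>) * s"
  have "bump_start \<theta> i \<ge> \<theta>" using assms by (intro bump_start_ge) auto
  then have "0 \<le> ?b" "?b \<le> ?a" using assms by (auto simp: mult_right_mono)
  then have [measurable]: "Y ?a \<in> borel_measurable (past ?a)" "Y ?b \<in> borel_measurable (past ?a)"
    by (auto intro!: past_measurable)
  have "swing \<theta> i w s = {\<omega>\<in>space (past ?a).
     8 * 3 ^ i * sqrt s < (-1) ^ i * (Y ?a \<omega> - Y ?b \<omega>) \<and> (-1) ^ i * (Y ?a \<omega> - Y ?b \<omega>) < (8 * 3 ^ i + 1) * sqrt s}"
    by (simp add: swing_def)
  also have "\<dots> \<in> sets (past ?a)" by measurable
  finally show ?thesis .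
qed

lemma rest_sets:
  assumes "w + bump_start \<theta> i * s \<ge> 0" "space L = space M"
    "\<And>t. t \<in> {w + bump_start \<theta> i * s..w + bump_end \<theta> i * s} \<Longrightarrow>
      (\<lambda>\<omega>. Y t \<omega> - Y (w + bump_start \<theta> i * s) \<omega>) \<in> borel_measurable L"
  shows "rest \<theta> i w s \<in> sets L"
proof -
  have "rest \<theta> i w s = {\<omega>\<in>space L. \<forall>t\<in>{w + bump_start \<theta> i * s..w + bump_end \<theta> i * s}.
      Y t \<omega> - Y (w + bump_start \<theta> i * s) \<omega> \<in> cball 0 (6 * sqrt s)}"
    by (simp add: rest_def assms(2))
  also have "\<dots> \<in> sets L"
    using assms by (intro sets_right_continuous_closed[OF assms(3)] continuous_diff right_cont) auto
  finally show ?thesis .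
qed

lemma rest_future:
  assumes "\<theta> > 0" "s > 0" "w \<ge> 0"
  shows "rest \<theta> i w s \<in> sets (future (w + bump_start \<theta> i * s))"
  using assms bump_start_ge[of \<theta> i] by (intro rest_sets future_measurable) auto

lemma rest_past:
  assumes "\<theta> > 0" "s > 0" "w \<ge> 0"
  shows "rest \<theta> i w s \<in> sets (past (w + bump_end \<theta> i * s))"
proof -
  have "0 \<le> bump_start \<theta> i * s" "bump_start \<theta> i * s \<le> bump_end \<theta> i * s"
    using assms bump_start_ge[of \<theta> i] bump_start_le_end[of \<theta> i] by (auto intro: mult_right_mono)
  then show ?thesis
    using assms by (intro rest_sets borel_measurable_diff past_measurable) auto
qed

text \<open>The gap has length \<open>\<theta> * s\<close>, so the bounds in units of
  \<open>sqrt s\<close> are divided by \<open>sqrt \<theta>\<close> before \<open>lower\<close>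
  applies. For odd \<open>i\<close> the sign exchanges the two bounds.\<close>

lemma swing_lower:
  assumes "\<theta> > 0"
  shows "\<exists>d>0. \<exists>H>0. \<forall>w s. w \<ge> 0 \<longrightarrow> s \<ge> H \<longrightarrow> prob (swing \<theta> i w s) \<ge> d"
proof -
  define m :: real where "m = 8 * 3 ^ i"
  define a where "a = (if even i then m / sqrt \<theta> else - (m + 1) / sqrt \<theta>)"
  define b where "b = (if even i then (m + 1) / sqrt \<theta> else - m / sqrt \<theta>)"
  have "a < b" using assms by (auto simp: a_def b_def field_simps)
  from lower[OF this] obtain d H where d: "d > 0" "H > 0"
    and *: "\<And>s t. 0 \<le> s \<Longrightarrow> t - s \<ge> H \<Longrightarrow>
      prob {\<omega>\<in>space M. a * sqrt (t - s) < Y t \<omega> - Y s \<omega> \<and> Y t \<omega> - Y s \<omega> < b * sqrt (t - s)} \<ge> d"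
    by blast
  have "prob (swing \<theta> i w s) \<ge> d" if "w \<ge> 0" "s \<ge> H / \<theta>" for w s
  proof -
    let ?t = "w + bump_start \<theta> i * s" and ?s = "w + (bump_start \<theta> i - \<theta>) * s"
    have "s > 0" using that d assms by (smt (verit) divide_pos_pos)
    have l: "?t - ?s = \<theta> * s" by (simp add: algebra_simps)
    have l1: "sqrt (?t - ?s) = sqrt \<theta> * sqrt s" unfolding l by (rule real_sqrt_mult)
    have ab: "a * (sqrt \<theta> * sqrt s) = (if even i then m * sqrt s else - ((m + 1) * sqrt s))"
      "b * (sqrt \<theta> * sqrt s) = (if even i then (m + 1) * sqrt s else - (m * sqrt s))"
      using assms by (auto simp: a_def b_def) (simp add: algebra_simps)
    have eq: "swing \<theta> i w s = {\<omega>\<in>space M. a * sqrt (?t - ?s) < Y ?t \<omega> - Y ?s \<omega> \<and> Y ?t \<omega> - Y ?s \<omega> < b * sqrt (?t - ?s)}"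
      unfolding swing_def l1 ab m_def[symmetric] by auto
    have "?s \<ge> 0" using that bump_start_ge[of \<theta> i] assms \<open>s > 0\<close> by auto
    moreover have "?t - ?s \<ge> H" unfolding l using that assms by (simp add: field_simps)
    ultimately show ?thesis unfolding eq by (rule *)
  qed
  then show ?thesis using d assms by (intro exI[of _ d] exI[of _ "H / \<theta>"] conjI) auto
qed

lemma rest_lower:
  assumes "\<theta> > 0" "s \<ge> 1" "w \<ge> 0"
  shows "prob (rest \<theta> i w s) \<ge> 1 / 2"
proof -
  let ?u = "w + bump_start \<theta> i * s" and ?v = "w + bump_end \<theta> i * s"
  have u: "0 \<le> ?u" using assms bump_start_ge[of \<theta> i] by simp
  have uv: "?u \<le> ?v" using assms bump_start_le_end[of \<theta> i] by (simp add: mult_right_mono)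
  have len: "?v - ?u \<le> s" using assms by (simp add: bump_start_def left_diff_distrib)
  \<comment> \<open>The remaining time is at most \<open>s\<close>, and the \<open>+ 1\<close> of
    \<open>cheb\<close> is absorbed by \<open>s \<ge> 1\<close>, so that the tail bound is
    \<open>2 * s / (9 * s)\<close>. The result \<open>1 - 2 / 7\<close> exceeds one half.\<close>
  have "prob {\<omega>\<in>space M. \<forall>t\<in>{?u..?v}. \<bar>Y t \<omega> - Y ?u \<omega>\<bar> \<le> 2 * (3 * sqrt s)} \<ge> 1 - (2 / 9) / (1 - 2 / 9)"
  proof (rule maximal_inequality[OF u uv])
    fix t assume t: "t \<in> {?u..?v}"
    have [measurable]: "Y t \<in> borel_measurable M" "Y ?v \<in> borel_measurable M"
      using t u by (auto intro!: rv)
    have "prob {\<omega>\<in>space M. \<bar>Y ?v \<omega> - Y t \<omega>\<bar> > 3 * sqrt s} \<le> prob {\<omega>\<in>space M. \<bar>Y ?v \<omega> - Y t \<omega>\<bar> \<ge> 3 * sqrt s}"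
      by (intro finite_measure_mono) auto
    also have "\<dots> \<le> (?v - t + 1) / (3 * sqrt s)\<^sup>2"
      using t u assms by (intro cheb) auto
    also have "\<dots> \<le> 2 / 9"
      using t len assms by (auto simp: power_mult_distrib field_simps)
    finally show "prob {\<omega>\<in>space M. \<bar>Y ?v \<omega> - Y t \<omega>\<bar> > 3 * sqrt s} \<le> 2 / 9" .
  qed simp
  then show ?thesis unfolding rest_def by simp
qed

lemma oscillation_0: "oscillation \<theta> 0 w s = swing \<theta> 0 w s \<inter> rest \<theta> 0 w s"
  by (auto simp: oscillation_def swing_def)

lemma oscillation_Suc:
  "oscillation \<theta> (Suc n) w s = oscillation \<theta> n w s \<inter> swing \<theta> (Suc n) w s \<inter> rest \<theta> (Suc n) w s"
  by (auto simp: oscillation_def le_Suc_eq)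

lemma oscillation_past:
  assumes "\<theta> > 0" "s > 0" "w \<ge> 0" "bump_end \<theta> n * s + w \<le> r"
  shows "oscillation \<theta> n w s \<in> sets (past r)"
proof -
  have le: "w + bump_end \<theta> i * s \<le> r" "w + bump_start \<theta> i * s \<le> r" if "i \<le> n" for i
    using assms mult_right_mono[OF bump_start_le_end[of \<theta> i], of s]
      mult_right_mono[OF bump_end_mono[OF _ that, of \<theta>], of s] by linarith+
  have "swing \<theta> i w s \<inter> rest \<theta> i w s \<in> sets (past r)" if "i \<le> n" for i
    using swing_past[of \<theta> s w i] rest_past[of \<theta> s w i] past_mono[OF le(1)[OF that]] past_mono[OF le(2)[OF that]] assms
    by (intro sets.Int) auto
  moreover have "oscillation \<theta> n w s = (\<Inter>i\<in>{..n}. swing \<theta> i w s \<inter> rest \<theta> i w s)"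
    by (auto simp: oscillation_def swing_def)
  ultimately show ?thesis by (auto intro!: sets.finite_INT)
qed

text \<open>Gaps and bumps follow one another without interruption, so each swing contributes a
  factor \<open>d\<close> and each rest a factor \<open>1 / 2\<close>. The arbitrary past event
  \<open>F\<close> makes this a lower bound conditional on the past, uniform in the starting time,
  which is what the recurrence argument consumes.\<close>

lemma oscillation_lower:
  assumes "\<theta> > 0"
  shows "\<exists>c>0. \<exists>H\<ge>1. \<forall>w s F. w \<ge> 0 \<longrightarrow> s \<ge> H \<longrightarrow> F \<in> sets (past w) \<longrightarrow>
    prob (F \<inter> oscillation \<theta> n w s) \<ge> c * prob F"
proof (induction n)
  case 0
  obtain d H where d: "d > 0" "H > 0"
    and *: "\<And>w s. w \<ge> 0 \<Longrightarrow> s \<ge> H \<Longrightarrow> prob (swing \<theta> 0 w s) \<ge> d"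
    using swing_lower[OF assms, of 0] by blast
  have "prob (F \<inter> oscillation \<theta> 0 w s) \<ge> (d / 2) * prob F"
    if w: "w \<ge> 0" and s: "s \<ge> max H 1" and F: "F \<in> sets (past w)" for w s F
  proof -
    have sp: "s > 0" using s by auto
    have "prob (F \<inter> swing \<theta> 0 w s) = prob F * prob (swing \<theta> 0 w s)"
      using swing_future[OF assms sp, of 0 w] w F by (intro indep) auto
    also have "\<dots> \<ge> prob F * d" using * w s by (intro mult_left_mono) auto
    finally have 1: "prob (F \<inter> swing \<theta> 0 w s) \<ge> d * prob F" by (simp add: mult.commute)
    have "F \<in> sets (past (w + bump_start \<theta> 0 * s))"
      using F past_mono[of w "w + bump_start \<theta> 0 * s"] sp assms by auto
    then have "prob ((F \<inter> swing \<theta> 0 w s) \<inter> rest \<theta> 0 w s) = prob (F \<inter> swing \<theta> 0 w s) * prob (rest \<theta> 0 w s)"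
      using swing_past[OF assms sp w, of 0] rest_future[OF assms sp w, of 0] w sp assms by (intro indep) auto
    also have "\<dots> \<ge> (d * prob F) * (1 / 2)"
      using 1 rest_lower[OF assms, of s w 0] s w d by (intro mult_mono) auto
    finally show ?thesis unfolding oscillation_0 by (simp add: Int_assoc)
  qed
  then show ?case using d by (intro exI[of _ "d / 2"] exI[of _ "max H 1"] conjI) auto
next
  case (Suc n)
  obtain c H' where c: "c > 0" "H' \<ge> 1"
    and IH: "\<And>w s F. w \<ge> 0 \<Longrightarrow> s \<ge> H' \<Longrightarrow> F \<in> sets (past w) \<Longrightarrow>
      prob (F \<inter> oscillation \<theta> n w s) \<ge> c * prob F" using Suc by blast
  obtain d H where d: "d > 0" "H > 0"
    and *: "\<And>w s. w \<ge> 0 \<Longrightarrow> s \<ge> H \<Longrightarrow> prob (swing \<theta> (Suc n) w s) \<ge> d"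
    using swing_lower[OF assms, of "Suc n"] by blast
  have "prob (F \<inter> oscillation \<theta> (Suc n) w s) \<ge> (c * d / 2) * prob F"
    if w: "w \<ge> 0" and s: "s \<ge> max H H'" and F: "F \<in> sets (past w)" for w s F
  proof -
    have sp: "s > 0" using s d by auto
    let ?F = "F \<inter> oscillation \<theta> n w s"
    let ?v = "w + bump_end \<theta> n * s" and ?u = "w + bump_start \<theta> (Suc n) * s"
    have be: "bump_end \<theta> n \<ge> 0" using assms by (simp add: bump_end_def)
    have le: "w \<le> ?v" "?v \<le> ?u" using sp be assms by (auto simp: bump_start_Suc mult_right_mono)
    have v: "w + (bump_start \<theta> (Suc n) - \<theta>) * s = ?v" by (simp add: bump_start_Suc)
    have Fv: "?F \<in> sets (past ?v)"
      using oscillation_past[of \<theta> s w n ?v] F past_mono[OF le(1)] assms sp w by auto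
    have 0: "prob ?F \<ge> c * prob F" using IH[OF w _ F] s by auto
    have "prob (?F \<inter> swing \<theta> (Suc n) w s) = prob ?F * prob (swing \<theta> (Suc n) w s)"
      using swing_future[OF assms sp, of "Suc n" w] w le Fv unfolding v by (intro indep) auto
    also have "\<dots> \<ge> (c * prob F) * d" using * w s 0 c d by (intro mult_mono) auto
    finally have 1: "prob (?F \<inter> swing \<theta> (Suc n) w s) \<ge> c * prob F * d" .
    have "prob ((?F \<inter> swing \<theta> (Suc n) w s) \<inter> rest \<theta> (Suc n) w s) = prob (?F \<inter> swing \<theta> (Suc n) w s) * prob (rest \<theta> (Suc n) w s)"
      using Fv past_mono[OF le(2)] swing_past[OF assms sp w, of "Suc n"] rest_future[OF assms sp w, of "Suc n"] w le
      by (intro indep) auto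
    also have "\<dots> \<ge> (c * prob F * d) * (1 / 2)"
      using 1 rest_lower[OF assms, of s w "Suc n"] s w d c by (intro mult_mono) auto
    finally show ?thesis unfolding oscillation_Suc by (simp add: Int_assoc algebra_simps)
  qed
  then show ?case using c d by (intro exI[of _ "c * d / 2"] exI[of _ "max H H'"] conjI) auto
qed

text \<open>The constants \<open>8 * 3 ^ i\<close> ensure that each swing overrides the position reached before.\<close>

lemma oscillation_bumps:
  assumes osc: "\<omega> \<in> oscillation \<theta> n w s" and w: "\<bar>Y w \<omega>\<bar> \<le> sqrt s" and "s > 0" "i \<le> n"
    and t: "t \<in> {w + bump_start \<theta> i * s..w + bump_end \<theta> i * s}"
  shows "(-1) ^ i * Y t \<omega> \<ge> sqrt s"
proof -
  define r where "r = sqrt s"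
  have "r > 0" using \<open>s > 0\<close> by (simp add: r_def)
  let ?p = "\<lambda>i. w + (bump_start \<theta> i - \<theta>) * s" and ?u = "\<lambda>i. w + bump_start \<theta> i * s"
  have sw: "8 * 3 ^ i * r < (-1) ^ i * (Y (?u i) \<omega> - Y (?p i) \<omega>)"
      "(-1) ^ i * (Y (?u i) \<omega> - Y (?p i) \<omega>) < (8 * 3 ^ i + 1) * r"
    and rs: "\<And>t. t \<in> {?u i..w + bump_end \<theta> i * s} \<Longrightarrow> \<bar>Y t \<omega> - Y (?u i) \<omega>\<bar> \<le> 6 * r" if "i \<le> n" for i
    using osc that by (auto simp: oscillation_def swing_def rest_def r_def)
  have split_sign: "(-1 :: real) ^ i = 1 \<or> (-1 :: real) ^ i = -1" for i by (simp add: minus_one_power_iff)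
  \<comment> \<open>In units of \<open>r\<close>, a swing adds at most \<open>8 * 3 ^ i + 1\<close>
    and a rest at most \<open>6\<close>, so the distance from zero after bump \<open>i\<close> is at
    most \<open>16 * 3 ^ i\<close>. This is at most \<open>8 * 3 ^ Suc i - 7\<close> because
    \<open>8 * 3 ^ i \<ge> 7\<close>. For \<open>i = 0\<close> the bound is the assumption on the
    position at time \<open>w\<close>.\<close>
  have pos: "\<bar>Y (?p i) \<omega>\<bar> \<le> (8 * 3 ^ i - 7) * r" if "i \<le> n" for i
    using that
  proof (induction i)
    case 0
    then show ?case using w by (simp add: r_def)
  next
    case (Suc i)
    have p: "?p (Suc i) = w + bump_end \<theta> i * s" by (simp add: bump_start_Suc)
    have "i \<le> n" using Suc.prems by simp
    note a = Suc.IH[OF this] sw[OF this]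
    have "bump_start \<theta> i * s \<le> bump_end \<theta> i * s"
      using \<open>s > 0\<close> bump_start_le_end[of \<theta> i] by (simp add: mult_right_mono)
    then have b: "\<bar>Y (?p (Suc i)) \<omega> - Y (?u i) \<omega>\<bar> \<le> 6 * r"
      unfolding p by (intro rs[OF \<open>i \<le> n\<close>]) auto
    define m where "m = 3 ^ i * r"
    have "m \<ge> r" unfolding m_def using \<open>r > 0\<close> by simp
    have "\<bar>Y (?u i) \<omega>\<bar> \<le> 16 * m - 6 * r"
      using a split_sign[of i] unfolding left_diff_distrib distrib_right mult.assoc m_def[symmetric] by auto
    with b have "\<bar>Y (?p (Suc i)) \<omega>\<bar> \<le> 16 * m" by auto
    also have "\<dots> \<le> 24 * m - 7 * r" using \<open>m \<ge> r\<close> \<open>r > 0\<close> by auto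
    also have "\<dots> = (8 * 3 ^ Suc i - 7) * r" by (simp add: m_def algebra_simps)
    finally show ?case .
  qed
  define m where "m = 3 ^ i * r"
  \<comment> \<open>The swing exceeds the bound on the previous position by \<open>7 * r\<close>;
    the following rest can undo at most \<open>6 * r\<close> of it.\<close>
  have "(-1) ^ i * Y (?u i) \<omega> \<ge> 7 * r"
    using pos[OF \<open>i \<le> n\<close>] sw[OF \<open>i \<le> n\<close>] split_sign[of i]
    unfolding left_diff_distrib distrib_right mult.assoc m_def[symmetric] by auto
  then have "(-1) ^ i * Y t \<omega> \<ge> r"
    using rs[OF \<open>i \<le> n\<close> t] split_sign[of i] by auto
  then show ?thesis by (simp add: r_def)
qed

end

section \<open>Superexponentially growing windows and their scales\<close>

definition window :: "nat \<Rightarrow> nat" where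
  "window k = 2 ^ (k\<^sup>2)"

text \<open>The length of one bump in window \<open>k\<close>, chosen such that bump
  \<open>N\<close> ends exactly at the next window time.\<close>

definition scale :: "nat \<Rightarrow> real \<Rightarrow> nat \<Rightarrow> real" where
  "scale N \<theta> k = (real (window (Suc k)) - real (window k)) / bump_end \<theta> N"

text \<open>The quotient of consecutive window times does not merely tend to infinity: its inverses
  are summable, as the Borel-Cantelli lemma requires later. This is the reason for a square in the
  exponent.\<close>

lemma window_Suc: "window (Suc k) = window k * 2 ^ (2 * k + 1)"
  by (simp add: window_def power2_eq_square power_add[symmetric])

lemma window_pos [simp]: "window k > 0" by (simp add: window_def)

lemma bump_end_pos: "\<theta> > 0 \<Longrightarrow> bump_end \<theta> N > 0"
  by (simp add: bump_end_def add_pos_nonneg)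

lemma window_scale: "\<theta> > 0 \<Longrightarrow> real (window k) + bump_end \<theta> N * scale N \<theta> k = real (window (Suc k))"
  using bump_end_pos[of \<theta> N] by (simp add: scale_def)

lemma scale_lower:
  assumes "\<theta> > 0"
  shows "scale N \<theta> k \<ge> real (window k) * 4 ^ k / bump_end \<theta> N"
proof -
  have "(2 :: real) ^ (2 * k) = 4 ^ k" by (simp add: power_mult)
  then have "real (window (Suc k)) - real (window k) = real (window k) * (2 * 4 ^ k - 1)"
    by (simp add: window_Suc right_diff_distrib)
  also have "\<dots> \<ge> real (window k) * 4 ^ k" by (intro mult_left_mono) auto
  finally show ?thesis
    unfolding scale_def using bump_end_pos[OF assms, of N] by (intro divide_right_mono) auto
qed

lemma scale_pos: "\<theta> > 0 \<Longrightarrow> scale N \<theta> k > 0"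
  by (rule less_le_trans[OF _ scale_lower]) (auto simp: bump_end_pos)

lemma scale_at_top:
  assumes "\<theta> > 0"
  shows "filterlim (scale N \<theta>) at_top sequentially"
proof (rule filterlim_at_top_mono)
  show "filterlim (\<lambda>k. real k / bump_end \<theta> N) at_top sequentially"
    unfolding divide_inverse using bump_end_pos[OF assms, of N] filterlim_real_sequentially
    by (subst mult.commute) (intro filterlim_tendsto_pos_mult_at_top[OF tendsto_const], auto)
  show "eventually (\<lambda>k. real k / bump_end \<theta> N \<le> scale N \<theta> k) sequentially"
  proof (rule always_eventually, rule)
    fix k
    have "real k \<le> 4 ^ k" by (rule order.trans[OF less_imp_le[OF of_nat_less_two_power] power_mono]) auto
    also have "\<dots> \<le> real (window k) * 4 ^ k" using window_pos[of k] by (simp add: Suc_le_eq)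
    finally have "real k / bump_end \<theta> N \<le> real (window k) * 4 ^ k / bump_end \<theta> N"
      using bump_end_pos[OF assms, of N] by (intro divide_right_mono) auto
    then show "real k / bump_end \<theta> N \<le> scale N \<theta> k" using scale_lower[OF assms, of k N] by linarith
  qed
qed

text \<open>The asymptotic share of one bump in the total time elapsed at the end of its window. The
  \<open>- 1\<close> allows for discrete time, where an interval of length \<open>s\<close> is only
  sure to contain \<open>s - 1\<close> integers.\<close>

lemma scale_ratio:
  assumes "\<theta> > 0"
  shows "(\<lambda>k. (scale N \<theta> k - 1) / real (window (Suc k))) \<longlonglongrightarrow> 1 / bump_end \<theta> N"
proof -
  let ?b = "bump_end \<theta> N"
  have b: "?b > 0" by (rule bump_end_pos[OF assms])
  have eq: "(scale N \<theta> k - 1) / real (window (Suc k)) = (1 - (1 / 2) ^ (2 * k + 1)) / ?b - inverse (real (window (Suc k)))" for k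
    unfolding scale_def window_Suc using b by (simp add: field_simps)
  have "(\<lambda>k. 1 / 2 * (1 / 4 :: real) ^ k) \<longlonglongrightarrow> 1 / 2 * 0"
    by (intro tendsto_intros LIMSEQ_realpow_zero) auto
  then have "(\<lambda>k. (1 / 2 :: real) ^ (2 * k + 1)) \<longlonglongrightarrow> 0"
    by (simp add: power_mult power2_eq_square)
  moreover have "(\<lambda>k. inverse (real (window (Suc k)))) \<longlonglongrightarrow> 0"
  proof (rule tendsto_inverse_0_at_top, rule filterlim_at_top_mono[OF filterlim_real_sequentially], rule always_eventually, rule)
    fix k
    have "real k \<le> 2 ^ k" by (rule less_imp_le[OF of_nat_less_two_power])
    also have "\<dots> \<le> real (window (Suc k))"
      unfolding window_def of_nat_power of_nat_numeral
      by (intro power_increasing) (auto simp: power2_eq_square)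
    finally show "real k \<le> real (window (Suc k))" .
  qed
  ultimately have "(\<lambda>k. (1 - (1 / 2) ^ (2 * k + 1)) / ?b - inverse (real (window (Suc k)))) \<longlonglongrightarrow> (1 - 0) / ?b - 0"
    by (intro tendsto_intros)
       (use b in auto)
  then show ?thesis unfolding eq by simp
qed

text \<open>In contrast to \<open>oscillation\<close>, this is a condition on the positions of a
  single path, not on increments; it is all that the pathwise arguments about labels use.\<close>

definition good_window :: "nat \<Rightarrow> real \<Rightarrow> (real \<Rightarrow> real) \<Rightarrow> nat \<Rightarrow> bool" where
  "good_window N \<theta> f k \<longleftrightarrow> (\<forall>i\<le>N. \<forall>t\<in>{real (window k) + bump_start \<theta> i * scale N \<theta> k..
     real (window k) + bump_end \<theta> i * scale N \<theta> k}. (-1) ^ i * f t \<ge> sqrt (scale N \<theta> k))"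

section \<open>Almost sure recurrence of good windows\<close>

context indep_increments
begin

text \<open>A conditional form of the second Borel-Cantelli lemma: whatever happened before a late
  window, the oscillation fails there with conditional probability at most \<open>1 - c\<close>, so
  \<open>m\<close> failures in a row have probability at most \<open>(1 - c) ^ m\<close>.\<close>

lemma AE_frequently_oscillation:
  assumes \<theta>: "\<theta> > 0"
  shows "AE \<omega> in M. \<exists>\<^sub>F k in sequentially. \<omega> \<in> oscillation \<theta> N (real (window k)) (scale N \<theta> k)"
proof -
  define E where "E k = oscillation \<theta> N (real (window k)) (scale N \<theta> k)" for k
  obtain c H where c: "c > 0" "H \<ge> 1"
    and lb: "\<And>w s F. w \<ge> 0 \<Longrightarrow> s \<ge> H \<Longrightarrow> F \<in> sets (past w) \<Longrightarrow>
      prob (F \<inter> oscillation \<theta> N w s) \<ge> c * prob F"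
    using oscillation_lower[OF \<theta>, of N] by blast
  obtain k0 where k0: "\<And>k. k \<ge> k0 \<Longrightarrow> scale N \<theta> k \<ge> H"
    using scale_at_top[OF \<theta>, of N] unfolding filterlim_at_top eventually_sequentially by blast
  have E_past: "E k \<in> sets (past (real (window (Suc k))))" for k
    unfolding E_def using \<theta> scale_pos[OF \<theta>] window_scale[OF \<theta>, of k N]
    by (intro oscillation_past) (auto simp: algebra_simps)
  have E_ev: "E k \<in> events" for k using E_past past_subset by blast
  define F where "F n m = {\<omega>\<in>space M. \<forall>k\<in>{n..<n + m}. \<omega> \<notin> E k}" for n m
  have wm: "real (window (n + m)) \<le> real (window (Suc (n + m)))" for n m
    unfolding of_nat_le_iff window_def by (intro power_increasing power_mono) auto
  have F_past: "F n m \<in> sets (past (real (window (n + m))))" for n m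
  proof (induction m)
    case 0
    have "F n 0 = space (past (real (window (n + 0))))" by (simp add: F_def)
    then show ?case by (metis sets.top)
  next
    case (Suc m)
    have "F n (Suc m) = F n m - E (n + m)" by (auto simp: F_def less_Suc_eq)
    then show ?case using Suc past_mono[OF wm, of n m] E_past[of "n + m"] by auto
  qed
  have F_ev: "F n m \<in> events" for n m using F_past past_subset by blast
  have F_prob: "prob (F n m) \<le> (1 - c) ^ m" if n: "n \<ge> k0" and "c \<le> 1" for n m
  proof (induction m)
    case (Suc m)
    have "F n (Suc m) = F n m - F n m \<inter> E (n + m)" by (auto simp: F_def less_Suc_eq)
    then have "prob (F n (Suc m)) = prob (F n m) - prob (F n m \<inter> E (n + m))"
      using F_ev E_ev by (simp add: finite_measure_Diff)
    moreover have "prob (F n m \<inter> E (n + m)) \<ge> c * prob (F n m)"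
      unfolding E_def using F_past k0 n by (intro lb) auto
    ultimately have "prob (F n (Suc m)) \<le> (1 - c) * prob (F n m)" by (simp add: algebra_simps)
    also have "\<dots> \<le> (1 - c) * (1 - c) ^ m" using Suc that by (intro mult_left_mono) auto
    finally show ?case by simp
  qed simp
  \<comment> \<open>Multiplication by \<open>1 - c\<close> in the induction above needs this sign
    condition; it results from applying the lower bound to the sure event.\<close>
  have "c \<le> 1"
  proof -
    have "c * prob (space M) \<le> prob (space M \<inter> oscillation \<theta> N 0 H)"
      using sets.top[of "past 0"] c by (intro lb) auto
    also have "\<dots> \<le> 1" by simp
    finally show ?thesis by (simp add: prob_space)
  qed
  have "AE \<omega> in M. \<exists>k\<ge>n. \<omega> \<in> E k" if n: "n \<ge> k0" for n
  proof -
    have "(\<lambda>m. prob (F n m)) \<longlonglongrightarrow> prob (\<Inter>m. F n m)"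
      using F_ev by (intro finite_Lim_measure_decseq) (auto simp: decseq_def F_def)
    moreover have "(\<lambda>m. prob (F n m)) \<longlonglongrightarrow> 0"
    proof (rule tendsto_sandwich[OF _ _ tendsto_const])
      show "(\<lambda>m. (1 - c) ^ m) \<longlonglongrightarrow> 0" using c \<open>c \<le> 1\<close> by (intro LIMSEQ_realpow_zero) auto
    qed (use F_prob[OF n \<open>c \<le> 1\<close>] in auto)
    ultimately have 0: "prob (\<Inter>m. F n m) = 0" by (rule LIMSEQ_unique)
    have "(\<Inter>m. F n m) \<in> null_sets M"
      using F_ev 0 by (intro null_setsI) (auto simp: emeasure_eq_measure)
    then have "AE \<omega> in M. \<omega> \<notin> (\<Inter>m. F n m)" by (rule AE_not_in)
    moreover have "\<exists>k\<ge>n. \<omega> \<in> E k" if "\<omega> \<notin> (\<Inter>m. F n m)" "\<omega> \<in> space M" for \<omega>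
      using that by (auto simp: F_def)
    ultimately show ?thesis using AE_space by (auto elim!: AE_mp)
  qed
  then have "AE \<omega> in M. \<forall>n\<in>{k0..}. \<exists>k\<ge>n. \<omega> \<in> E k"
    by (subst AE_ball_countable) auto
  then show ?thesis
  proof eventually_elim
    fix \<omega> assume *: "\<forall>n\<in>{k0..}. \<exists>k\<ge>n. \<omega> \<in> E k"
    show "\<exists>\<^sub>F k in sequentially. \<omega> \<in> oscillation \<theta> N (real (window k)) (scale N \<theta> k)"
      unfolding frequently_sequentially E_def[symmetric]
    proof
      fix n
      show "\<exists>k\<ge>n. \<omega> \<in> E k" using bspec[OF *, of "max n k0"] by auto
    qed
  qed
qed

text \<open>Up to time \<open>window k\<close> the bound \<open>cheb\<close> is of the order of
  \<open>window k\<close>, while the scale is at least of the order of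
  \<open>window k * 4 ^ k\<close>. The resulting tail probabilities are summable, and the first
  Borel-Cantelli lemma applies.\<close>

lemma AE_eventually_window_small:
  assumes \<theta>: "\<theta> > 0"
  shows "AE \<omega> in M. \<forall>\<^sub>F k in sequentially. \<bar>Y (real (window k)) \<omega>\<bar> < sqrt (scale N \<theta> k)"
proof -
  define A where "A k = {\<omega>\<in>space M. \<bar>Y (real (window k)) \<omega>\<bar> \<ge> sqrt (scale N \<theta> k)}" for k
  have [measurable]: "Y (real (window k)) \<in> borel_measurable M" for k by (rule rv) simp
  have A_ev: "A k \<in> events" for k unfolding A_def by measurable
  let ?b = "bump_end \<theta> N"
  have b: "?b > 0" by (rule bump_end_pos[OF \<theta>])
  have "prob (A k) \<le> 2 * ?b * (1 / 4) ^ k" for k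
  proof -
    have s: "scale N \<theta> k > 0" by (rule scale_pos[OF \<theta>])
    have "prob (A k) = prob {\<omega>\<in>space M. \<bar>Y (real (window k)) \<omega> - Y 0 \<omega>\<bar> \<ge> sqrt (scale N \<theta> k)}"
      unfolding A_def using start by (intro arg_cong[where f = prob]) auto
    also have "\<dots> \<le> (real (window k) - 0 + 1) / (sqrt (scale N \<theta> k))\<^sup>2"
      using s by (intro cheb) auto
    also have "\<dots> = (real (window k) + 1) / scale N \<theta> k" using s by simp
    also have "\<dots> \<le> (2 * real (window k)) / (real (window k) * 4 ^ k / ?b)"
      using scale_lower[OF \<theta>, of k N] b window_pos[of k] by (intro frac_le) (auto simp: Suc_le_eq)
    also have "\<dots> = 2 * ?b * (1 / 4) ^ k" using b by (simp add: field_simps power_one_over)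
    finally show ?thesis .
  qed
  then have "summable (\<lambda>k. prob (A k))"
    by (intro summable_comparison_test[OF _ summable_mult[OF summable_geometric]]) auto
  then have "AE \<omega> in M. \<forall>\<^sub>F k in sequentially. \<omega> \<in> space M - A k"
    using A_ev by (intro borel_cantelli_AE1) (auto simp: emeasure_eq_measure)
  then show ?thesis
    by eventually_elim (auto simp: A_def not_le elim: eventually_mono)
qed

text \<open>One event occurs infinitely often and the other one eventually always, so they occur
  together infinitely often, and then the bumps have the prescribed signs.\<close>

theorem AE_frequently_good_window:
  assumes \<theta>: "\<theta> > 0"
  shows "AE \<omega> in M. \<exists>\<^sub>F k in sequentially. good_window N \<theta> (\<lambda>t. Y t \<omega>) k"
  using AE_frequently_oscillation[OF \<theta>, of N] AE_eventually_window_small[OF \<theta>, of N]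
proof eventually_elim
  fix \<omega>
  assume "\<exists>\<^sub>F k in sequentially. \<omega> \<in> oscillation \<theta> N (real (window k)) (scale N \<theta> k)"
    and "\<forall>\<^sub>F k in sequentially. \<bar>Y (real (window k)) \<omega>\<bar> < sqrt (scale N \<theta> k)"
  then have "\<exists>\<^sub>F k in sequentially. \<omega> \<in> oscillation \<theta> N (real (window k)) (scale N \<theta> k) \<and>
      \<bar>Y (real (window k)) \<omega>\<bar> < sqrt (scale N \<theta> k)"
    by (rule frequently_eventually_frequently)
  then show "\<exists>\<^sub>F k in sequentially. good_window N \<theta> (\<lambda>t. Y t \<omega>) k"
  proof (rule frequently_elim1)
    fix k
    assume *: "\<omega> \<in> oscillation \<theta> N (real (window k)) (scale N \<theta> k) \<and>
      \<bar>Y (real (window k)) \<omega>\<bar> < sqrt (scale N \<theta> k)"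
    then show "good_window N \<theta> (\<lambda>t. Y t \<omega>) k"
      unfolding good_window_def using scale_pos[OF \<theta>, of N k]
      by (auto intro!: oscillation_bumps[of \<omega> \<theta> N "real (window k)" "scale N \<theta> k"])
  qed
qed

text \<open>The event belongs to the algebra generated by the process itself, which makes the choice
  of windows independent of the labels.\<close>

lemma good_window_sets:
  assumes \<theta>: "\<theta> > 0"
  shows "{\<omega>\<in>space M. good_window N \<theta> (\<lambda>t. Y t \<omega>) k} \<in> sets (generated_algebra (space M) {0..} Y)"
proof -
  let ?L = "generated_algebra (space M) {0..} Y"
  let ?u = "\<lambda>i. real (window k) + bump_start \<theta> i * scale N \<theta> k"
  let ?v = "\<lambda>i. real (window k) + bump_end \<theta> i * scale N \<theta> k"
  have u: "?u i \<ge> 0" for i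
    using bump_start_ge[of \<theta> i] \<theta> scale_pos[OF \<theta>, of N k] by auto
  have "{\<omega>\<in>space ?L. \<forall>t\<in>{?u i..?v i}. (-1) ^ i * Y t \<omega> \<in> {sqrt (scale N \<theta> k)..}} \<in> sets ?L" for i
    using u[of i] by (intro sets_right_continuous_closed borel_measurable_times measurable_generated_algebra
        continuous_mult continuous_const right_cont) auto
  then have "{\<omega>\<in>space ?L. \<forall>i\<in>{..N}. \<forall>t\<in>{?u i..?v i}. (-1) ^ i * Y t \<omega> \<in> {sqrt (scale N \<theta> k)..}} \<in> sets ?L"
    by (rule sets.sets_Collect_finite_All) (rule finite_atMost)
  then show ?thesis
    unfolding good_window_def space_generated_algebra Ball_def atMost_iff atLeast_iff .
qed

end

section \<open>Independent labels\<close>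

lemma (in prob_space) indep_set_commute: "indep_set A C \<Longrightarrow> indep_set C A"
  unfolding indep_sets2_eq by (metis Int_commute mult.commute)

lemma sets_count_space_imp_measurable:
  fixes f :: "'a \<Rightarrow> 'b::countable"
  assumes "\<And>v. {\<omega>\<in>space L. f \<omega> = v} \<in> sets L"
  shows "f \<in> measurable L (count_space UNIV)"
  using assms by (subst measurable_count_space_eq2_countable) (auto simp: vimage_def Int_def conj_commute)

text \<open>Here \<open>x k\<close> lists the labels' indices relevant for the \<open>k\<close>-th trial; \<open>None\<close> stands for a trial that is skipped.\<close>

definition valid_selection :: "nat \<Rightarrow> (nat \<Rightarrow> nat list option) \<Rightarrow> bool" where
  "valid_selection N x \<longleftrightarrow>
     (\<exists>\<^sub>F k in sequentially. x k \<noteq> None) \<and>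
     (\<forall>k l. x k = Some l \<longrightarrow> length l = N \<and> set l \<subseteq> {1..} \<and> distinct l) \<and>
     (\<forall>k k' l l'. k \<noteq> k' \<longrightarrow> x k = Some l \<longrightarrow> x k' = Some l' \<longrightarrow> set l \<inter> set l' = {})"

text \<open>The conditions on \<open>l\<close> ensure that only the values of \<open>c\<close> at
  indices from \<open>1\<close> on matter, the range over which labels are random variables.\<close>

definition matching :: "nat \<Rightarrow> nat list option \<Rightarrow> (nat \<Rightarrow> nat) \<Rightarrow> bool" where
  "matching N v c \<longleftrightarrow> (\<exists>l. v = Some l \<and> length l = N \<and> set l \<subseteq> {1..} \<and> (\<forall>i<N. c (l ! i) = Suc i))"

lemma matching_cong:
  assumes "\<And>m. m \<ge> 1 \<Longrightarrow> c m = d m"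
  shows "matching N v c \<longleftrightarrow> matching N v d"
proof -
  have "c (l ! i) = d (l ! i)" if "length l = N" "set l \<subseteq> {1..}" "i < N" for l i
    using assms[of "l ! i"] nth_mem[of i l] that by (auto simp del: nth_mem)
  then show ?thesis unfolding matching_def by (metis (no_types, lifting))
qed

text \<open>Disjoint lists make the trials independent, and distinct entries give each of them the
  same success probability \<open>q > 0\<close>, the product of all \<open>p j\<close>. A run of
  \<open>m\<close> failures thus has probability \<open>(1 - q) ^ m\<close>.\<close>

lemma (in prob_space) AE_frequently_matching_fixed:
  fixes \<kappa> :: "nat \<Rightarrow> 'a \<Rightarrow> nat"
  assumes N: "N \<ge> 1" and indep: "indep_vars (\<lambda>_. count_space UNIV) \<kappa> {1..}"
    and \<kappa>: "\<And>m j. m \<ge> 1 \<Longrightarrow> j \<in> {1..N} \<Longrightarrow> prob {\<omega>\<in>space M. \<kappa> m \<omega> = j} = p j"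
    and p: "\<And>j. j \<in> {1..N} \<Longrightarrow> p j > 0"
    and x: "valid_selection N x"
  shows "AE \<omega> in M. \<exists>\<^sub>F k in sequentially. matching N (x k) (\<lambda>m. \<kappa> m \<omega>)"
proof -
  define I where "I = {k. x k \<noteq> None}"
  have "infinite I"
    using x unfolding valid_selection_def I_def frequently_cofinite[symmetric] cofinite_eq_sequentially by simp
  define e where "e = enumerate I"
  have e: "e n \<in> I" "n \<le> e n" for n
    using enumerate_in_set[OF \<open>infinite I\<close>] le_enumerate[OF \<open>infinite I\<close>] by (auto simp: e_def)
  have e_inj: "inj e"
    unfolding e_def by (rule strict_mono_imp_inj_on[OF strict_mono_enumerate[OF \<open>infinite I\<close>]])
  define l where "l n = the (x (e n))" for n
  have xl: "x (e n) = Some (l n)" for n using e(1)[of n] by (auto simp: I_def l_def)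
  have l: "length (l n) = N" "set (l n) \<subseteq> {1..}" "distinct (l n)" for n
    using x xl[of n] unfolding valid_selection_def by auto
  have l_disj: "set (l m) \<inter> set (l n) = {}" if "m \<noteq> n" for m n
  proof -
    have "e m \<noteq> e n" using that e_inj by (auto dest: injD)
    then show ?thesis using x xl[of m] xl[of n] unfolding valid_selection_def by blast
  qed
  define Q where "Q n \<omega> \<longleftrightarrow> (\<forall>i<N. \<kappa> (l n ! i) \<omega> = Suc i)" for n \<omega>
  define q where "q = (\<Prod>i<N. p (Suc i))"
  have q: "q > 0" unfolding q_def using p by (intro prod_pos) auto
  have [measurable]: "\<kappa> m \<in> measurable M (count_space UNIV)" if "m \<ge> 1" for m
    using indep that unfolding indep_vars_def by auto
  have li: "l n ! i \<ge> 1" if "i < N" for n i using nth_mem[of i "l n"] l(1,2)[of n] that by (auto simp del: nth_mem)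
  have Q_meas: "Measurable.pred M (Q n)" for n
    unfolding Q_def using li by measurable
  have Q_prob: "prob {\<omega>\<in>space M. Q n \<omega>} = q" for n
  proof -
    \<comment> \<open>Prescribes labels by index instead of by position, as the product formula for
      independent variables wants it. As the list is distinct, each listed index gets exactly one
      admissible label.\<close>
    define A where "A m = {j. \<exists>i<N. l n ! i = m \<and> j = Suc i}" for m
    have A: "A (l n ! i) = {Suc i}" if "i < N" for i
      using that l(1,3)[of n] by (auto simp: A_def nth_eq_iff_index_eq)
    have s: "set (l n) = (!) (l n) ` {..<N}" using l(1)[of n] by (auto simp: set_conv_nth)
    have inj: "inj_on ((!) (l n)) {..<N}" using l(1,3)[of n] by (auto intro!: inj_on_nth)
    have "{\<omega>\<in>space M. Q n \<omega>} = (\<Inter>m\<in>set (l n). \<kappa> m -` A m \<inter> space M)"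
      using N by (auto simp: s A Q_def lessThan_empty_iff)
    also have "prob \<dots> = (\<Prod>m\<in>set (l n). prob (\<kappa> m -` A m \<inter> space M))"
      using l[of n] N by (intro indep_varsD[OF indep]) auto
    also have "\<dots> = (\<Prod>i<N. prob (\<kappa> (l n ! i) -` A (l n ! i) \<inter> space M))"
      unfolding s by (subst prod.reindex[OF inj]) simp
    also have "\<dots> = q" unfolding q_def
    proof (rule prod.cong)
      fix i assume "i \<in> {..<N}"
      then show "prob (\<kappa> (l n ! i) -` A (l n ! i) \<inter> space M) = p (Suc i)"
        using \<kappa>[of "l n ! i" "Suc i"] li[of i n] by (auto simp: A vimage_def Int_def conj_commute)
    qed simp
    finally show ?thesis .
  qed
  have Q_indep: "indep_vars (\<lambda>_. count_space UNIV) Q UNIV"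
  proof -
    \<comment> \<open>Grouping independent variables along disjoint index sets yields independent
      blocks, and \<open>Q n\<close> is a function of block \<open>n\<close> alone.\<close>
    have "indep_vars (\<lambda>n. PiM (set (l n)) (\<lambda>_. count_space UNIV)) (\<lambda>n \<omega>. restrict (\<lambda>i. \<kappa> i \<omega>) (set (l n))) UNIV"
      using l l_disj N by (intro indep_vars_restrict[OF indep]) (auto simp: disjoint_family_on_def)
    then have "indep_vars (\<lambda>_. count_space UNIV)
        (\<lambda>n \<omega>. \<forall>i\<in>{..<N}. restrict (\<lambda>i. \<kappa> i \<omega>) (set (l n)) (l n ! i) = Suc i) UNIV"
    proof (rule indep_vars_compose2)
      fix n
      have m: "l n ! i \<in> set (l n)" if "i < N" for i using that l(1)[of n] by simp
      have "Measurable.pred (PiM (set (l n)) (\<lambda>_. count_space UNIV)) (\<lambda>f. f (l n ! i) = Suc i)" if "i < N" for i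
        by (rule measurable_compose[OF measurable_component_singleton[OF m[OF that]]]) simp
      then show "(\<lambda>f. \<forall>i\<in>{..<N}. f (l n ! i) = Suc i) \<in> measurable (PiM (set (l n)) (\<lambda>_. count_space UNIV)) (count_space UNIV)"
        by (intro pred_intros_finite) auto
    qed
    moreover have "(\<forall>i\<in>{..<N}. restrict (\<lambda>i. \<kappa> i \<omega>) (set (l n)) (l n ! i) = Suc i) = Q n \<omega>" for n \<omega>
      using l(1)[of n] by (auto simp: Q_def)
    ultimately show ?thesis by simp
  qed
  have "AE \<omega> in M. \<exists>n\<ge>a. Q n \<omega>" for a
  proof -
    define F where "F m = {\<omega>\<in>space M. \<forall>n\<in>{a..<a + m}. \<not> Q n \<omega>}" for m
    have F_ev: "F m \<in> events" for m unfolding F_def using Q_meas by measurable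
    have F_prob: "prob (F m) = (1 - q) ^ m" for m
    proof (cases "m = 0")
      case False
      have "F m = (\<Inter>n\<in>{a..<a + m}. Q n -` {False} \<inter> space M)"
        using False by (auto simp: F_def)
      also have "prob \<dots> = (\<Prod>n\<in>{a..<a + m}. prob (Q n -` {False} \<inter> space M))"
        using False by (intro indep_varsD[OF Q_indep]) auto
      also have "\<dots> = (\<Prod>n\<in>{a..<a + m}. 1 - q)"
      proof (rule prod.cong)
        fix n
        have "Q n -` {False} \<inter> space M = {\<omega>\<in>space M. \<not> Q n \<omega>}" by auto
        then show "prob (Q n -` {False} \<inter> space M) = 1 - q"
          using prob_neg[of "Q n"] Q_meas[of n] Q_prob[of n] by simp
      qed simp
      finally show ?thesis by simp
    qed (simp add: F_def prob_space)
    have "q \<le> 1" using Q_prob[of 0] by (metis prob_le_1)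
    have "(\<lambda>m. prob (F m)) \<longlonglongrightarrow> prob (\<Inter>m. F m)"
      using F_ev by (intro finite_Lim_measure_decseq) (auto simp: decseq_def F_def)
    moreover have "(\<lambda>m. prob (F m)) \<longlonglongrightarrow> 0"
      unfolding F_prob using q \<open>q \<le> 1\<close> by (intro LIMSEQ_realpow_zero) auto
    ultimately have 0: "prob (\<Inter>m. F m) = 0" by (rule LIMSEQ_unique)
    have "(\<Inter>m. F m) \<in> null_sets M"
      using F_ev 0 by (intro null_setsI) (auto simp: emeasure_eq_measure)
    then have "AE \<omega> in M. \<omega> \<notin> (\<Inter>m. F m)" by (rule AE_not_in)
    moreover have "\<exists>n\<ge>a. Q n \<omega>" if "\<omega> \<notin> (\<Inter>m. F m)" "\<omega> \<in> space M" for \<omega>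
      using that by (auto simp: F_def)
    ultimately show ?thesis using AE_space by (auto elim!: AE_mp)
  qed
  then have "AE \<omega> in M. \<forall>a. \<exists>n\<ge>a. Q n \<omega>" by (simp add: AE_all_countable)
  then show ?thesis
  proof eventually_elim
    fix \<omega> assume *: "\<forall>a. \<exists>n\<ge>a. Q n \<omega>"
    show "\<exists>\<^sub>F k in sequentially. matching N (x k) (\<lambda>m. \<kappa> m \<omega>)"
      unfolding frequently_sequentially
    proof
      fix a
      obtain n where n: "n \<ge> a" "Q n \<omega>" using * by blast
      then have "e n \<ge> a" using e(2)[of n] by simp
      moreover have "matching N (x (e n)) (\<lambda>m. \<kappa> m \<omega>)"
        using n(2) l[of n] xl[of n] by (auto simp: matching_def Q_def)
      ultimately show "\<exists>k\<ge>a. matching N (x k) (\<lambda>m. \<kappa> m \<omega>)" by blast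
    qed
  qed
qed

text \<open>By independence, the selection may be treated as fixed (Fubini on the joint law).\<close>

lemma (in prob_space) AE_frequently_matching:
  fixes \<kappa> :: "nat \<Rightarrow> 'a \<Rightarrow> nat" and X :: "nat \<Rightarrow> 'a \<Rightarrow> nat list option"
  assumes N: "N \<ge> 1" and indep: "indep_vars (\<lambda>_. count_space UNIV) \<kappa> {1..}"
    and \<kappa>: "\<And>m j. m \<ge> 1 \<Longrightarrow> j \<in> {1..N} \<Longrightarrow> prob {\<omega>\<in>space M. \<kappa> m \<omega> = j} = p j"
    and p: "\<And>j. j \<in> {1..N} \<Longrightarrow> p j > 0"
    and G: "space G = space M" "indep_set (generated_events M (count_space UNIV) {1..} \<kappa>) (sets G)"
    and X: "\<And>k v. {\<omega>\<in>space M. X k \<omega> = v} \<in> sets G"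
    and valid: "AE \<omega> in M. valid_selection N (\<lambda>k. X k \<omega>)"
  shows "AE \<omega> in M. \<exists>\<^sub>F k in sequentially. matching N (X k \<omega>) (\<lambda>m. \<kappa> m \<omega>)"
proof -
  define P where "P = PiM {1..} (\<lambda>_::nat. count_space (UNIV :: nat set))"
  define Q where "Q = PiM UNIV (\<lambda>_::nat. count_space (UNIV :: nat list option set))"
  \<comment> \<open>Outside \<open>{1..}\<close> the labels become \<open>undefined\<close>, as the
    product space demands; by \<open>matching_cong\<close> this does not affect
    \<open>matching\<close>.\<close>
  define K where "K \<omega> = (\<lambda>i\<in>{1..}. \<kappa> i \<omega>)" for \<omega>
  define Xs where "Xs \<omega> = (\<lambda>k. X k \<omega>)" for \<omega>
  have [measurable]: "\<kappa> m \<in> measurable M (count_space UNIV)" if "m \<ge> 1" for m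
    using indep that unfolding indep_vars_def by auto
  have K: "K \<in> measurable M P"
    unfolding K_def P_def by (intro measurable_restrict) auto
  have GM: "sets G \<subseteq> events" using G(2) unfolding indep_sets2_eq by auto
  have XG: "Xs \<in> measurable G Q"
    unfolding Xs_def Q_def using X G(1)
    by (intro measurable_PiM_single' sets_count_space_imp_measurable) auto
  then have Xs: "Xs \<in> measurable M Q"
    using GM G(1) by (auto simp: measurable_def)
  interpret Q: prob_space "distr M Q Xs" by (rule prob_space_distr[OF Xs])
  interpret P: prob_space "distr M P K" by (rule prob_space_distr[OF K])
  interpret QP: pair_sigma_finite "distr M Q Xs" "distr M P K" ..
  \<comment> \<open>Independence in the form that Fubini's theorem needs: the joint law of selection
    and labels is the product of the two laws. It is checked on rectangles, whose sides pull back to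
    \<open>G\<close> and to the events of the labels.\<close>
  have joint: "distr M Q Xs \<Otimes>\<^sub>M distr M P K = distr M (Q \<Otimes>\<^sub>M P) (\<lambda>\<omega>. (Xs \<omega>, K \<omega>))"
  proof (rule pair_measure_eqI)
    show "sigma_finite_measure (distr M Q Xs)" "sigma_finite_measure (distr M P K)" by unfold_locales
    show "sets (distr M Q Xs \<Otimes>\<^sub>M distr M P K) = sets (distr M (Q \<Otimes>\<^sub>M P) (\<lambda>\<omega>. (Xs \<omega>, K \<omega>)))"
      by (simp cong: sets_pair_measure_cong)
  next
    fix A B assume "A \<in> sets (distr M Q Xs)" "B \<in> sets (distr M P K)"
    then have [measurable]: "A \<in> sets Q" "B \<in> sets P" by auto
    have "Xs -` A \<inter> space M \<in> sets G" using measurable_sets[OF XG] G(1) by auto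
    moreover have "K -` B \<inter> space M \<in> generated_events M (count_space UNIV) {1..} \<kappa>"
      unfolding generated_events_def P_def[symmetric] K_def[symmetric] by (intro in_vimage_algebra) auto
    ultimately have "prob (Xs -` A \<inter> space M \<inter> (K -` B \<inter> space M)) = prob (Xs -` A \<inter> space M) * prob (K -` B \<inter> space M)"
      using indep_setD[OF indep_set_commute[OF G(2)]] by auto
    moreover have "(\<lambda>\<omega>. (Xs \<omega>, K \<omega>)) -` (A \<times> B) \<inter> space M = Xs -` A \<inter> space M \<inter> (K -` B \<inter> space M)"
      by auto
    ultimately show "emeasure (distr M Q Xs) A * emeasure (distr M P K) B =
        emeasure (distr M (Q \<Otimes>\<^sub>M P) (\<lambda>\<omega>. (Xs \<omega>, K \<omega>))) (A \<times> B)"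
      using Xs K by (simp add: emeasure_distr emeasure_eq_measure ennreal_mult'')
  qed
  define R where "R x c \<longleftrightarrow> (\<exists>\<^sub>F k in sequentially. matching N (x k) c)"
    for x :: "nat \<Rightarrow> nat list option" and c :: "nat \<Rightarrow> nat"
  have xk [measurable]: "(\<lambda>x. x k) \<in> measurable Q (count_space UNIV)" for k unfolding Q_def by measurable
  have ck: "(\<lambda>c. c m) \<in> measurable P (count_space UNIV)" if "m \<ge> 1" for m
    unfolding P_def using that by (intro measurable_component_singleton) auto
  have match: "Measurable.pred (Q \<Otimes>\<^sub>M P) (\<lambda>z. matching N (fst z k) (snd z))" for k
  proof -
    have "Measurable.pred (Q \<Otimes>\<^sub>M P) (\<lambda>z. fst z k = Some l \<and> length l = N \<and> set l \<subseteq> {1..} \<and> (\<forall>i<N. snd z (l ! i) = Suc i))" for l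
    proof (cases "length l = N \<and> set l \<subseteq> {1..}")
      case True
      then have "l ! i \<ge> 1" if "i < N" for i using nth_mem[of i l] that by (auto simp del: nth_mem)
      then have [measurable]: "(\<lambda>z. snd z (l ! i)) \<in> measurable (Q \<Otimes>\<^sub>M P) (count_space UNIV)" if "i < N" for i
        using measurable_compose[OF measurable_snd ck] that by blast
      show ?thesis by measurable
    next
      case False
      then have "(\<lambda>z. fst z k = Some l \<and> length l = N \<and> set l \<subseteq> {1..} \<and> (\<forall>i<N. snd z (l ! i) = Suc i)) = (\<lambda>_. False)"
        by (auto simp: fun_eq_iff)
      then show ?thesis by simp
    qed
    then show ?thesis unfolding matching_def by (intro pred_intros_countable)
  qed
  have R: "Measurable.pred (Q \<Otimes>\<^sub>M P) (\<lambda>z. R (fst z) (snd z))"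
    unfolding R_def frequently_sequentially using match by measurable
  have V: "Measurable.pred Q (valid_selection N)"
    unfolding valid_selection_def frequently_sequentially by measurable
  have "AE x in distr M Q Xs. AE c in distr M P K. R x c"
  proof -
    have sec: "Measurable.pred P (R x)" for x
      using measurable_compose[OF measurable_Pair1' R, of x] by (simp add: Q_def space_PiM)
    have "AE x in distr M Q Xs. valid_selection N x"
      using V valid unfolding Xs_def by (subst AE_distr_iff[OF Xs[unfolded Xs_def]]) (auto simp: pred_def)
    then show ?thesis
    proof eventually_elim
      fix x assume x: "valid_selection N x"
      have "AE \<omega> in M. \<exists>\<^sub>F k in sequentially. matching N (x k) (\<lambda>m. \<kappa> m \<omega>)"
        using N indep \<kappa> p x by (rule AE_frequently_matching_fixed)
      then have "AE \<omega> in M. R x (K \<omega>)"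
      proof eventually_elim
        fix \<omega> assume "\<exists>\<^sub>F k in sequentially. matching N (x k) (\<lambda>m. \<kappa> m \<omega>)"
        then show "R x (K \<omega>)" unfolding R_def
          by (subst matching_cong[of "K \<omega>" "\<lambda>m. \<kappa> m \<omega>"]) (auto simp: K_def)
      qed
      then show "AE c in distr M P K. R x c"
        using sec[of x] by (subst AE_distr_iff[OF K]) (auto simp: pred_def)
    qed
  qed
  then have "AE z in distr M Q Xs \<Otimes>\<^sub>M distr M P K. R (fst z) (snd z)"
    using R by (intro QP.AE_pair_measure) (auto simp: pred_def space_pair_measure)
  then have "AE z in distr M (Q \<Otimes>\<^sub>M P) (\<lambda>\<omega>. (Xs \<omega>, K \<omega>)). R (fst z) (snd z)"
    unfolding joint .
  then have "AE \<omega> in M. R (Xs \<omega>) (K \<omega>)"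
    using Xs K by (subst (asm) AE_distr_iff) (use R in \<open>auto simp: pred_def\<close>)
  then show ?thesis
  proof eventually_elim
    fix \<omega> assume "R (Xs \<omega>) (K \<omega>)"
    then show "\<exists>\<^sub>F k in sequentially. matching N (X k \<omega>) (\<lambda>m. \<kappa> m \<omega>)"
      unfolding R_def Xs_def
      by (subst (asm) matching_cong[of "K \<omega>" "\<lambda>m. \<kappa> m \<omega>"]) (auto simp: K_def)
  qed
qed

section \<open>Legs and occupation times\<close>

lemma norm_spider_point [simp]: "norm (spider_point N x j) = \<bar>x\<bar>"
proof -
  have "2 * of_real pi * \<i> * (of_nat j - 1) / of_nat N = \<i> * complex_of_real (2 * pi * (real j - 1) / real N)"
    by simp
  then show ?thesis unfolding spider_point_def norm_mult by (metis mult.right_neutral norm_exp_i_times norm_of_real)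
qed

lemma spider_point_0 [simp]: "spider_point N 0 j = 0"
  by (simp add: spider_point_def)

lemma spider_point_eq_0_iff [simp]: "spider_point N x j = 0 \<longleftrightarrow> x = 0"
  by (metis abs_eq_0 norm_eq_zero norm_spider_point)

text \<open>Norms give \<open>x = y\<close>. Equal directions mean that the angles differ by a
  multiple of a full turn, so \<open>N\<close> divides \<open>i - j\<close>, whose absolute value is
  less than \<open>N\<close>.\<close>

lemma spider_point_eq_iff:
  assumes "x > 0" "y > 0" "i \<in> {1..N}" "j \<in> {1..N}"
  shows "spider_point N x i = spider_point N y j \<longleftrightarrow> x = y \<and> i = j"
proof
  assume eq: "spider_point N x i = spider_point N y j"
  then have xy: "x = y" using assms norm_spider_point[of N x i] norm_spider_point[of N y j] by auto
  define a where "a k = 2 * pi * (real k - 1) / real N" for k :: nat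
  have "2 * of_real pi * \<i> * (of_nat k - 1) / of_nat N = \<i> * complex_of_real (a k)" for k
    by (simp add: a_def)
  then have "exp (\<i> * complex_of_real (a i)) = exp (\<i> * complex_of_real (a j))"
    using eq assms xy unfolding spider_point_def by simp
  then obtain n :: int where "\<i> * complex_of_real (a i) = \<i> * complex_of_real (a j) + (of_int (2 * n) * pi) * \<i>"
    unfolding exp_eq by blast
  then have "a i = a j + 2 * real_of_int n * pi"
    by (auto simp: complex_eq_iff)
  then have "(real i - 1) / real N = (real j - 1) / real N + real_of_int n"
  proof -
    assume "a i = a j + 2 * real_of_int n * pi"
    then have "(2 * pi) * ((real i - 1) / real N) = (2 * pi) * ((real j - 1) / real N + real_of_int n)"
      by (simp add: a_def distrib_left mult_ac)
    then show ?thesis by (subst (asm) mult_cancel_left) auto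
  qed
  then have *: "real i - real j = real_of_int n * real N"
    using assms by (simp add: field_simps)
  then have "int i - int j = n * int N" by (metis (mono_tags, lifting) of_int_diff of_int_eq_iff of_int_mult of_int_of_nat_eq)
  then have "int N dvd int i - int j" by simp
  moreover have "\<bar>int i - int j\<bar> < int N" using assms by auto
  ultimately have "int i - int j = 0" by (metis abs_of_nat dvd_imp_le_int linorder_not_le)
  then show "x = y \<and> i = j" using xy by simp
qed auto

lemma spider_point_in_leg_iff:
  assumes "x > 0" "i \<in> {1..N}" "j \<in> {1..N}"
  shows "spider_point N x i \<in> leg N j \<longleftrightarrow> i = j"
proof
  assume "spider_point N x i \<in> leg N j"
  then obtain y where "y > 0" "spider_point N x i = spider_point N y j" by (auto simp: leg_def)
  with spider_point_eq_iff[OF assms(1) \<open>y > 0\<close> assms(2,3)] show "i = j" by blast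
next
  assume "i = j"
  with assms show "spider_point N x i \<in> leg N j" unfolding leg_def by blast
qed

lemma zero_notin_leg [simp]: "0 \<notin> leg N j"
  unfolding leg_def by (auto simp: eq_commute[of 0])

text \<open>Describes the leg by an equation between measurable functions of \<open>z\<close>, from
  which its Borel measurability can be read off.\<close>

lemma leg_eq: "leg N j = {z. z \<noteq> 0 \<and> z = of_real (norm z) * spider_point N 1 j}"
proof -
  have *: "spider_point N x j = of_real x * spider_point N 1 j" for x by (simp add: spider_point_def)
  have "z \<in> leg N j \<longleftrightarrow> z \<noteq> 0 \<and> z = spider_point N (norm z) j" for z
  proof
    assume "z \<in> leg N j"
    then obtain x where "x > 0" "z = spider_point N x j" by (auto simp: leg_def)
    then show "z \<noteq> 0 \<and> z = spider_point N (norm z) j" by simp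
  next
    assume "z \<noteq> 0 \<and> z = spider_point N (norm z) j"
    then show "z \<in> leg N j" unfolding leg_def by (metis (mono_tags, lifting) mem_Collect_eq zero_less_norm_iff)
  qed
  then show ?thesis unfolding *[of "norm _"] by blast
qed

lemma leg_borel [measurable]: "leg N j \<in> sets borel"
  unfolding leg_eq by measurable

lemma sum_indicator_leg:
  assumes "z \<in> spider N"
  shows "(\<Sum>j\<in>{1..N}. indicator (leg N j) z) = (if z = 0 then 0 else 1 :: real)"
proof (cases "z = 0")
  case False
  with assms obtain x i where z: "z = spider_point N x i" "x > 0" "i \<in> {1..N}"
    unfolding spider_def by (auto simp: order.order_iff_strict)
  have "(\<Sum>j\<in>{1..N}. indicator (leg N j) z) = (\<Sum>j\<in>{1..N}. if j = i then 1 else 0 :: real)"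
    using z by (intro sum.cong) (auto simp: spider_point_in_leg_iff indicator_def)
  then show ?thesis using z False by simp
qed simp

text \<open>Since the shares add up to about one, the largest is asymptotically at least, and the
  smallest at most, \<open>1 / N\<close>. At balanced times all shares are almost
  \<open>1 / N\<close> or more, which leaves no room for a share well above \<open>1 / N\<close>. A
  general filter covers both kinds of time.\<close>

lemma Liminf_Max_Limsup_Min:
  fixes Z :: "nat \<Rightarrow> 'c \<Rightarrow> real" and \<tau> :: "'c \<Rightarrow> real"
  assumes N: "N \<ge> 1" and F: "F \<noteq> bot"
    and pos: "\<forall>\<^sub>F x in F. \<tau> x > 0"
    and total: "((\<lambda>x. (\<Sum>j\<in>{1..N}. Z j x) / \<tau> x) \<longlongrightarrow> 1) F"
    and balanced: "\<And>c. c < 1 / real N \<Longrightarrow> \<exists>\<^sub>F x in F. \<forall>j\<in>{1..N}. Z j x / \<tau> x \<ge> c"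
  shows "Liminf F (\<lambda>x. ereal ((MAX j\<in>{1..N}. Z j x) / \<tau> x)) = ereal (1 / real N)"
    and "Limsup F (\<lambda>x. ereal ((MIN j\<in>{1..N}. Z j x) / \<tau> x)) = ereal (1 / real N)"
proof -
  have ne: "{1..N} \<noteq> {}" using N by auto
  have N0: "real N > 0" using N by simp
  define S where "S x = (\<Sum>j\<in>{1..N}. Z j x)" for x
  have total': "\<forall>\<^sub>F x in F. \<bar>S x / \<tau> x - 1\<bar> < e" if "e > 0" for e
    using tendstoD[OF total that] by (simp add: dist_real_def S_def)
  have max_lower: "(MAX j\<in>{1..N}. Z j x) * real N \<ge> S x" for x
  proof -
    have "S x \<le> (\<Sum>j\<in>{1..N}. (MAX j\<in>{1..N}. Z j x))"
      unfolding S_def using ne by (intro sum_mono Max_ge) auto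
    then show ?thesis by (simp add: mult.commute)
  qed
  have min_upper: "(MIN j\<in>{1..N}. Z j x) * real N \<le> S x" for x
  proof -
    have "(\<Sum>j\<in>{1..N}. (MIN j\<in>{1..N}. Z j x)) \<le> S x"
      unfolding S_def using ne by (intro sum_mono Min_le) auto
    then show ?thesis by (simp add: mult.commute)
  qed
  show "Liminf F (\<lambda>x. ereal ((MAX j\<in>{1..N}. Z j x) / \<tau> x)) = ereal (1 / real N)"
  proof (rule antisym)
    show "ereal (1 / real N) \<le> Liminf F (\<lambda>x. ereal ((MAX j\<in>{1..N}. Z j x) / \<tau> x))"
      unfolding le_Liminf_iff
    proof safe
      fix y assume y: "y < ereal (1 / real N)"
      then obtain r where r: "y < ereal r" "r < 1 / real N" using ereal_dense2[OF y] by auto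
      have "real N * (1 / real N - r) > 0" using r N0 by simp
      from total'[OF this] pos show "\<forall>\<^sub>F x in F. y < ereal ((MAX j\<in>{1..N}. Z j x) / \<tau> x)"
      proof eventually_elim
        fix x assume x: "\<bar>S x / \<tau> x - 1\<bar> < real N * (1 / real N - r)" "0 < \<tau> x"
        have "r * real N < S x / \<tau> x" using x(1) N0 by (simp add: algebra_simps abs_less_iff)
        also have "\<dots> \<le> (MAX j\<in>{1..N}. Z j x) * real N / \<tau> x"
          using max_lower[of x] x(2) by (intro divide_right_mono) auto
        finally have "r * real N < (MAX j\<in>{1..N}. Z j x) / \<tau> x * real N" by simp
        then have "r < (MAX j\<in>{1..N}. Z j x) / \<tau> x" using N0 mult_less_cancel_right_pos by blast
        then have "ereal r < ereal ((MAX j\<in>{1..N}. Z j x) / \<tau> x)" by simp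
        with r(1) show "y < ereal ((MAX j\<in>{1..N}. Z j x) / \<tau> x)" by (rule less_trans)
      qed
    qed
    show "Liminf F (\<lambda>x. ereal ((MAX j\<in>{1..N}. Z j x) / \<tau> x)) \<le> ereal (1 / real N)"
    proof (rule ccontr)
      assume "\<not> ?thesis"
      then have *: "ereal (1 / real N) < Liminf F (\<lambda>x. ereal ((MAX j\<in>{1..N}. Z j x) / \<tau> x))" by simp
      then obtain r where r: "1 / real N < r" "ereal r < Liminf F (\<lambda>x. ereal ((MAX j\<in>{1..N}. Z j x) / \<tau> x))"
        using ereal_dense2[OF *] by auto
      have ev: "\<forall>\<^sub>F x in F. r < (MAX j\<in>{1..N}. Z j x) / \<tau> x"
        using less_LiminfD[OF r(2)] by simp
      \<comment> \<open>With this choice \<open>N * e\<close> is half of \<open>r - 1 / N\<close>.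
        If one share exceeded \<open>r\<close> and the others were at least
        \<open>1 / N - e\<close>, their sum would exceed \<open>1 + e\<close>.\<close>
      define e where "e = (r - 1 / real N) / (2 * real N)"
      have e: "e > 0" using r(1) N0 by (simp add: e_def)
      have "\<exists>\<^sub>F x in F. (\<forall>j\<in>{1..N}. Z j x / \<tau> x \<ge> 1 / real N - e) \<and>
          (\<bar>S x / \<tau> x - 1\<bar> < e \<and> 0 < \<tau> x \<and> r < (MAX j\<in>{1..N}. Z j x) / \<tau> x)"
        using e by (intro frequently_eventually_frequently balanced eventually_conj total' pos ev) auto
      then obtain x where x: "\<And>j. j \<in> {1..N} \<Longrightarrow> Z j x / \<tau> x \<ge> 1 / real N - e"
          "\<bar>S x / \<tau> x - 1\<bar> < e" "0 < \<tau> x" "r < (MAX j\<in>{1..N}. Z j x) / \<tau> x"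
        using frequently_ex by blast
      have "(MAX j\<in>{1..N}. Z j x) \<in> (\<lambda>j. Z j x) ` {1..N}" using ne by (intro Max_in) auto
      then obtain i where i: "i \<in> {1..N}" "(MAX j\<in>{1..N}. Z j x) = Z i x" by auto
      have "S x / \<tau> x = (\<Sum>j\<in>{1..N}. Z j x / \<tau> x)" by (simp add: S_def sum_divide_distrib)
      also have "\<dots> = Z i x / \<tau> x + (\<Sum>j\<in>{1..N} - {i}. Z j x / \<tau> x)"
        using i by (intro sum.remove) auto
      finally have "S x / \<tau> x = Z i x / \<tau> x + (\<Sum>j\<in>{1..N} - {i}. Z j x / \<tau> x)" .
      moreover have "(\<Sum>j\<in>{1..N} - {i}. Z j x / \<tau> x) \<ge> (\<Sum>j\<in>{1..N} - {i}. 1 / real N - e)"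
        using x(1) by (intro sum_mono) auto
      ultimately have "S x / \<tau> x \<ge> Z i x / \<tau> x + (real N - 1) * (1 / real N - e)"
        using i(1) N by (simp add: of_nat_diff)
      moreover have "(real N - 1) * (1 / real N - e) = 1 - 1 / real N - real N * e + e"
        using N0 by (simp add: field_simps)
      moreover have "real N * e = (r - 1 / real N) / 2" using N0 by (simp add: e_def)
      moreover have "S x / \<tau> x < 1 + e" using x(2) by linarith
      moreover have "r < Z i x / \<tau> x" using x(4) i(2) by simp
      ultimately show False using r(1) by argo
    qed
  qed
  show "Limsup F (\<lambda>x. ereal ((MIN j\<in>{1..N}. Z j x) / \<tau> x)) = ereal (1 / real N)"
  proof (rule antisym)
    show "Limsup F (\<lambda>x. ereal ((MIN j\<in>{1..N}. Z j x) / \<tau> x)) \<le> ereal (1 / real N)"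
      unfolding Limsup_le_iff
    proof safe
      fix y assume y: "ereal (1 / real N) < y"
      then obtain r where r: "ereal r < y" "1 / real N < r" using ereal_dense2[OF y] by auto
      have "real N * (r - 1 / real N) > 0" using r N0 by simp
      from total'[OF this] pos show "\<forall>\<^sub>F x in F. ereal ((MIN j\<in>{1..N}. Z j x) / \<tau> x) < y"
      proof eventually_elim
        fix x assume x: "\<bar>S x / \<tau> x - 1\<bar> < real N * (r - 1 / real N)" "0 < \<tau> x"
        have "(MIN j\<in>{1..N}. Z j x) * real N / \<tau> x \<le> S x / \<tau> x"
          using min_upper[of x] x(2) by (intro divide_right_mono) auto
        also have "\<dots> < r * real N" using x(1) N0 by (simp add: algebra_simps abs_less_iff)
        finally have "(MIN j\<in>{1..N}. Z j x) / \<tau> x * real N < r * real N" by simp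
        then have "(MIN j\<in>{1..N}. Z j x) / \<tau> x < r" using N0 mult_less_cancel_right_pos by blast
        then have "ereal ((MIN j\<in>{1..N}. Z j x) / \<tau> x) < ereal r" by simp
        then show "ereal ((MIN j\<in>{1..N}. Z j x) / \<tau> x) < y" using r(1) by (rule less_trans)
      qed
    qed
    show "ereal (1 / real N) \<le> Limsup F (\<lambda>x. ereal ((MIN j\<in>{1..N}. Z j x) / \<tau> x))"
    proof (rule ccontr)
      assume "\<not> ?thesis"
      then have *: "Limsup F (\<lambda>x. ereal ((MIN j\<in>{1..N}. Z j x) / \<tau> x)) < ereal (1 / real N)" by simp
      then obtain r where r: "Limsup F (\<lambda>x. ereal ((MIN j\<in>{1..N}. Z j x) / \<tau> x)) < ereal r" "r < 1 / real N"
        using ereal_dense2[OF *] by auto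
      have "\<forall>\<^sub>F x in F. (MIN j\<in>{1..N}. Z j x) / \<tau> x < r"
        using Limsup_lessD[OF r(1)] by simp
      then obtain x where x: "\<And>j. j \<in> {1..N} \<Longrightarrow> Z j x / \<tau> x \<ge> r" "(MIN j\<in>{1..N}. Z j x) / \<tau> x < r"
        using frequently_eventually_frequently[OF balanced[OF r(2)]] frequently_ex by blast
      have "(MIN j\<in>{1..N}. Z j x) \<in> (\<lambda>j. Z j x) ` {1..N}" using ne by (intro Min_in) auto
      then obtain i where "i \<in> {1..N}" "(MIN j\<in>{1..N}. Z j x) = Z i x" by auto
      with x(1)[of i] x(2) show False by simp
    qed
  qed
qed

section \<open>Brownian motion\<close>

text \<open>The density is positive everywhere, so an interval of probability zero would have
  Lebesgue measure zero.\<close>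

lemma std_normal_interval_pos:
  assumes "a < b"
  shows "measure std_normal_distribution {a<..<b} > 0"
proof -
  interpret N: prob_space std_normal_distribution by (rule prob_space_normal_density) simp
  have "emeasure std_normal_distribution {a<..<b} \<noteq> 0"
  proof
    assume "emeasure std_normal_distribution {a<..<b} = 0"
    then have "(\<integral>\<^sup>+x. ennreal (std_normal_density x) * indicator {a<..<b} x \<partial>lborel) = 0"
      by (simp add: emeasure_density)
    then have "AE x in lborel. ennreal (std_normal_density x) * indicator {a<..<b} x = 0"
      by (subst (asm) nn_integral_0_iff_AE) auto
    then have "AE x in lborel. x \<notin> {a<..<b}"
    proof eventually_elim
      fix x assume "ennreal (std_normal_density x) * indicator {a<..<b} x = 0"
      moreover have "std_normal_density x > 0" by (rule normal_density_pos) simp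
      ultimately show "x \<notin> {a<..<b}" by (auto simp: indicator_def ennreal_eq_0_iff split: if_splits)
    qed
    then have "emeasure lborel {a<..<b} = 0"
      by (subst (asm) AE_iff_measurable[where N = "{a<..<b}"]) auto
    then show False using assms by (simp add: emeasure_lborel_Ioo)
  qed
  then show ?thesis by (simp add: N.emeasure_eq_measure zero_less_measure_iff)
qed

section \<open>From increments on finite grids to independence of past and future\<close>

context prob_space
begin

text \<open>Both algebras are generated by cylinder sets, which are closed under intersection, so
  two cylinders suffice. On a grid of all times involved, values up to \<open>s\<close> are sums of
  the increments before \<open>s\<close>, and later differences are sums of those after
  \<open>s\<close>; the two groups are independent.\<close>

lemma independent_increments_past_future:
  fixes Y :: "real \<Rightarrow> 'a \<Rightarrow> real"
  assumes rv: "\<And>t. t \<ge> 0 \<Longrightarrow> Y t \<in> borel_measurable M"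
    and start: "\<And>\<omega>. \<omega> \<in> space M \<Longrightarrow> Y 0 \<omega> = 0"
    and incr: "\<And>n (\<tau> :: nat \<Rightarrow> real). 0 \<le> \<tau> 0 \<Longrightarrow> (\<And>i. i < n \<Longrightarrow> \<tau> i \<le> \<tau> (Suc i)) \<Longrightarrow>
        indep_vars (\<lambda>_. borel) (\<lambda>i \<omega>. Y (\<tau> (Suc i)) \<omega> - Y (\<tau> i) \<omega>) {..<n}"
    and s: "s \<ge> 0"
    and A: "A \<in> sets (generated_algebra (space M) {0..s} Y)"
    and C: "C \<in> sets (generated_algebra (space M) {s..} (\<lambda>t \<omega>. Y t \<omega> - Y s \<omega>))"
  shows "prob (A \<inter> C) = prob A * prob C"
proof -
  define cyl where "cyl I X = {{\<omega>\<in>space M. \<forall>t\<in>F. X t \<omega> \<in> D t} | F D. finite F \<and> F \<subseteq> I \<and> (\<forall>t. D t \<in> sets borel)}"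
    for I :: "real set" and X :: "real \<Rightarrow> 'a \<Rightarrow> real"
  have cylI: "{\<omega>\<in>space M. \<forall>t\<in>F. X t \<omega> \<in> D t} \<in> cyl I X"
    if "finite F" "F \<subseteq> I" "\<And>t. D t \<in> sets borel" for F D I X
    unfolding cyl_def using that by blast
  have stable: "Int_stable (cyl I X)" for I X
  proof (rule Int_stableI)
    fix a b assume "a \<in> cyl I X" "b \<in> cyl I X"
    then obtain F D F' D' where *: "a = {\<omega>\<in>space M. \<forall>t\<in>F. X t \<omega> \<in> D t}" "finite F" "F \<subseteq> I" "\<And>t. D t \<in> sets borel"
      "b = {\<omega>\<in>space M. \<forall>t\<in>F'. X t \<omega> \<in> D' t}" "finite F'" "F' \<subseteq> I" "\<And>t. D' t \<in> sets borel"
      unfolding cyl_def by blast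
    have "a \<inter> b = {\<omega>\<in>space M. \<forall>t\<in>F \<union> F'. X t \<omega> \<in> (if t \<in> F then D t else UNIV) \<inter> (if t \<in> F' then D' t else UNIV)}"
      unfolding * by auto
    also have "\<dots> \<in> cyl I X" using * by (intro cylI) auto
    finally show "a \<inter> b \<in> cyl I X" .
  qed
  have gen: "sets (generated_algebra (space M) I X) \<subseteq> sigma_sets (space M) (cyl I X)" for I X
    unfolding sets_generated_algebra
  proof (rule sigma_sets_mono', safe)
    fix i and B :: "real set" assume "i \<in> I" "B \<in> sets borel"
    then have "{\<omega>\<in>space M. \<forall>t\<in>{i}. X t \<omega> \<in> B} \<in> cyl I X" by (intro cylI) auto
    then show "X i -` B \<inter> space M \<in> cyl I X" by (simp add: vimage_def Int_def conj_commute)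
  qed
  let ?Z = "\<lambda>t \<omega>. Y t \<omega> - Y s \<omega>"
  have "indep_set (cyl {0..s} Y) (cyl {s..} ?Z)"
  proof (rule indep_setI)
    have "{\<omega>\<in>space M. \<forall>t\<in>F. X t \<omega> \<in> D t} \<in> events"
      if "finite F" "\<And>t. t \<in> F \<Longrightarrow> X t \<in> borel_measurable M" "\<And>t. D t \<in> sets borel"
      for F :: "real set" and X :: "real \<Rightarrow> 'a \<Rightarrow> real" and D
    proof (rule sets.sets_Collect_finite_All[OF _ that(1)])
      fix t assume "t \<in> F"
      with that show "{\<omega>\<in>space M. X t \<omega> \<in> D t} \<in> events" by measurable
    qed
    then have *: "cyl I X \<subseteq> events" if "\<And>t. t \<in> I \<Longrightarrow> X t \<in> borel_measurable M" for I X
      unfolding cyl_def using that by blast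
    show "cyl {0..s} Y \<subseteq> events" "cyl {s..} ?Z \<subseteq> events"
      using s by (auto intro!: * rv borel_measurable_diff)
  next
    fix a b assume "a \<in> cyl {0..s} Y" "b \<in> cyl {s..} ?Z"
    then obtain F D F' D' where *: "a = {\<omega>\<in>space M. \<forall>t\<in>F. Y t \<omega> \<in> D t}" "finite F" "F \<subseteq> {0..s}" "\<And>t. D t \<in> sets borel"
      "b = {\<omega>\<in>space M. \<forall>t\<in>F'. ?Z t \<omega> \<in> D' t}" "finite F'" "F' \<subseteq> {s..}" "\<And>t. D' t \<in> sets borel"
      unfolding cyl_def by blast
    \<comment> \<open>Time \<open>0\<close>, where the process vanishes, lets values be written as
      sums of increments, and \<open>s\<close> provides the index \<open>k\<close> at which the
      increments are split.\<close>
    define G where "G = F \<union> F' \<union> {0, s}"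
    define l where "l = sorted_list_of_set G"
    have fG: "finite G" using * by (simp add: G_def)
    have "G \<noteq> {}" by (simp add: G_def)
    then have l: "set l = G" "sorted l" "l \<noteq> []" unfolding l_def using fG by simp_all
    define n where "n = length l - 1"
    have len: "length l = Suc n" using l(3) by (simp add: n_def)
    define \<tau> where "\<tau> i = l ! min i n" for i
    have mono: "\<tau> i \<le> \<tau> j" if "i \<le> j" for i j
      unfolding \<tau>_def using that l(2) len by (intro sorted_nth_mono) auto
    have surj: "\<exists>i\<le>n. \<tau> i = t" if t: "t \<in> G" for t
    proof -
      obtain i where "i < length l" "l ! i = t" using t unfolding l(1)[symmetric] in_set_conv_nth by blast
      then show ?thesis by (intro exI[of _ i]) (auto simp: \<tau>_def len)
    qed
    have \<tau>G: "\<tau> i \<in> G" for i unfolding l(1)[symmetric] \<tau>_def by (rule nth_mem) (simp add: len)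
    have Gpos: "t \<ge> 0" if "t \<in> G" for t using that * s by (auto simp: G_def)
    obtain i0 where "\<tau> i0 = 0" using surj[of 0] by (auto simp: G_def)
    with mono[of 0 i0] Gpos[OF \<tau>G[of 0]] have \<tau>0: "\<tau> 0 = 0" by simp
    obtain k where k: "k \<le> n" "\<tau> k = s" using surj[of s] by (auto simp: G_def)
    define X where "X i \<omega> = Y (\<tau> (Suc i)) \<omega> - Y (\<tau> i) \<omega>" for i \<omega>
    have X: "indep_vars (\<lambda>_. borel) X {..<n}"
      unfolding X_def using \<tau>0 by (intro incr mono) auto
    have tele: "(\<Sum>q\<in>{i..<j}. X q \<omega>) = Y (\<tau> j) \<omega> - Y (\<tau> i) \<omega>" if "i \<le> j" for i j \<omega>
      unfolding X_def by (rule sum_Suc_diff'[OF that])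
    have "\<exists>i\<le>k. \<tau> i = t" if t: "t \<in> F" for t
    proof -
      obtain i where i: "i \<le> n" "\<tau> i = t" using surj[of t] t by (auto simp: G_def)
      show ?thesis
      proof (cases "i \<le> k")
        case False
        then have "\<tau> k \<le> \<tau> i" by (intro mono) auto
        with i k * t have "\<tau> k = t" by auto
        then show ?thesis by blast
      qed (use i in blast)
    qed
    then obtain pos where pos: "\<And>t. t \<in> F \<Longrightarrow> pos t \<le> k" "\<And>t. t \<in> F \<Longrightarrow> \<tau> (pos t) = t" by metis
    have "\<exists>i. k \<le> i \<and> i \<le> n \<and> \<tau> i = t" if t: "t \<in> F'" for t
    proof -
      obtain i where i: "i \<le> n" "\<tau> i = t" using surj[of t] t by (auto simp: G_def)
      show ?thesis
      proof (cases "k \<le> i")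
        case False
        then have "\<tau> i \<le> \<tau> k" by (intro mono) auto
        with i k * t have "\<tau> k = t" by auto
        then show ?thesis using k by blast
      qed (use i in blast)
    qed
    then obtain pos' where pos': "\<And>t. t \<in> F' \<Longrightarrow> k \<le> pos' t" "\<And>t. t \<in> F' \<Longrightarrow> pos' t \<le> n" "\<And>t. t \<in> F' \<Longrightarrow> \<tau> (pos' t) = t"
      by metis
    let ?P = "PiM {..<k} (\<lambda>_. borel :: real measure)" and ?P' = "PiM {k..<n} (\<lambda>_. borel :: real measure)"
    let ?X = "\<lambda>\<omega>. restrict (\<lambda>i. X i \<omega>) {..<k}" and ?X' = "\<lambda>\<omega>. restrict (\<lambda>i. X i \<omega>) {k..<n}"
    have ind: "indep_var ?P ?X ?P' ?X'"
      using k by (intro indep_var_restrict[OF X]) auto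
    define U where "U = {x\<in>space ?P. \<forall>t\<in>F. (\<Sum>q\<in>{0..<pos t}. x q) \<in> D t}"
    define U' where "U' = {x\<in>space ?P'. \<forall>t\<in>F'. (\<Sum>q\<in>{k..<pos' t}. x q) \<in> D' t}"
    have Um: "U \<in> sets ?P" unfolding U_def
    proof (rule sets.sets_Collect_finite_All[OF _ *(2)])
      fix t assume t: "t \<in> F"
      have "(\<lambda>x. \<Sum>q\<in>{0..<pos t}. x q) \<in> borel_measurable ?P"
        using pos(1)[OF t] by (intro borel_measurable_sum measurable_component_singleton) auto
      then show "{x\<in>space ?P. (\<Sum>q\<in>{0..<pos t}. x q) \<in> D t} \<in> sets ?P" using *(4) by measurable
    qed
    have U'm: "U' \<in> sets ?P'" unfolding U'_def
    proof (rule sets.sets_Collect_finite_All[OF _ *(6)])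
      fix t assume t: "t \<in> F'"
      have "(\<lambda>x. \<Sum>q\<in>{k..<pos' t}. x q) \<in> borel_measurable ?P'"
        using pos'(2)[OF t] by (intro borel_measurable_sum measurable_component_singleton) auto
      then show "{x\<in>space ?P'. (\<Sum>q\<in>{k..<pos' t}. x q) \<in> D' t} \<in> sets ?P'" using *(8) by measurable
    qed
    have sp: "?X \<omega> \<in> space ?P" "?X' \<omega> \<in> space ?P'" for \<omega> by (auto simp: space_PiM)
    have "(\<Sum>q\<in>{0..<pos t}. ?X \<omega> q) = Y t \<omega>" if "t \<in> F" "\<omega> \<in> space M" for t \<omega>
    proof -
      have "(\<Sum>q\<in>{0..<pos t}. ?X \<omega> q) = (\<Sum>q\<in>{0..<pos t}. X q \<omega>)"
        using pos(1)[OF that(1)] by (intro sum.cong) auto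
      then show ?thesis using tele[of 0 "pos t" \<omega>] start[OF that(2)] \<tau>0 pos(2)[OF that(1)] by simp
    qed
    then have a: "a = ?X -` U \<inter> space M" unfolding U_def *(1) using sp(1) by auto
    have "(\<Sum>q\<in>{k..<pos' t}. ?X' \<omega> q) = ?Z t \<omega>" if "t \<in> F'" for t \<omega>
    proof -
      have "(\<Sum>q\<in>{k..<pos' t}. ?X' \<omega> q) = (\<Sum>q\<in>{k..<pos' t}. X q \<omega>)"
        using pos'(2)[OF that(1)] by (intro sum.cong) auto
      then show ?thesis using tele[OF pos'(1)[OF that], of \<omega>] k pos'(3)[OF that(1)] by simp
    qed
    then have b: "b = ?X' -` U' \<inter> space M" unfolding U'_def *(5) using sp(2) by auto
    have "prob ((\<lambda>\<omega>. (?X \<omega>, ?X' \<omega>)) -` (U \<times> U') \<inter> space M) = prob a * prob b"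
      unfolding a b by (rule indep_varD[OF ind Um U'm])
    moreover have "(\<lambda>\<omega>. (?X \<omega>, ?X' \<omega>)) -` (U \<times> U') \<inter> space M = a \<inter> b" unfolding a b by auto
    ultimately show "prob (a \<inter> b) = prob a * prob b" by simp
  qed
  then have "indep_set (sigma_sets (space M) (cyl {0..s} Y)) (sigma_sets (space M) (cyl {s..} ?Z))"
    using stable by (intro indep_set_sigma_sets)
  then show ?thesis using indep_setD A C gen by blast
qed

end

lemma standard_brownian_motion_indep_increments:
  assumes "standard_brownian_motion M B"
  shows "indep_increments M B"
proof -
  interpret prob_space M using assms unfolding standard_brownian_motion_def by blast
  have rv [measurable]: "B t \<in> borel_measurable M" if "t \<ge> 0" for t
    using assms that unfolding standard_brownian_motion_def by blast
  have start: "B 0 \<omega> = 0" if "\<omega> \<in> space M" for \<omega>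
    using assms that unfolding standard_brownian_motion_def by blast
  have cont: "continuous_on {0..} (\<lambda>t. B t \<omega>)" if "\<omega> \<in> space M" for \<omega>
    using assms that unfolding standard_brownian_motion_def by blast
  have normal: "distributed M lborel (\<lambda>\<omega>. B t \<omega> - B s \<omega>) (normal_density 0 (sqrt (t - s)))" if "0 \<le> s" "s < t" for s t
    using assms that unfolding standard_brownian_motion_def by blast
  have incr: "indep_vars (\<lambda>_. borel) (\<lambda>i \<omega>. B (\<tau> (Suc i)) \<omega> - B (\<tau> i) \<omega>) {..<n}"
    if "0 \<le> \<tau> 0" "\<And>i. i < n \<Longrightarrow> \<tau> i \<le> \<tau> (Suc i)" for n and \<tau> :: "nat \<Rightarrow> real"
    using assms that unfolding standard_brownian_motion_def by blast
  show ?thesis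
  proof unfold_locales
    fix \<omega> and t :: real assume "\<omega> \<in> space M" "t \<ge> 0"
    then have "continuous (at t within {0..}) (\<lambda>t. B t \<omega>)"
      using cont[of \<omega>] by (simp add: continuous_on_eq_continuous_within)
    then show "continuous (at_right t) (\<lambda>t. B t \<omega>)"
      by (rule continuous_within_subset) (use \<open>t \<ge> 0\<close> in auto)
  next
    fix s :: real and A C assume "s \<ge> 0" "A \<in> sets (generated_algebra (space M) {0..s} B)"
      "C \<in> sets (generated_algebra (space M) {s..} (\<lambda>t \<omega>. B t \<omega> - B s \<omega>))"
    with rv start incr show "prob (A \<inter> C) = prob A * prob C"
      by (rule independent_increments_past_future)
  next
    fix s t a :: real assume st: "0 \<le> s" "s \<le> t" "a > 0"
    show "prob {\<omega>\<in>space M. \<bar>B t \<omega> - B s \<omega>\<bar> \<ge> a} \<le> (t - s + 1) / a\<^sup>2"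
    \<comment> \<open>A normal law is available for \<open>s < t\<close> only; for
      \<open>s = t\<close> the increment is zero and cannot reach \<open>a > 0\<close>.\<close>
    proof (cases "s = t")
      case True
      then show ?thesis using st by simp
    next
      case False
      let ?D = "\<lambda>\<omega>. B t \<omega> - B s \<omega>"
      have lt: "s < t" using False st by simp
      have D: "distributed M lborel ?D (normal_density 0 (sqrt (t - s)))" using normal st lt by blast
      have pos: "sqrt (t - s) > 0" using lt by simp
      have [measurable]: "B t \<in> borel_measurable M" "B s \<in> borel_measurable M" using st by auto
      have E: "expectation ?D = 0" by (rule normal_distributed_expectation[OF pos D])
      have V: "variance ?D = t - s" using normal_distributed_variance[OF pos D] lt by simp
      have I: "integrable M (\<lambda>\<omega>. (?D \<omega>)\<^sup>2)"
      proof -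
        have "integrable lborel (\<lambda>x. normal_density 0 (sqrt (t - s)) x * x\<^sup>2)"
          using integrable_normal_moment[OF pos, of 0 2] by simp
        then show ?thesis
          using distributed_integrable[OF D, of "\<lambda>x. x\<^sup>2"] by simp
      qed
      have "prob {\<omega>\<in>space M. a \<le> \<bar>?D \<omega> - expectation ?D\<bar>} \<le> variance ?D / a\<^sup>2"
        using I st by (intro Chebyshev_inequality) auto
      also have "\<dots> \<le> (t - s + 1) / a\<^sup>2" unfolding V by (intro divide_right_mono) auto
      finally show ?thesis unfolding E by simp
    qed
  next
    fix a b :: real assume "a < b"
    \<comment> \<open>By scaling, this one number serves for all time spans; the threshold
      \<open>1\<close> chosen below for \<open>H\<close> secures \<open>s < t\<close>.\<close>
    define d where "d = measure std_normal_distribution {a<..<b}"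
    have d: "d > 0" unfolding d_def by (rule std_normal_interval_pos[OF \<open>a < b\<close>])
    have "prob {\<omega>\<in>space M. a * sqrt (t - s) < B t \<omega> - B s \<omega> \<and> B t \<omega> - B s \<omega> < b * sqrt (t - s)} \<ge> d"
      if st: "0 \<le> s" "t - s \<ge> 1" for s t
    proof -
      let ?D = "\<lambda>\<omega>. B t \<omega> - B s \<omega>"
      have pos: "sqrt (t - s) > 0" using st by simp
      have D: "distributed M lborel ?D (normal_density 0 (sqrt (t - s)))" using normal st by auto
      have D1: "distributed M lborel (\<lambda>\<omega>. ?D \<omega> / sqrt (t - s)) std_normal_density"
        using iffD1[OF normal_standard_normal_convert[OF pos] D] by simp
      have "d = measure (distr M lborel (\<lambda>\<omega>. ?D \<omega> / sqrt (t - s))) {a<..<b}"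
        unfolding d_def using distributed_distr_eq_density[OF D1] by simp
      also have "\<dots> = prob ((\<lambda>\<omega>. ?D \<omega> / sqrt (t - s)) -` {a<..<b} \<inter> space M)"
        using distributed_measurable[OF D1] by (intro measure_distr) auto
      also have "(\<lambda>\<omega>. ?D \<omega> / sqrt (t - s)) -` {a<..<b} \<inter> space M =
          {\<omega>\<in>space M. a * sqrt (t - s) < ?D \<omega> \<and> ?D \<omega> < b * sqrt (t - s)}"
        using pos by (auto simp: pos_less_divide_eq pos_divide_less_eq)
      finally show ?thesis by simp
    qed
    then show "\<exists>d>0. \<exists>H>0. \<forall>s t. 0 \<le> s \<longrightarrow> t - s \<ge> H \<longrightarrow>
          prob {\<omega>\<in>space M. a * sqrt (t - s) < B t \<omega> - B s \<omega> \<and> B t \<omega> - B s \<omega> < b * sqrt (t - s)} \<ge> d"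
      using d by (intro exI[of _ d] conjI exI[of _ 1]) auto
  qed (use rv start in auto)
qed

text \<open>The limiting share \<open>1 / bump_end \<theta> N\<close> tends to \<open>1 / N\<close>
  as \<theta> tends to zero, so some \<theta> makes it exceed \<open>c\<close>. Taking \<theta>
  among the numbers \<open>1 / real (Suc n)\<close> keeps the almost sure statements behind
  \<open>freq\<close> countable in number. The map \<open>g\<close> embeds the window ends into the
  time axis, discrete or continuous.\<close>

lemma frequently_balanced:
  fixes Z :: "nat \<Rightarrow> 'c \<Rightarrow> real" and \<tau> :: "'c \<Rightarrow> real"
  assumes N: "N \<ge> 1" and g: "filterlim g F sequentially" "\<And>k. \<tau> (g k) = real (window (Suc k))"
    and freq: "\<And>n. \<exists>\<^sub>F k in sequentially. \<forall>j\<in>{1..N}. Z j (g k) \<ge> scale N (1 / real (Suc n)) k - 1"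
    and c: "c < 1 / real N"
  shows "\<exists>\<^sub>F x in F. \<forall>j\<in>{1..N}. Z j x / \<tau> x \<ge> c"
proof -
  have "(\<lambda>n. 1 / bump_end (1 / real (Suc n)) N) \<longlonglongrightarrow> 1 / (0 + real N * (1 + 0))"
    unfolding bump_end_def using N LIMSEQ_inverse_real_of_nat
    by (intro tendsto_intros) (auto simp: inverse_eq_divide)
  then have "\<forall>\<^sub>F n in sequentially. c < 1 / bump_end (1 / real (Suc n)) N"
    using c by (intro order_tendstoD) auto
  then obtain n where n: "c < 1 / bump_end (1 / real (Suc n)) N"
    using eventually_happens by fastforce
  have "\<forall>\<^sub>F k in sequentially. c < (scale N (1 / real (Suc n)) k - 1) / real (window (Suc k))"
    using n scale_ratio[of "1 / real (Suc n)" N] by (intro order_tendstoD) auto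
  then have "\<exists>\<^sub>F k in sequentially. (\<forall>j\<in>{1..N}. Z j (g k) \<ge> scale N (1 / real (Suc n)) k - 1) \<and>
      c < (scale N (1 / real (Suc n)) k - 1) / real (window (Suc k))"
    by (rule frequently_eventually_frequently[OF freq])
  then have *: "\<exists>\<^sub>F k in sequentially. \<forall>j\<in>{1..N}. Z j (g k) / \<tau> (g k) \<ge> c"
  proof (rule frequently_elim1, safe)
    fix k j assume k: "\<forall>j\<in>{1..N}. Z j (g k) \<ge> scale N (1 / real (Suc n)) k - 1"
        "c < (scale N (1 / real (Suc n)) k - 1) / real (window (Suc k))" and j: "j \<in> {1..N}"
    have "(scale N (1 / real (Suc n)) k - 1) / real (window (Suc k)) \<le> Z j (g k) / real (window (Suc k))"
      using k j by (intro divide_right_mono) auto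
    with k show "c \<le> Z j (g k) / \<tau> (g k)" unfolding g(2) by linarith
  qed
  show ?thesis
  proof (rule ccontr)
    assume "\<not> ?thesis"
    then have "\<forall>\<^sub>F x in F. \<not> (\<forall>j\<in>{1..N}. Z j x / \<tau> x \<ge> c)" by (simp add: not_frequently)
    then have "\<forall>\<^sub>F k in sequentially. \<not> (\<forall>j\<in>{1..N}. Z j (g k) / \<tau> (g k) \<ge> c)"
      using g(1) by (rule eventually_compose_filterlim)
    with * show False by (simp add: frequently_def)
  qed
qed

lemma filterlim_window: "filterlim (\<lambda>k. window (Suc k)) at_top sequentially"
proof (rule filterlim_at_top_mono[OF filterlim_ident], rule always_eventually, rule)
  fix k :: nat
  have "k \<le> 2 ^ k" by (rule less_imp_le[OF less_exp])
  also have "\<dots> \<le> window (Suc k)" unfolding window_def by (intro power_increasing) (auto simp: power2_eq_square)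
  finally show "k \<le> window (Suc k)" .
qed

section \<open>Reading off label indices at the bumps of good windows\<close>

definition bump_time :: "nat \<Rightarrow> real \<Rightarrow> nat \<Rightarrow> nat \<Rightarrow> real" where
  "bump_time N \<theta> k i = real (window k) + bump_end \<theta> i * scale N \<theta> k"

lemma good_window_bump_time:
  assumes "\<theta> > 0" "good_window N \<theta> f k" "i \<le> N"
  shows "(-1) ^ i * f (bump_time N \<theta> k i) > 0"
proof -
  have "bump_time N \<theta> k i \<in> {real (window k) + bump_start \<theta> i * scale N \<theta> k..real (window k) + bump_end \<theta> i * scale N \<theta> k}"
    using bump_start_le_end[of \<theta> i] scale_pos[OF assms(1), of N k] by (auto simp: bump_time_def mult_right_mono)
  then have "(-1) ^ i * f (bump_time N \<theta> k i) \<ge> sqrt (scale N \<theta> k)"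
    using assms unfolding good_window_def by blast
  moreover have "sqrt (scale N \<theta> k) > 0" using scale_pos[OF assms(1)] by simp
  ultimately show ?thesis by linarith
qed

lemma window_mono: "k \<le> k' \<Longrightarrow> window k \<le> window k'"
  unfolding window_def by (intro power_increasing power_mono) auto

lemma bump_time_mono:
  assumes "\<theta> > 0" "i \<le> i'"
  shows "bump_time N \<theta> k i \<le> bump_time N \<theta> k i'"
  using assms scale_pos[OF assms(1), of N k] bump_end_mono[of \<theta> i i'] by (auto simp: bump_time_def mult_right_mono)

lemma bump_time_less_window:
  assumes "\<theta> > 0" "i \<le> N" "k < k'"
  shows "bump_time N \<theta> k i \<le> bump_time N \<theta> k' i'"
proof -
  have "bump_time N \<theta> k i \<le> bump_time N \<theta> k N" using assms by (intro bump_time_mono) auto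
  also have "\<dots> = real (window (Suc k))" unfolding bump_time_def by (rule window_scale[OF assms(1)])
  also have "\<dots> \<le> real (window k')" using window_mono[of "Suc k" k'] assms(3) by simp
  also have "\<dots> \<le> bump_time N \<theta> k' i'"
    using scale_pos[OF assms(1), of N k'] bump_end_mono[of \<theta> 0 i'] assms(1) by (simp add: bump_time_def)
  finally show ?thesis .
qed

lemma bump_time_nonneg: "\<theta> > 0 \<Longrightarrow> bump_time N \<theta> k i \<ge> 0"
  using bump_end_mono[of \<theta> 0 i] scale_pos[of \<theta> N k] by (simp add: bump_time_def)

text \<open>Between the bumps selected in two good windows the sign changes: even when the two bumps
  themselves have the same sign, a bump of the opposite sign lies in between.\<close>

lemma bumps_separated:
  assumes \<theta>: "\<theta> > 0" and good: "good_window N \<theta> f k" "good_window N \<theta> f k'"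
    and i: "i \<in> {1..N}" "i' \<in> {1..N}" and less: "k < k' \<or> k = k' \<and> i < i'"
  obtains t where "bump_time N \<theta> k i \<le> t" "t \<le> bump_time N \<theta> k' i'" "f (bump_time N \<theta> k i) * f t < 0"
proof -
  have flip: "f (bump_time N \<theta> k i) * f (bump_time N \<theta> k'' i'') < 0"
    if "good_window N \<theta> f k''" "i'' \<le> N" "odd (i + i'')" for k'' i''
  proof -
    have "((-1) ^ i * f (bump_time N \<theta> k i)) * ((-1) ^ i'' * f (bump_time N \<theta> k'' i'')) > 0"
      using i that good by (intro mult_pos_pos good_window_bump_time \<theta>) auto
    also have "((-1) ^ i * f (bump_time N \<theta> k i)) * ((-1) ^ i'' * f (bump_time N \<theta> k'' i'')) =
        (-1) ^ (i + i'') * (f (bump_time N \<theta> k i) * f (bump_time N \<theta> k'' i''))"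
      by (simp add: power_add mult_ac)
    also have "(-1 :: real) ^ (i + i'') = -1" using that by (simp add: minus_one_power_iff)
    finally show ?thesis by simp
  qed
  show ?thesis
  proof (cases "k < k'")
    case True
    \<comment> \<open>Bump \<open>0\<close> or bump \<open>1\<close> of the later window, whichever
      has the parity opposite to \<open>i\<close>. Either one comes no later than bump
      \<open>i'\<close> because \<open>i' \<ge> 1\<close>.\<close>
    define i'' where "i'' = (if odd i then 0 else 1 :: nat)"
    have "i'' \<le> N" "i'' \<le> i'" "odd (i + i'')" using i by (auto simp: i''_def)
    then show ?thesis
      using \<theta> True i by (intro that[of "bump_time N \<theta> k' i''"] flip[OF good(2)] bump_time_mono bump_time_less_window) auto
  next
    case False
    with less have "k = k'" "Suc i \<le> i'" by auto
    then show ?thesis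
      using \<theta> i unfolding \<open>k = k'\<close>[symmetric]
      by (intro that[of "bump_time N \<theta> k (Suc i)", folded \<open>k = k'\<close>] flip[OF good(1)] bump_time_mono) auto
  qed
qed

text \<open>\<open>idx t\<close> stands for the index of the label in force at time
  \<open>t\<close>; it stays abstract because the two spiders number their labels differently. The
  end of a bump represents its excursion, and bump \<open>0\<close> is left out because no label is
  prescribed for it.\<close>

definition bump_selection :: "nat \<Rightarrow> real \<Rightarrow> (real \<Rightarrow> nat) \<Rightarrow> (real \<Rightarrow> real) \<Rightarrow> nat \<Rightarrow> nat list option" where
  "bump_selection N \<theta> idx f k =
    (if good_window N \<theta> f k then Some (map (\<lambda>i. idx (bump_time N \<theta> k (Suc i))) [0..<N]) else None)"

text \<open>By \<open>sep\<close>, equal indices at two times rule out a sign change in between. Any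
  two of the selected bumps, from the same window or not, do have one between them, so all indices
  are different.\<close>

lemma valid_bump_selection:
  assumes \<theta>: "\<theta> > 0" and freq: "\<exists>\<^sub>F k in sequentially. good_window N \<theta> f k"
    and idx: "\<And>t. t \<ge> 0 \<Longrightarrow> f t \<noteq> 0 \<Longrightarrow> idx t \<ge> 1"
    and sep: "\<And>s t t'. 0 \<le> s \<Longrightarrow> s \<le> t' \<Longrightarrow> t' \<le> t \<Longrightarrow> f s \<noteq> 0 \<Longrightarrow> f t \<noteq> 0 \<Longrightarrow> idx s = idx t \<Longrightarrow> f s * f t' > 0"
  shows "valid_selection N (bump_selection N \<theta> idx f)"
proof -
  let ?t = "bump_time N \<theta>"
  have ne: "f (?t k i) \<noteq> 0" if "good_window N \<theta> f k" "i \<le> N" for k i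
    using good_window_bump_time[OF \<theta> that] by auto
  have neq_less: "idx (?t k i) \<noteq> idx (?t k' i')"
    if A: "good_window N \<theta> f k" "good_window N \<theta> f k'" "i \<in> {1..N}" "i' \<in> {1..N}" "k < k' \<or> k = k' \<and> i < i'" for k k' i i'
  proof
    assume eq: "idx (?t k i) = idx (?t k' i')"
    obtain t where t: "?t k i \<le> t" "t \<le> ?t k' i'" "f (?t k i) * f t < 0"
      using bumps_separated[OF \<theta> A] by blast
    have "f (?t k i) * f t > 0"
      using A eq by (intro sep[OF bump_time_nonneg[OF \<theta>] t(1,2)] ne) auto
    with t(3) show False by simp
  qed
  have neq: "idx (?t k i) \<noteq> idx (?t k' i')"
    if "good_window N \<theta> f k" "good_window N \<theta> f k'" "i \<in> {1..N}" "i' \<in> {1..N}" "(k, i) \<noteq> (k', i')" for k k' i i'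
    using neq_less[OF that(1,2,3,4)] neq_less[OF that(2,1,4,3)] that(5) by (metis linorder_neqE_nat)
  show ?thesis
    unfolding valid_selection_def
  proof (intro conjI allI impI)
    show "\<exists>\<^sub>F k in sequentially. bump_selection N \<theta> idx f k \<noteq> None"
      using freq by (rule frequently_elim1) (simp add: bump_selection_def)
  next
    fix k l assume "bump_selection N \<theta> idx f k = Some l"
    then have good: "good_window N \<theta> f k" and l: "l = map (\<lambda>i. idx (?t k (Suc i))) [0..<N]"
      by (auto simp: bump_selection_def split: if_splits)
    show "length l = N" by (simp add: l)
    show "set l \<subseteq> {1..}"
      using idx[OF bump_time_nonneg[OF \<theta>] ne[OF good]] by (force simp: l)
    show "distinct l"
      unfolding l distinct_map
    proof
      show "inj_on (\<lambda>i. idx (?t k (Suc i))) (set [0..<N])"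
      proof (rule inj_onI)
        fix i i' assume "i \<in> set [0..<N]" "i' \<in> set [0..<N]" "idx (?t k (Suc i)) = idx (?t k (Suc i'))"
        then show "i = i'" using neq[OF good good, of "Suc i" "Suc i'"] by auto
      qed
    qed simp
  next
    fix k k' l l' assume "k \<noteq> k'" "bump_selection N \<theta> idx f k = Some l" "bump_selection N \<theta> idx f k' = Some l'"
    then have good: "good_window N \<theta> f k" "good_window N \<theta> f k'" and l: "l = map (\<lambda>i. idx (?t k (Suc i))) [0..<N]"
        "l' = map (\<lambda>i. idx (?t k' (Suc i))) [0..<N]"
      by (auto simp: bump_selection_def split: if_splits)
    show "set l \<inter> set l' = {}"
    proof (rule ccontr)
      assume "set l \<inter> set l' \<noteq> {}"
      then obtain i i' where "i < N" "i' < N" "idx (?t k (Suc i)) = idx (?t k' (Suc i'))"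
        by (auto simp: l)
      then show False using neq[OF good, of "Suc i" "Suc i'"] \<open>k \<noteq> k'\<close> by auto
    qed
  qed
qed

lemma sets_bump_selection:
  assumes "{\<omega>\<in>space G. good_window N \<theta> (\<lambda>t. Y t \<omega>) k} \<in> sets G"
    and "\<And>i. i < N \<Longrightarrow> (\<lambda>\<omega>. idx (bump_time N \<theta> k (Suc i)) \<omega>) \<in> measurable G (count_space UNIV)"
  shows "{\<omega>\<in>space G. bump_selection N \<theta> (\<lambda>t. idx t \<omega>) (\<lambda>t. Y t \<omega>) k = v} \<in> sets G"
proof (cases v)
  case None
  then have "{\<omega>\<in>space G. bump_selection N \<theta> (\<lambda>t. idx t \<omega>) (\<lambda>t. Y t \<omega>) k = v} =
      space G - {\<omega>\<in>space G. good_window N \<theta> (\<lambda>t. Y t \<omega>) k}"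
    by (auto simp: bump_selection_def)
  then show ?thesis using assms(1) by auto
next
  case (Some l)
  show ?thesis
  proof (cases "length l = N")
    case True
    then have "{\<omega>\<in>space G. bump_selection N \<theta> (\<lambda>t. idx t \<omega>) (\<lambda>t. Y t \<omega>) k = v} =
        {\<omega>\<in>space G. good_window N \<theta> (\<lambda>t. Y t \<omega>) k} \<inter>
        {\<omega>\<in>space G. \<forall>i\<in>{..<N}. idx (bump_time N \<theta> k (Suc i)) \<omega> = l ! i}"
      by (auto simp: bump_selection_def Some list_eq_iff_nth_eq)
    moreover have "{\<omega>\<in>space G. idx (bump_time N \<theta> k (Suc i)) \<omega> = l ! i} \<in> sets G" if "i < N" for i
      using measurable_sets[OF assms(2)[OF that], of "{l ! i}"] by (simp add: vimage_def Int_def conj_commute)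
    ultimately show ?thesis using assms(1) by (auto intro!: sets.sets_Collect_finite_All)
  next
    case False
    then have "{\<omega>\<in>space G. bump_selection N \<theta> (\<lambda>t. idx t \<omega>) (\<lambda>t. Y t \<omega>) k = v} = {}"
      by (auto simp: bump_selection_def Some)
    then show ?thesis by (metis sets.empty_sets)
  qed
qed

section \<open>Excursions of a continuous path and the time spent on a leg\<close>

lemma excursion_components:
  fixes f :: "real \<Rightarrow> real"
  assumes cont: "continuous_on {0..} f" and f0: "f 0 = 0"
    and J: "bij_betw J {1::nat..} (excursion_intervals f)"
  shows "t \<ge> 0 \<Longrightarrow> f t \<noteq> 0 \<Longrightarrow> \<exists>!m. m \<ge> 1 \<and> t \<in> J m"
    and "m \<ge> 1 \<Longrightarrow> t \<in> J m \<Longrightarrow> t \<ge> 0 \<and> f t \<noteq> 0"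
    and "m \<ge> 1 \<Longrightarrow> open (J m)"
    and "m \<ge> 1 \<Longrightarrow> s \<in> J m \<Longrightarrow> t \<in> J m \<Longrightarrow> s \<le> t' \<Longrightarrow> t' \<le> t \<Longrightarrow> t' \<in> J m \<and> f s * f t' > 0"
    and "m \<ge> 1 \<Longrightarrow> 0 \<le> u \<Longrightarrow> t \<in> {u..v} \<Longrightarrow> t \<in> J m \<Longrightarrow> (\<And>x. x \<in> {u..v} \<Longrightarrow> f x \<noteq> 0) \<Longrightarrow> {u..v} \<subseteq> J m"
proof -
  \<comment> \<open>As \<open>f\<close> vanishes at the boundary point \<open>0\<close>, the set
    \<open>U\<close> is open on the whole line. The claims are then facts about its connected
    components: they partition \<open>U\<close>, are open, contain every interval in
    \<open>U\<close> that they meet, and admit no sign change by the intermediate value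
    theorem.\<close>
  define U where "U = {t. 0 \<le> t \<and> \<bar>f t\<bar> \<noteq> 0}"
  have comp: "J m \<in> components U" if "m \<ge> 1" for m
    using J that unfolding excursion_intervals_def U_def by (auto dest: bij_betw_apply)
  have subU: "J m \<subseteq> U" if "m \<ge> 1" for m using comp[OF that] by (rule in_components_subset)
  have inj: "m = n" if "m \<ge> 1" "n \<ge> 1" "t \<in> J m" "t \<in> J n" for m n t
  proof -
    have "J m = J n" using components_eq[OF comp[OF that(1)] comp[OF that(2)]] that by blast
    then show ?thesis using J that unfolding bij_betw_def inj_on_def by auto
  qed
  show "\<exists>!m. m \<ge> 1 \<and> t \<in> J m" if "t \<ge> 0" "f t \<noteq> 0" for t
  proof -
    have "t \<in> \<Union> (components U)" using that by (auto simp: U_def Union_components)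
    also have "components U = J ` {1..}" using J unfolding bij_betw_def excursion_intervals_def U_def by simp
    finally show ?thesis using inj by blast
  qed
  show sub: "t \<ge> 0 \<and> f t \<noteq> 0" if "m \<ge> 1" "t \<in> J m" for m t using subU[OF that(1)] that(2) by (auto simp: U_def)
  have "continuous_on {0<..} f" by (rule continuous_on_subset[OF cont]) auto
  then have "open ({0<..} \<inter> f -` (- {0}))"
    by (intro continuous_open_preimage) auto
  also have "{0<..} \<inter> f -` (- {0}) = U" using f0 by (auto simp: U_def order.order_iff_strict)
  finally show "open (J m)" if "m \<ge> 1" for m using open_components comp[OF that] by blast
  show "t' \<in> J m \<and> f s * f t' > 0"
    if m: "m \<ge> 1" and st: "s \<in> J m" "t \<in> J m" "s \<le> t'" "t' \<le> t" for m s t t'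
  proof -
    have conn: "connected (J m)" using comp[OF m] by (rule in_components_connected)
    have sub_int: "{s..t} \<subseteq> J m"
      using conn st(1,2) by (rule connected_contains_Icc)
    have "f s * f t' > 0"
    proof (rule ccontr)
      assume n: "\<not> f s * f t' > 0"
      have "f s \<noteq> 0" "f t' \<noteq> 0" using sub[OF m] st sub_int by auto
      then have "f s < 0 \<and> f t' > 0 \<or> f s > 0 \<and> f t' < 0" using n by (auto simp: zero_less_mult_iff)
      moreover have c: "continuous_on {s..t'} f"
        using sub[OF m st(1)] by (intro continuous_on_subset[OF cont]) auto
      ultimately have "\<exists>x. s \<le> x \<and> x \<le> t' \<and> f x = 0"
        using st IVT'[of f s 0 t'] IVT2'[of f t' 0 s] by auto
      then obtain x where "s \<le> x" "x \<le> t'" "f x = 0" by blast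
      then have "x \<in> {s..t}" "f x = 0" using st by auto
      then show False using sub_int sub[OF m, of x] by auto
    qed
    then show ?thesis using sub_int st by auto
  qed
  show "{u..v} \<subseteq> J m" if "m \<ge> 1" "0 \<le> u" "t \<in> {u..v}" "t \<in> J m" "\<And>x. x \<in> {u..v} \<Longrightarrow> f x \<noteq> 0" for m u v t
    using that by (intro components_maximal[OF comp[OF that(1)]]) (auto simp: U_def)
qed

text \<open>Where the path does not vanish, the index is unique; the formulation by
  \<open>LEAST\<close> makes its measurability in the random path immediate.\<close>

definition excursion_index :: "(nat \<Rightarrow> real set) \<Rightarrow> real \<Rightarrow> nat" where
  "excursion_index J t = (LEAST m. m \<ge> 1 \<and> t \<in> J m)"

text \<open>Spider paths are specified at nonnegative times only, so measurability is asked of the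
  preimage within \<open>A\<close> instead of that of \<open>w\<close>.\<close>

lemma set_integral_indicator:
  assumes "A \<in> sets borel" "{s. w s \<in> L} \<inter> A = D" "D \<in> sets borel"
  shows "(LINT s:A|lborel. indicator L (w s) :: real) = measure lborel D"
proof -
  have "(LINT s:A|lborel. indicator L (w s) :: real) = (LINT s|lborel. indicator D s)"
    unfolding set_lebesgue_integral_def assms(2)[symmetric]
    by (intro Bochner_Integration.integral_cong) (auto simp: indicator_def)
  then show ?thesis using assms(3) by simp
qed

text \<open>The time spent on leg \<open>j\<close> is the Lebesgue measure of the open set
  \<open>D j\<close>, the union of all excursions with label \<open>j\<close>. These sets fill the
  time axis up to zeros of the path, and \<open>D j\<close> contains a whole bump when the labels
  match.\<close>

lemma spider_path_occupation:
  fixes f :: "real \<Rightarrow> real" and c :: "nat \<Rightarrow> nat"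
  assumes N: "N \<ge> 1" and cont: "continuous_on {0..} f" and f0: "f 0 = 0"
    and J: "bij_betw J {1::nat..} (excursion_intervals f)"
    and c: "\<And>m. m \<ge> 1 \<Longrightarrow> c m \<in> {1..N}"
    and w: "\<And>t. t \<ge> 0 \<Longrightarrow> w t = (if f t \<noteq> 0
      then (\<Sum>m. indicator (J (Suc m)) t * spider_point N \<bar>f t\<bar> (c (Suc m))) else 0)"
    and null: "AE t in lborel. t > 0 \<longrightarrow> f t \<noteq> 0"
  shows "t > 0 \<Longrightarrow> (\<Sum>j\<in>{1..N}. brownian_occ N w j t) = t"
    and "\<theta> > 0 \<Longrightarrow> matching N (bump_selection N \<theta> (excursion_index J) f k) c \<Longrightarrow> j \<in> {1..N} \<Longrightarrow>
      brownian_occ N w j (real (window (Suc k))) \<ge> scale N \<theta> k"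
proof -
  note comp = excursion_components[OF cont f0 J]
  let ?e = "excursion_index J"
  have e: "?e t \<ge> 1" "t \<in> J (?e t)" "\<And>m. m \<ge> 1 \<Longrightarrow> t \<in> J m \<Longrightarrow> m = ?e t" if t: "t \<ge> 0" "f t \<noteq> 0" for t
  proof -
    obtain m where m: "m \<ge> 1" "t \<in> J m" "\<And>n. n \<ge> 1 \<and> t \<in> J n \<Longrightarrow> n = m" using comp(1)[OF t] by blast
    have "?e t \<ge> 1 \<and> t \<in> J (?e t)" unfolding excursion_index_def by (rule LeastI[of _ m]) (use m(1,2) in blast)
    moreover from this have "?e t = m" using m(3) by blast
    ultimately show "?e t \<ge> 1" "t \<in> J (?e t)" "\<And>m. m \<ge> 1 \<Longrightarrow> t \<in> J m \<Longrightarrow> m = ?e t"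
      using m(3) by blast+
  qed
  have we: "w t = spider_point N \<bar>f t\<bar> (c (?e t))" if t: "t \<ge> 0" "f t \<noteq> 0" for t
  proof -
    \<comment> \<open>The series starts at the excursion with number \<open>1\<close>, so excursion
      \<open>?e t\<close> is its term with index \<open>?e t - 1\<close>, the only one that does not
      vanish at time \<open>t\<close>.\<close>
    have "indicator (J (Suc m)) t * spider_point N \<bar>f t\<bar> (c (Suc m)) =
        (if m = ?e t - 1 then spider_point N \<bar>f t\<bar> (c (?e t)) else 0)" for m
    proof (cases "Suc m = ?e t")
      case True
      moreover from True have "m = ?e t - 1" by simp
      moreover have "t \<in> J (Suc m)" using e(2)[OF t] True by simp
      ultimately show ?thesis by simp
    next
      case False
      then have "t \<notin> J (Suc m)" using e(3)[OF t, of "Suc m"] by (metis Suc_eq_plus1 le_add2)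
      moreover have "m \<noteq> ?e t - 1" using False e(1)[OF t] by linarith
      ultimately show ?thesis by simp
    qed
    then have "w t = (\<Sum>m. if m = ?e t - 1 then spider_point N \<bar>f t\<bar> (c (?e t)) else 0)"
      using w[OF t(1)] t by simp
    also have "\<dots> = spider_point N \<bar>f t\<bar> (c (?e t))"
      by (rule sums_unique[OF sums_single, symmetric])
    finally show ?thesis .
  qed
  define D where "D j = (\<Union>m\<in>{m. m \<ge> 1 \<and> c m = j}. J m)" for j
  have D_open: "open (D j)" for j unfolding D_def using comp(3) by auto
  have leg_iff: "w t \<in> leg N j \<longleftrightarrow> t \<in> D j" if "t \<ge> 0" "j \<in> {1..N}" for t j
  proof (cases "f t = 0")
    case True
    then show ?thesis using w[OF that(1)] comp(2)[of _ t] by (auto simp: D_def)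
  next
    case False
    have "w t \<in> leg N j \<longleftrightarrow> c (?e t) = j"
      unfolding we[OF that(1) False] using False c[OF e(1)[OF that(1) False]] that
      by (intro spider_point_in_leg_iff) auto
    then show ?thesis using e[OF that(1) False] unfolding D_def by blast
  qed
  have occ: "brownian_occ N w j t = measure lborel ({0..t} \<inter> D j)" if "j \<in> {1..N}" for j t
    unfolding brownian_occ_def using leg_iff that D_open by (intro set_integral_indicator) auto
  show "(\<Sum>j\<in>{1..N}. brownian_occ N w j t) = t" if t: "t > 0" for t
  proof -
    have fin: "emeasure lborel ({0..t} \<inter> D j) \<noteq> \<infinity>" for j
      by (rule less_imp_neq[OF emeasure_bounded_finite]) (auto intro: bounded_subset[of "{0..t}"])
    have "(\<Sum>j\<in>{1..N}. brownian_occ N w j t) = (\<Sum>j\<in>{1..N}. measure lborel ({0..t} \<inter> D j))"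
      by (intro sum.cong occ) auto
    also have "\<dots> = measure lborel (\<Union>j\<in>{1..N}. {0..t} \<inter> D j)"
    proof (rule measure_finite_Union[symmetric])
      show "disjoint_family_on (\<lambda>j. {0..t} \<inter> D j) {1..N}"
        unfolding disjoint_family_on_def D_def using comp(1,2) by (auto; blast)
    qed (use D_open fin in auto)
    also have "\<dots> = measure lborel {0..t}"
    proof (rule measure_eq_AE)
      show "AE x in lborel. x \<in> (\<Union>j\<in>{1..N}. {0..t} \<inter> D j) \<longleftrightarrow> x \<in> {0..t}"
        using null AE_lborel_singleton[of 0]
      proof eventually_elim
        fix x assume x: "x > 0 \<longrightarrow> f x \<noteq> 0" "x \<noteq> (0::real)"
        have "x \<in> (\<Union>j\<in>{1..N}. D j)" if "x \<in> {0..t}"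
        proof -
          have fx: "x \<ge> 0" "f x \<noteq> 0" using x that by auto
          show ?thesis unfolding D_def using e[OF fx] c[OF e(1)[OF fx]] by blast
        qed
        then show "x \<in> (\<Union>j\<in>{1..N}. {0..t} \<inter> D j) \<longleftrightarrow> x \<in> {0..t}" by auto
      qed
    qed (use D_open in auto)
    also have "\<dots> = t" using t by simp
    finally show ?thesis .
  qed
  show "brownian_occ N w j (real (window (Suc k))) \<ge> scale N \<theta> k"
    if \<theta>: "\<theta> > 0" and m: "matching N (bump_selection N \<theta> ?e f k) c" and j: "j \<in> {1..N}" for \<theta> k j
  proof -
    obtain l where l: "bump_selection N \<theta> ?e f k = Some l" "\<And>i. i < N \<Longrightarrow> c (l ! i) = Suc i"
      using m by (auto simp: matching_def)
    then have good: "good_window N \<theta> f k" and l': "l = map (\<lambda>i. ?e (bump_time N \<theta> k (Suc i))) [0..<N]"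
      by (auto simp: bump_selection_def split: if_splits)
    have cj: "c (?e (bump_time N \<theta> k j)) = j"
    proof -
      have "j - 1 < N" using j by auto
      from l(2)[OF this] show ?thesis using j \<open>j - 1 < N\<close> by (simp add: l')
    qed
    let ?s = "scale N \<theta> k"
    have s: "?s > 0" by (rule scale_pos[OF \<theta>])
    define u where "u = real (window k) + bump_start \<theta> j * ?s"
    define v where "v = bump_time N \<theta> k j"
    have uv: "v - u = ?s" using j by (auto simp: u_def v_def bump_time_def bump_start_def algebra_simps)
    have "u \<ge> 0" using bump_start_ge[of \<theta> j] \<theta> s by (simp add: u_def)
    have nz: "f x \<noteq> 0" if x: "x \<in> {u..v}" for x
    proof -
      have "(-1) ^ j * f x \<ge> sqrt ?s"
        using good x j unfolding good_window_def u_def v_def bump_time_def by auto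
      moreover have "sqrt ?s > 0" using s by simp
      ultimately show ?thesis by auto
    qed
    have v: "v \<ge> 0" "f v \<noteq> 0" "v \<in> {u..v}" using \<open>u \<ge> 0\<close> uv s nz[of v] by auto
    \<comment> \<open>The bump is an interval without zeros, so it lies entirely in the excursion
      through its end \<open>v\<close>, which is the excursion whose label has been matched.\<close>
    have "{u..v} \<subseteq> J (?e v)" using comp(5)[OF e(1)[OF v(1,2)] \<open>u \<ge> 0\<close> v(3) e(2)[OF v(1,2)]] nz by blast
    also have "\<dots> \<subseteq> D j" unfolding D_def using cj e(1)[OF v(1,2)] by (auto simp: v_def)
    finally have sub: "{u..v} \<subseteq> D j" .
    have "v \<le> real (window (Suc k))"
      using bump_time_mono[OF \<theta>, of j N N k] j window_scale[OF \<theta>, of k N] by (simp add: v_def bump_time_def)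
    then have "{u..v} \<subseteq> {0..real (window (Suc k))} \<inter> D j" using sub \<open>u \<ge> 0\<close> by auto
    then have "measure lborel {u..v} \<le> measure lborel ({0..real (window (Suc k))} \<inter> D j)"
      using D_open by (intro measure_mono_fmeasurable fmeasurable_Int_fmeasurable) (auto intro: fmeasurable_compact)
    then show ?thesis unfolding occ[OF j] using uv s by simp
  qed
qed

text \<open>For each fixed positive time the normal law gives zero no mass; Fubini's theorem
  exchanges the roles of time and chance. This takes joint measurability in both, which comes from
  approximating the path along grids.\<close>

lemma AE_zero_set_null:
  assumes "standard_brownian_motion M B"
  shows "AE \<omega> in M. AE t in lborel. t > 0 \<longrightarrow> B t \<omega> \<noteq> 0"
proof -
  interpret prob_space M using assms unfolding standard_brownian_motion_def by blast
  interpret P: pair_sigma_finite lborel M ..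
  have rv: "B t \<in> borel_measurable M" if "t \<ge> 0" for t
    using assms that unfolding standard_brownian_motion_def by blast
  have start: "B 0 \<omega> = 0" if "\<omega> \<in> space M" for \<omega>
    using assms that unfolding standard_brownian_motion_def by blast
  have cont: "continuous_on {0..} (\<lambda>t. B t \<omega>)" if "\<omega> \<in> space M" for \<omega>
    using assms that unfolding standard_brownian_motion_def by blast
  have normal: "distributed M lborel (\<lambda>\<omega>. B t \<omega> - B s \<omega>) (normal_density 0 (sqrt (t - s)))" if "0 \<le> s" "s < t" for s t
    using assms that unfolding standard_brownian_motion_def by blast
  \<comment> \<open>The path is evaluated at the grid point of mesh \<open>1 / Suc n\<close> to the
    left of the time, a countable choice and hence measurable. \<open>max 0\<close> avoids negative
    times, at which nothing is known about \<open>B\<close>.\<close>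
  define g where "g n z = B (max 0 (real_of_int \<lfloor>fst z * real (Suc n)\<rfloor> / real (Suc n))) (snd z)" for n z
  have g [measurable]: "g n \<in> borel_measurable (lborel \<Otimes>\<^sub>M M)" for n
    unfolding g_def
  proof (rule measurable_compose_countable[where f = "\<lambda>i z. B (max 0 (real_of_int i / real (Suc n))) (snd z)"])
    fix i :: int
    show "(\<lambda>z. B (max 0 (real_of_int i / real (Suc n))) (snd z)) \<in> borel_measurable (lborel \<Otimes>\<^sub>M M)"
      using rv by (intro measurable_compose[OF measurable_snd]) auto
  qed measurable
  have lim: "(\<lambda>n. g n z) \<longlonglongrightarrow> B (max 0 (fst z)) (snd z)" if z: "z \<in> space (lborel \<Otimes>\<^sub>M M)" for z
  proof -
    let ?r = "\<lambda>n. real_of_int \<lfloor>fst z * real (Suc n)\<rfloor> / real (Suc n)"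
    have "?r \<longlonglongrightarrow> fst z"
    proof (rule tendsto_sandwich)
      show "(\<lambda>n. fst z - inverse (real (Suc n))) \<longlonglongrightarrow> fst z"
        using tendsto_diff[OF tendsto_const LIMSEQ_inverse_real_of_nat] by simp
      have *: "fst z * real (Suc n) - 1 \<le> real_of_int \<lfloor>fst z * real (Suc n)\<rfloor>" for n by linarith
      show "\<forall>\<^sub>F n in sequentially. fst z - inverse (real (Suc n)) \<le> ?r n"
      proof (rule always_eventually, rule)
        fix n
        have "fst z - inverse (real (Suc n)) = (fst z * real (Suc n) - 1) / real (Suc n)"
          by (simp add: diff_divide_distrib inverse_eq_divide)
        also have "\<dots> \<le> ?r n" using *[of n] by (intro divide_right_mono) auto
        finally show "fst z - inverse (real (Suc n)) \<le> ?r n" .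
      qed
      show "\<forall>\<^sub>F n in sequentially. ?r n \<le> fst z"
        by (rule always_eventually) (simp add: pos_divide_le_eq)
    qed (rule tendsto_const)
    then have "(\<lambda>n. max 0 (?r n)) \<longlonglongrightarrow> max 0 (fst z)" by (intro tendsto_intros)
    then show ?thesis unfolding g_def
      using z by (intro continuous_on_tendsto_compose[OF cont]) (auto simp: space_pair_measure)
  qed
  have [measurable]: "(\<lambda>z. B (max 0 (fst z)) (snd z)) \<in> borel_measurable (lborel \<Otimes>\<^sub>M M)"
    by (rule borel_measurable_LIMSEQ_real[OF lim g])
  have "AE t in lborel. AE \<omega> in M. t > 0 \<longrightarrow> B (max 0 t) \<omega> \<noteq> 0"
  proof (rule AE_I2)
    fix t :: real
    show "AE \<omega> in M. t > 0 \<longrightarrow> B (max 0 t) \<omega> \<noteq> 0"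
    proof (cases "t > 0")
      case True
      have D: "distributed M lborel (\<lambda>\<omega>. B t \<omega> - B 0 \<omega>) (normal_density 0 (sqrt (t - 0)))"
        using normal[of 0 t] True by simp
      have "emeasure M ((\<lambda>\<omega>. B t \<omega> - B 0 \<omega>) -` {0} \<inter> space M) =
          (\<integral>\<^sup>+x. ennreal (normal_density 0 (sqrt (t - 0)) x) * indicator {0} x \<partial>lborel)"
        using distributed_emeasure[OF D, of "{0}"] by simp
      also have "\<dots> = 0"
        by (simp add: nn_integral_0_iff_AE)
      finally have "(\<lambda>\<omega>. B t \<omega> - B 0 \<omega>) -` {0} \<inter> space M \<in> null_sets M"
        using distributed_measurable[OF D] by (intro null_setsI) auto
      then have "AE \<omega> in M. \<omega> \<notin> (\<lambda>\<omega>. B t \<omega> - B 0 \<omega>) -` {0} \<inter> space M" by (rule AE_not_in)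
      then show ?thesis using AE_space
        by eventually_elim (use start True in auto)
    qed simp
  qed
  moreover have "Measurable.pred (lborel \<Otimes>\<^sub>M M) (\<lambda>z. fst z > 0 \<longrightarrow> B (max 0 (fst z)) (snd z) \<noteq> 0)" by measurable
  ultimately have "AE \<omega> in M. AE t in lborel. t > 0 \<longrightarrow> B (max 0 t) \<omega> \<noteq> 0"
    by (subst (asm) P.AE_commute) (auto simp: pred_def split_beta)
  then show ?thesis
    by (elim eventually_mono) (auto elim!: eventually_mono)
qed

theorem brownian_spider_occupation:
  assumes N: "N \<ge> 1" and p: "\<And>j. j \<in> {1..N} \<Longrightarrow> p j > 0"
    and W: "brownian_spider M N p W"
  shows "AE \<omega> in M.
    Liminf at_top (\<lambda>t. ereal (brownian_occ_max N (\<lambda>s. W s \<omega>) t / t)) = ereal (1 / real N) \<and>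
    Limsup at_top (\<lambda>t. ereal (brownian_occ_min N (\<lambda>s. W s \<omega>) t / t)) = ereal (1 / real N)"
proof -
  obtain B J \<kappa> where B: "standard_brownian_motion M B" and J: "excursion_enumeration M B J"
    and \<kappa>: "prob_space.indep_vars M (\<lambda>_. count_space UNIV) \<kappa> {1::nat..}"
      "\<And>m \<omega>. m \<ge> 1 \<Longrightarrow> \<omega> \<in> space M \<Longrightarrow> \<kappa> m \<omega> \<in> {1..N}"
      "\<And>m j. m \<ge> 1 \<Longrightarrow> j \<in> {1..N} \<Longrightarrow> \<P>(\<omega> in M. \<kappa> m \<omega> = j) = p j"
    and ind: "prob_space.indep_set M (generated_events M (count_space UNIV) {1..} \<kappa>) (generated_events M borel {0..} B)"
    and Weq: "\<And>t \<omega>. t \<ge> 0 \<Longrightarrow> \<omega> \<in> space M \<Longrightarrow> W t \<omega> = (if B t \<omega> \<noteq> 0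
             then (\<Sum>m. indicator (J (Suc m) \<omega>) t * spider_point N \<bar>B t \<omega>\<bar> (\<kappa> (Suc m) \<omega>)) else 0)"
    using W unfolding brownian_spider_def by blast
  interpret indep_increments M B by (rule standard_brownian_motion_indep_increments[OF B])
  have cont: "continuous_on {0..} (\<lambda>t. B t \<omega>)" if "\<omega> \<in> space M" for \<omega>
    using B that unfolding standard_brownian_motion_def by blast
  have bij: "AE \<omega> in M. bij_betw (\<lambda>m. J m \<omega>) {1..} (excursion_intervals (\<lambda>t. B t \<omega>))"
    and J_sets: "\<And>m t. m \<ge> 1 \<Longrightarrow> t \<ge> 0 \<Longrightarrow> {\<omega>\<in>space M. t \<in> J m \<omega>} \<in> generated_events M borel {0..} B"
    using J unfolding excursion_enumeration_def by blast+
  \<comment> \<open>The events determined by the Brownian path. Windows and excursion numbers are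
    measurable with respect to \<open>G\<close>, the latter since the enumeration is, and the labels
    are independent of \<open>G\<close>.\<close>
  define G where "G = vimage_algebra (space M) (\<lambda>\<omega>. \<lambda>t\<in>{0..}. B t \<omega>) (PiM {0..} (\<lambda>_. borel :: real measure))"
  have G: "space G = space M" "sets G = generated_events M borel {0..} B"
    by (simp_all add: G_def generated_events_def)
  have BG: "B t \<in> borel_measurable G" if "t \<in> {0..}" for t
  proof -
    have "(\<lambda>\<omega>. \<lambda>t\<in>{0..}. B t \<omega>) \<in> measurable G (PiM {0..} (\<lambda>_. borel :: real measure))"
      unfolding G_def by (rule measurable_vimage_algebra1) (auto simp: space_PiM)
    from measurable_compose[OF this measurable_component_singleton[OF that]] that show ?thesis by simp
  qed
  let ?e = "\<lambda>t \<omega>. excursion_index (\<lambda>m. J m \<omega>) t"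
  let ?X = "\<lambda>\<theta> k \<omega>. bump_selection N \<theta> (\<lambda>t. ?e t \<omega>) (\<lambda>t. B t \<omega>) k"
  have eG: "?e t \<in> measurable G (count_space UNIV)" if "t \<ge> 0" for t
    unfolding excursion_index_def
  proof (rule measurable_Least)
    fix m
    show "(\<lambda>\<omega>. m \<ge> 1 \<and> t \<in> J m \<omega>) \<in> measurable G (count_space UNIV)"
    proof (cases "m \<ge> 1")
      case True
      then show ?thesis using J_sets[OF True that] G by (simp add: pred_def)
    next
      case False
      then have "(\<lambda>\<omega>. m \<ge> 1 \<and> t \<in> J m \<omega>) = (\<lambda>\<omega>. False)" by auto
      then show ?thesis by simp
    qed
  qed
  have X_sets: "{\<omega>\<in>space M. ?X \<theta> k \<omega> = v} \<in> sets G" if "\<theta> > 0" for \<theta> k v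
  proof -
    have "{\<omega>\<in>space G. good_window N \<theta> (\<lambda>t. B t \<omega>) k} \<in> sets G"
      using good_window_sets[OF that, of N k] sets_generated_algebra_subset[of "{0..}" B G "space M"] BG G(1) by auto
    then have "{\<omega>\<in>space G. ?X \<theta> k \<omega> = v} \<in> sets G"
      using bump_time_nonneg[OF that] by (intro sets_bump_selection eG)
    then show ?thesis by (simp add: G(1))
  qed
  have matching: "AE \<omega> in M. \<exists>\<^sub>F k in sequentially. matching N (?X \<theta> k \<omega>) (\<lambda>m. \<kappa> m \<omega>)" if \<theta>: "\<theta> > 0" for \<theta>
  proof (rule AE_frequently_matching[OF N \<kappa>(1,3) p G(1)])
    show "indep_set (generated_events M (count_space UNIV) {1..} \<kappa>) (sets G)" using ind G(2) by simp
    show "AE \<omega> in M. valid_selection N (\<lambda>k. ?X \<theta> k \<omega>)"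
      using AE_frequently_good_window[OF \<theta>, of N] bij AE_space
    proof eventually_elim
      fix \<omega> assume freq: "\<exists>\<^sub>F k in sequentially. good_window N \<theta> (\<lambda>t. B t \<omega>) k"
        and b: "bij_betw (\<lambda>m. J m \<omega>) {1..} (excursion_intervals (\<lambda>t. B t \<omega>))" and sp: "\<omega> \<in> space M"
      note comp = excursion_components[OF cont[OF sp] start[OF sp] b]
      have e: "?e t \<omega> \<ge> 1 \<and> t \<in> J (?e t \<omega>) \<omega>" if "t \<ge> 0" "B t \<omega> \<noteq> 0" for t
        using LeastI_ex[of "\<lambda>m. m \<ge> 1 \<and> t \<in> J m \<omega>"] comp(1)[OF that] unfolding excursion_index_def by blast
      show "valid_selection N (\<lambda>k. ?X \<theta> k \<omega>)"
      proof (rule valid_bump_selection[OF \<theta> freq])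
        show "?e t \<omega> \<ge> 1" if "t \<ge> 0" "B t \<omega> \<noteq> 0" for t using e[OF that] by blast
        \<comment> \<open>Equal indices put \<open>s\<close> and \<open>t\<close> into the same
          excursion, on which the sign is constant.\<close>
        show "B s \<omega> * B t' \<omega> > 0"
          if "0 \<le> s" "s \<le> t'" "t' \<le> t" "B s \<omega> \<noteq> 0" "B t \<omega> \<noteq> 0" "?e s \<omega> = ?e t \<omega>" for s t t'
          using comp(4)[of "?e s \<omega>" s t t'] e[of s] e[of t] that by auto
      qed
    qed
  qed (use X_sets[OF \<theta>] in auto)
  then have "AE \<omega> in M. \<forall>n. \<exists>\<^sub>F k in sequentially. matching N (?X (1 / real (Suc n)) k \<omega>) (\<lambda>m. \<kappa> m \<omega>)"
    by (subst AE_all_countable) auto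
  with bij AE_zero_set_null[OF B] AE_space show ?thesis
  proof eventually_elim
    fix \<omega> assume freq: "\<forall>n. \<exists>\<^sub>F k in sequentially. matching N (?X (1 / real (Suc n)) k \<omega>) (\<lambda>m. \<kappa> m \<omega>)"
      and b: "bij_betw (\<lambda>m. J m \<omega>) {1..} (excursion_intervals (\<lambda>t. B t \<omega>))" and sp: "\<omega> \<in> space M"
      and null: "AE t in lborel. t > 0 \<longrightarrow> B t \<omega> \<noteq> 0"
    let ?w = "\<lambda>s. W s \<omega>"
    note occ = spider_path_occupation[OF N cont[OF sp] start[OF sp] b, of "\<lambda>m. \<kappa> m \<omega>" ?w, OF \<kappa>(2)[OF _ sp] Weq[OF _ sp] null]
    have total: "((\<lambda>t. (\<Sum>j\<in>{1..N}. brownian_occ N ?w j t) / t) \<longlongrightarrow> 1) at_top"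
      by (rule tendsto_eventually, rule eventually_mono[OF eventually_gt_at_top[of 0]]) (use occ(1) in fastforce)
    have bal: "\<exists>\<^sub>F t in at_top. \<forall>j\<in>{1..N}. brownian_occ N ?w j t / t \<ge> c" if c: "c < 1 / real N" for c
    proof (rule frequently_balanced[OF N _ _ _ c])
      show "filterlim (\<lambda>k. real (window (Suc k))) at_top sequentially"
        by (rule filterlim_compose[OF filterlim_real_sequentially filterlim_window])
      show "\<exists>\<^sub>F k in sequentially. \<forall>j\<in>{1..N}. brownian_occ N ?w j (real (window (Suc k))) \<ge> scale N (1 / real (Suc n)) k - 1" for n
        using spec[OF freq, of n]
      proof (rule frequently_elim1)
        fix k assume "matching N (?X (1 / real (Suc n)) k \<omega>) (\<lambda>m. \<kappa> m \<omega>)"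
        then have "brownian_occ N ?w j (real (window (Suc k))) \<ge> scale N (1 / real (Suc n)) k" if "j \<in> {1..N}" for j
          using that by (intro occ(2)) auto
        then show "\<forall>j\<in>{1..N}. brownian_occ N ?w j (real (window (Suc k))) \<ge> scale N (1 / real (Suc n)) k - 1"
          by (smt (verit))
      qed
    qed simp
    have "(at_top :: real filter) \<noteq> bot" by simp
    note main = Liminf_Max_Limsup_Min[OF N this eventually_gt_at_top[of 0] total bal]
    show "Liminf at_top (\<lambda>t. ereal (brownian_occ_max N ?w t / t)) = ereal (1 / real N) \<and>
        Limsup at_top (\<lambda>t. ereal (brownian_occ_min N ?w t / t)) = ereal (1 / real N)"
      unfolding brownian_occ_max_def brownian_occ_min_def using main by blast
  qed
qed

section \<open>A concrete random walk on the spider\<close>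

text \<open>A simple random walk \<open>pos\<close> on the integers provides the distance to the body; a leg is drawn
  afresh whenever the walk leaves zero. The coordinates \<open>Z (True, n)\<close> are coins, \<open>Z (False, n)\<close> legs.\<close>

locale spider_model = prob_space M for M :: "'a measure" +
  fixes N :: nat and p :: "nat \<Rightarrow> real" and Z :: "bool \<times> nat \<Rightarrow> 'a \<Rightarrow> nat"
  assumes N_pos: "N \<ge> 1"
    and indep_Z: "indep_vars (\<lambda>_. count_space UNIV) Z UNIV"
    and coin: "\<And>n. prob {\<omega>\<in>space M. Z (True, n) \<omega> = 0} = 1 / 2"
    and label: "\<And>n j. j \<in> {1..N} \<Longrightarrow> prob {\<omega>\<in>space M. Z (False, n) \<omega> = j} = p j"
    and label_range: "\<And>n \<omega>. \<omega> \<in> space M \<Longrightarrow> Z (False, n) \<omega> \<in> {1..N}"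
begin

text \<open>The events determined by the coordinates in \<open>A\<close>. Independence is henceforth
  obtained by exhibiting disjoint sets of coordinates.\<close>

definition coord :: "(bool \<times> nat) set \<Rightarrow> 'a measure" where
  "coord A = vimage_algebra (space M) (\<lambda>\<omega>. \<lambda>i\<in>A. Z i \<omega>) (PiM A (\<lambda>_. count_space UNIV))"

lemma space_coord [simp]: "space (coord A) = space M"
  by (simp add: coord_def)

lemma measurable_Z_M [measurable]: "Z i \<in> measurable M (count_space UNIV)"
  using indep_Z unfolding indep_vars_def by blast

lemma measurable_Z_coord: "i \<in> A \<Longrightarrow> Z i \<in> measurable (coord A) (count_space UNIV)"
proof -
  assume i: "i \<in> A"
  have "(\<lambda>\<omega>. \<lambda>i\<in>A. Z i \<omega>) \<in> measurable (coord A) (PiM A (\<lambda>_. count_space UNIV))"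
    unfolding coord_def by (rule measurable_vimage_algebra1) (auto simp: space_PiM)
  from measurable_compose[OF this measurable_component_singleton[OF i]] i show ?thesis by simp
qed

lemma sets_coord_subset:
  assumes "\<And>i. i \<in> A \<Longrightarrow> Z i \<in> measurable L (count_space UNIV)" "space L = space M"
  shows "sets (coord A) \<subseteq> sets L"
proof -
  have "(\<lambda>\<omega>. \<lambda>i\<in>A. Z i \<omega>) \<in> measurable L (PiM A (\<lambda>_. count_space UNIV))"
    using assms by (intro measurable_restrict) auto
  from measurable_sets[OF this] show ?thesis
    unfolding coord_def using assms(2)
    by (subst sets_vimage_algebra2) (auto simp: space_PiM)
qed

lemma coord_subset: "sets (coord A) \<subseteq> events"
  by (rule sets_coord_subset) auto

lemma measurable_coord_M:
  assumes "f \<in> measurable (coord A) L"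
  shows "f \<in> measurable M L"
  using measurable_space[OF assms] measurable_sets[OF assms] coord_subset
  by (intro measurableI) (simp, metis space_coord subsetD)

lemma coord_indep:
  assumes "A \<inter> C = {}" "E \<in> sets (coord A)" "F \<in> sets (coord C)"
  shows "prob (E \<inter> F) = prob E * prob F"
proof -
  have "indep_var (PiM A (\<lambda>_. count_space UNIV)) (\<lambda>\<omega>. \<lambda>i\<in>A. Z i \<omega>) (PiM C (\<lambda>_. count_space UNIV)) (\<lambda>\<omega>. \<lambda>i\<in>C. Z i \<omega>)"
    using assms(1) by (intro indep_var_restrict[OF indep_Z]) auto
  then have "indep_set (sets (coord A)) (sets (coord C))"
    unfolding indep_var_eq coord_def sets_vimage_algebra by blast
  then show ?thesis using assms by (intro indep_setD)
qed

lemma indep_set_coord: "A \<inter> C = {} \<Longrightarrow> indep_set (sets (coord A)) (sets (coord C))"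
  using coord_subset coord_indep by (intro indep_setI) auto

lemma indep_var_coord:
  fixes f g :: "'a \<Rightarrow> real"
  assumes "A \<inter> C = {}" "f \<in> borel_measurable (coord A)" "g \<in> borel_measurable (coord C)"
  shows "indep_var borel f borel g"
  unfolding indep_var_eq
proof (intro conjI)
  show "random_variable borel f" "random_variable borel g"
    using assms(2,3) by (auto intro: measurable_coord_M)
  have s: "sigma_sets (space M) {h -` D \<inter> space M |D. D \<in> sets borel} \<subseteq> sets (coord B)"
    if "h \<in> borel_measurable (coord B)" for h :: "'a \<Rightarrow> real" and B
    using measurable_sets[OF that] sets.top[of "coord B"]
    by (intro sets.sigma_sets_subset'[of _ "coord B", simplified]) auto
  show "indep_set (sigma_sets (space M) {f -` D \<inter> space M |D. D \<in> sets borel})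
      (sigma_sets (space M) {g -` D \<inter> space M |D. D \<in> sets borel})"
    using indep_set_coord[OF assms(1)] s[OF assms(2)] s[OF assms(3)] unfolding indep_set_def
    by (rule_tac indep_sets_mono_sets) (auto split: bool.split)
qed

definition step :: "nat \<Rightarrow> 'a \<Rightarrow> int" where
  "step n \<omega> = (if Z (True, n) \<omega> = 0 then 1 else -1)"

primrec pos :: "nat \<Rightarrow> 'a \<Rightarrow> int" where
  "pos 0 \<omega> = 0"
| "pos (Suc n) \<omega> = pos n \<omega> + step (Suc n) \<omega>"

lemma step_cases: "step n \<omega> = 1 \<or> step n \<omega> = -1"
  by (simp add: step_def)

lemma measurable_step_coord: "(True, n) \<in> A \<Longrightarrow> (\<lambda>\<omega>. real_of_int (step n \<omega>)) \<in> borel_measurable (coord A)"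
  unfolding step_def using measurable_Z_coord[of "(True, n)" A] by measurable

lemma measurable_pos_diff_coord:
  assumes "n \<le> m" "{True} \<times> {n<..m} \<subseteq> A"
  shows "(\<lambda>\<omega>. real_of_int (pos m \<omega> - pos n \<omega>)) \<in> borel_measurable (coord A)"
  using assms
proof (induction m rule: dec_induct)
  case (step m)
  have "(\<lambda>\<omega>. real_of_int (pos m \<omega> - pos n \<omega>) + real_of_int (local.step (Suc m) \<omega>)) \<in> borel_measurable (coord A)"
  proof (rule borel_measurable_add)
    have "{True} \<times> {n<..m} \<subseteq> {True} \<times> {n<..Suc m}" by auto
    with step.prems show "(\<lambda>\<omega>. real_of_int (pos m \<omega> - pos n \<omega>)) \<in> borel_measurable (coord A)"
      by (intro step.IH) (rule subset_trans)
    have "(True, Suc m) \<in> {True} \<times> {n<..Suc m}" using step.hyps by auto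
    with step.prems show "(\<lambda>\<omega>. real_of_int (local.step (Suc m) \<omega>)) \<in> borel_measurable (coord A)"
      by (intro measurable_step_coord) (rule subsetD)
  qed
  then show ?case by (simp add: algebra_simps)
qed simp

lemma measurable_pos_coord: "{True} \<times> {0<..n} \<subseteq> A \<Longrightarrow> (\<lambda>\<omega>. real_of_int (pos n \<omega>)) \<in> borel_measurable (coord A)"
  using measurable_pos_diff_coord[of 0 n A] by simp

lemma measurable_pos [measurable]: "(\<lambda>\<omega>. real_of_int (pos n \<omega>)) \<in> borel_measurable M"
  by (rule measurable_coord_M[OF measurable_pos_coord[of n UNIV]]) simp

lemma measurable_step [measurable]: "(\<lambda>\<omega>. real_of_int (step n \<omega>)) \<in> borel_measurable M"
  by (rule measurable_coord_M[OF measurable_step_coord[of n UNIV]]) simp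

lemma abs_pos_diff_le: "n \<le> m \<Longrightarrow> \<bar>pos m \<omega> - pos n \<omega>\<bar> \<le> int (m - n)"
proof (induction m rule: dec_induct)
  case (step m)
  then show ?case using step_cases[of "Suc m" \<omega>] by auto
qed simp

lemma abs_pos_le: "\<bar>pos n \<omega>\<bar> \<le> int n"
  using abs_pos_diff_le[of 0 n \<omega>] by simp

lemma prob_step:
  "prob {\<omega>\<in>space M. step n \<omega> = 1} = 1 / 2" "prob {\<omega>\<in>space M. step n \<omega> = -1} = 1 / 2"
proof -
  have eq: "{\<omega>\<in>space M. step n \<omega> = 1} = {\<omega>\<in>space M. Z (True, n) \<omega> = 0}" by (auto simp: step_def)
  then show "prob {\<omega>\<in>space M. step n \<omega> = 1} = 1 / 2" using coin by simp
  have "{\<omega>\<in>space M. step n \<omega> = -1} = {\<omega>\<in>space M. \<not> Z (True, n) \<omega> = 0}" by (auto simp: step_def)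
  also have "prob \<dots> = 1 - prob {\<omega>\<in>space M. Z (True, n) \<omega> = 0}" by (rule prob_neg) measurable
  finally show "prob {\<omega>\<in>space M. step n \<omega> = -1} = 1 / 2" using coin by simp
qed

lemma step_sets_coord: "(True, n) \<in> A \<Longrightarrow> {\<omega>\<in>space M. step n \<omega> = z} \<in> sets (coord A)"
proof -
  assume "(True, n) \<in> A"
  from measurable_step_coord[OF this] have [measurable]: "(\<lambda>\<omega>. real_of_int (step n \<omega>)) \<in> borel_measurable (coord A)" .
  have "{\<omega>\<in>space (coord A). real_of_int (step n \<omega>) = real_of_int z} \<in> sets (coord A)" by measurable
  then show ?thesis by simp
qed

lemma integrable_step: "integrable M (\<lambda>\<omega>. real_of_int (step n \<omega>))"
  by (rule integrable_const_bound[where B = 1]) (auto simp: step_def)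

lemma expectation_step: "expectation (\<lambda>\<omega>. real_of_int (step n \<omega>)) = 0"
proof -
  have "expectation (\<lambda>\<omega>. real_of_int (step n \<omega>)) = expectation (\<lambda>\<omega>. 2 * indicator {\<omega>\<in>space M. step n \<omega> = 1} \<omega> - 1)"
    by (intro Bochner_Integration.integral_cong) (auto simp: step_def)
  also have "\<dots> = 2 * prob {\<omega>\<in>space M. step n \<omega> = 1} - 1"
  proof -
    have [measurable]: "{\<omega>\<in>space M. step n \<omega> = 1} \<in> events" using step_sets_coord[of n UNIV 1] coord_subset by blast
    have "integrable M (\<lambda>\<omega>. 2 * indicator {\<omega>\<in>space M. step n \<omega> = 1} \<omega> :: real)"
      by (intro integrable_mult_right integrable_real_indicator) (auto simp: emeasure_eq_measure)
    then show ?thesis by (simp add: prob_space Int_absorb1)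
  qed
  finally show ?thesis by (simp add: prob_step)
qed

text \<open>A step has mean zero and is independent of everything built from other coordinates. This
  martingale property yields both the variance of the increments and the recursion for the mean
  distance from zero.\<close>

lemma expectation_times_step:
  assumes f: "f \<in> borel_measurable (coord A)" "(True, n) \<notin> A" "\<And>\<omega>. \<omega> \<in> space M \<Longrightarrow> \<bar>f \<omega>\<bar> \<le> b"
  shows "expectation (\<lambda>\<omega>. f \<omega> * real_of_int (step n \<omega>)) = 0"
    and "integrable M (\<lambda>\<omega>. f \<omega> * real_of_int (step n \<omega>))"
proof -
  have ind: "indep_var borel f borel (\<lambda>\<omega>. real_of_int (step n \<omega>))"
    using f by (intro indep_var_coord[of A "{(True, n)}"] measurable_step_coord) auto
  have int: "integrable M f"
    using f measurable_coord_M[OF f(1)] by (intro integrable_const_bound[where B = b]) auto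
  show "expectation (\<lambda>\<omega>. f \<omega> * real_of_int (step n \<omega>)) = 0"
    using indep_var_lebesgue_integral[OF ind int integrable_step] by (simp add: expectation_step)
  show "integrable M (\<lambda>\<omega>. f \<omega> * real_of_int (step n \<omega>))"
    by (rule indep_var_integrable[OF ind int integrable_step])
qed

text \<open>Expanding the square after one more step, the mixed term has mean zero and the square of
  the step is \<open>1\<close>.\<close>

lemma expectation_pos_diff_square:
  "n \<le> m \<Longrightarrow> expectation (\<lambda>\<omega>. (real_of_int (pos m \<omega> - pos n \<omega>))\<^sup>2) = real (m - n)"
proof (induction m rule: dec_induct)
  case (step m)
  define D where "D \<omega> = real_of_int (pos m \<omega> - pos n \<omega>)" for \<omega>
  have D: "D \<in> borel_measurable (coord ({True} \<times> {n<..m}))"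
    unfolding D_def using step by (intro measurable_pos_diff_coord) auto
  have Db: "\<bar>D \<omega>\<bar> \<le> real (m - n)" for \<omega>
    using abs_pos_diff_le[of n m \<omega>] step(1) unfolding D_def by linarith
  have [measurable]: "D \<in> borel_measurable M" using D by (rule measurable_coord_M)
  have D2: "integrable M (\<lambda>\<omega>. (D \<omega>)\<^sup>2)"
    by (rule integrable_const_bound[where B = "(real (m - n))\<^sup>2"]) (use Db in \<open>auto simp: abs_le_square_iff[symmetric]\<close>)
  note c = expectation_times_step[OF D _ Db, of "Suc m"]
  have "expectation (\<lambda>\<omega>. (real_of_int (pos (Suc m) \<omega> - pos n \<omega>))\<^sup>2) =
      expectation (\<lambda>\<omega>. (D \<omega>)\<^sup>2 + (2 * (D \<omega> * real_of_int (local.step (Suc m) \<omega>)) + 1))"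
    by (intro Bochner_Integration.integral_cong)
       (auto simp: D_def local.step_def power2_eq_square algebra_simps)
  also have "\<dots> = expectation (\<lambda>\<omega>. (D \<omega>)\<^sup>2) + 1"
    using D2 c by (simp add: prob_space)
  finally show ?case using step by (simp add: D_def Suc_diff_le)
qed simp

text \<open>Splitting according to the last step gives a recursion in \<open>k\<close> that does not
  depend on the starting time \<open>n\<close>.\<close>

lemma pos_diff_shift:
  "prob {\<omega>\<in>space M. pos (n + k) \<omega> - pos n \<omega> \<in> A} = prob {\<omega>\<in>space M. pos k \<omega> \<in> A}"
proof (induction k arbitrary: A)
  case (Suc k)
  have split: "prob {\<omega>\<in>space M. pos (n + Suc k) \<omega> - pos n \<omega> \<in> A} =
      (prob {\<omega>\<in>space M. pos (n + k) \<omega> - pos n \<omega> \<in> (\<lambda>z. z - 1) ` A} +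
       prob {\<omega>\<in>space M. pos (n + k) \<omega> - pos n \<omega> \<in> (\<lambda>z. z + 1) ` A}) / 2" for n A
  proof -
    let ?D = "\<lambda>\<omega>. pos (n + k) \<omega> - pos n \<omega>"
    let ?C = "coord ({True} \<times> {n<..n + k})"
    have [measurable]: "(\<lambda>\<omega>. real_of_int (?D \<omega>)) \<in> borel_measurable ?C"
      by (intro measurable_pos_diff_coord) auto
    have D: "{\<omega>\<in>space M. ?D \<omega> \<in> B} \<in> sets ?C" for B
    proof -
      have [measurable]: "real_of_int ` B \<in> sets borel" by (rule sets.countable) auto
      have "{\<omega>\<in>space ?C. real_of_int (?D \<omega>) \<in> real_of_int ` B} \<in> sets ?C" by measurable
      moreover have "inj real_of_int" by (rule injI) simp
      ultimately show ?thesis by (simp only: inj_image_mem_iff space_coord)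
    qed
    have Dev: "{\<omega>\<in>space M. ?D \<omega> \<in> B} \<in> events" for B using D coord_subset by blast
    have sev: "{\<omega>\<in>space M. step (n + Suc k) \<omega> = z} \<in> events" for z
      using step_sets_coord[of _ UNIV] coord_subset by blast
    have ind: "prob ({\<omega>\<in>space M. ?D \<omega> \<in> B} \<inter> {\<omega>\<in>space M. step (n + Suc k) \<omega> = z}) =
        prob {\<omega>\<in>space M. ?D \<omega> \<in> B} * prob {\<omega>\<in>space M. step (n + Suc k) \<omega> = z}" for B z
      by (intro coord_indep[OF _ D step_sets_coord[of _ "{(True, n + Suc k)}"]]) auto
    have "{\<omega>\<in>space M. pos (n + Suc k) \<omega> - pos n \<omega> \<in> A} =
        ({\<omega>\<in>space M. ?D \<omega> \<in> (\<lambda>z. z - 1) ` A} \<inter> {\<omega>\<in>space M. step (n + Suc k) \<omega> = 1}) \<union>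
        ({\<omega>\<in>space M. ?D \<omega> \<in> (\<lambda>z. z + 1) ` A} \<inter> {\<omega>\<in>space M. step (n + Suc k) \<omega> = -1})" (is "_ = ?U \<union> ?V")
    proof (intro set_eqI)
      fix \<omega>
      have *: "pos (n + Suc k) \<omega> - pos n \<omega> = ?D \<omega> + step (n + Suc k) \<omega>" by simp
      have "z + 1 \<in> A \<longleftrightarrow> z \<in> (\<lambda>z. z - 1) ` A" "z - 1 \<in> A \<longleftrightarrow> z \<in> (\<lambda>z. z + 1) ` A" for z :: int
        by (auto simp: image_iff intro: bexI[of _ "z + 1"] bexI[of _ "z - 1"])
      then show "\<omega> \<in> {\<omega>\<in>space M. pos (n + Suc k) \<omega> - pos n \<omega> \<in> A} \<longleftrightarrow> \<omega> \<in> ?U \<union> ?V"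
        using step_cases[of "n + Suc k" \<omega>] unfolding mem_Collect_eq * by auto
    qed
    moreover have "prob (?U \<union> ?V) = prob ?U + prob ?V"
      using Dev sev by (intro finite_measure_Union) auto
    ultimately show ?thesis unfolding ind prob_step by simp
  qed
  show ?case unfolding split using split[of 0] Suc.IH by simp
qed simp

end

section \<open>Central limit bounds and the random walk in continuous time\<close>

lemma (in spider_model) pos_interval_lower:
  assumes "a < b"
  shows "\<exists>d>0. \<forall>\<^sub>F n in sequentially.
    prob {\<omega>\<in>space M. a * sqrt (real n) < real_of_int (pos n \<omega>) \<and> real_of_int (pos n \<omega>) \<le> b * sqrt (real n)} \<ge> d"
proof -
  define X where "X i \<omega> = real_of_int (step (Suc i) \<omega>)" for i \<omega>
  have Xm [measurable]: "X i \<in> borel_measurable M" for i unfolding X_def by measurable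
  have indep: "indep_vars (\<lambda>_. borel) X UNIV"
  proof -
    have "indep_vars (\<lambda>i. PiM {(True, Suc i)} (\<lambda>_. count_space UNIV)) (\<lambda>i \<omega>. restrict (\<lambda>j. Z j \<omega>) {(True, Suc i)}) UNIV"
      by (intro indep_vars_restrict[OF indep_Z]) (auto simp: disjoint_family_on_def)
    then have "indep_vars (\<lambda>_. borel)
        (\<lambda>i \<omega>. (\<lambda>f. if f (True, Suc i) = 0 then 1 else -1 :: real) (restrict (\<lambda>j. Z j \<omega>) {(True, Suc i)})) UNIV"
    proof (rule indep_vars_compose2)
      fix i
      have [measurable]: "(\<lambda>f. f (True, Suc i)) \<in> measurable (PiM {(True, Suc i)} (\<lambda>_. count_space (UNIV :: nat set))) (count_space UNIV)"
        by (rule measurable_component_singleton) simp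
      show "(\<lambda>f. if f (True, Suc i) = 0 then 1 else -1 :: real) \<in>
          borel_measurable (PiM {(True, Suc i)} (\<lambda>_. count_space (UNIV :: nat set)))" by measurable
    qed
    then show ?thesis unfolding X_def step_def by (simp add: if_distrib[where f = real_of_int] cong: if_cong)
  qed
  have X1: "(X i \<omega>)\<^sup>2 = 1" for i \<omega> unfolding X_def step_def by simp
  have distr: "distr M borel (X n) = distr M borel (X 0)" for n
  proof (rule measure_eqI)
    fix A assume "A \<in> sets (distr M borel (X n))"
    then have A: "A \<in> sets borel" by simp
    have P: "prob (X n -` A \<inter> space M) = ((if 1 \<in> A then 1 else 0) + (if -1 \<in> A then 1 else 0)) / 2" for n
    proof -
      have ev: "{\<omega>\<in>space M. step (Suc n) \<omega> = z} \<in> events" for z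
        using step_sets_coord[of _ UNIV] coord_subset by blast
      have "X n -` A \<inter> space M = (if 1 \<in> A then {\<omega>\<in>space M. step (Suc n) \<omega> = 1} else {}) \<union>
          (if -1 \<in> A then {\<omega>\<in>space M. step (Suc n) \<omega> = -1} else {})"
        unfolding X_def using step_cases[of "Suc n"] by (auto split: if_splits) (metis of_int_1 of_int_minus)+
      also have "prob \<dots> = prob (if 1 \<in> A then {\<omega>\<in>space M. step (Suc n) \<omega> = 1} else {}) +
          prob (if -1 \<in> A then {\<omega>\<in>space M. step (Suc n) \<omega> = -1} else {})"
        using ev by (intro finite_measure_Union) auto
      finally show ?thesis by (auto simp: prob_step)
    qed
    have "prob (X n -` A \<inter> space M) = prob (X 0 -` A \<inter> space M)" unfolding P ..
    with A show "emeasure (distr M borel (X n)) A = emeasure (distr M borel (X 0)) A"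
      by (simp add: emeasure_distr emeasure_eq_measure)
  qed simp
  have mean: "expectation (X n) = 0" for n unfolding X_def by (rule expectation_step)
  have sum: "(\<Sum>i<n. X i \<omega>) = real_of_int (pos n \<omega>)" for n \<omega>
    by (induction n) (auto simp: X_def)
  have "weak_conv_m (\<lambda>n. distr M borel (\<lambda>\<omega>. (\<Sum>i<n. X i \<omega>) / sqrt (real n * 1\<^sup>2))) std_normal_distribution"
  proof (rule central_limit_theorem_zero_mean[OF indep mean _ _ _ distr])
    show "integrable M (\<lambda>\<omega>. (X n \<omega>)\<^sup>2)" for n by (simp add: X1)
    show "variance (X n) = 1\<^sup>2" for n unfolding mean by (simp add: X1 prob_space)
  qed simp
  then have conv: "weak_conv_m (\<lambda>n. distr M borel (\<lambda>\<omega>. real_of_int (pos n \<omega>) / sqrt (real n))) std_normal_distribution"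
    by (simp add: sum)
  interpret N: real_distribution std_normal_distribution
    by (rule real_distribution.intro[OF prob_space_normal_density]) (auto simp: real_distribution_axioms_def)
  have "isCont (cdf std_normal_distribution) x" for x
  proof -
    have "emeasure std_normal_distribution {x} = (\<integral>\<^sup>+y. ennreal (std_normal_density y) * indicator {x} y \<partial>lborel)"
      by (subst emeasure_density) auto
    also have "\<dots> = 0" by (simp add: nn_integral_0_iff_AE)
    finally show ?thesis unfolding N.isCont_cdf by (simp add: measure_def)
  qed
  then have lim: "(\<lambda>n. cdf (distr M borel (\<lambda>\<omega>. real_of_int (pos n \<omega>) / sqrt (real n))) x) \<longlonglongrightarrow> cdf std_normal_distribution x" for x
    using conv unfolding weak_conv_m_def weak_conv_def by blast
  \<comment> \<open>The normal distribution function is continuous, so the central limit theorem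
    gives convergence of distribution functions at \<open>a\<close> and \<open>b\<close>. Their
    difference is the mass of \<open>{a<..b}\<close>; half of the positive limit is eventually a
    lower bound.\<close>
  define d where "d = cdf std_normal_distribution b - cdf std_normal_distribution a"
  have d: "d > 0"
  proof -
    have "0 < measure std_normal_distribution {a<..<b}" by (rule std_normal_interval_pos[OF assms])
    also have "\<dots> \<le> measure std_normal_distribution {a<..b}" by (intro N.finite_measure_mono) auto
    also have "\<dots> = d" unfolding d_def using N.cdf_diff_eq[OF assms] by simp
    finally show ?thesis .
  qed
  have "(\<lambda>n. cdf (distr M borel (\<lambda>\<omega>. real_of_int (pos n \<omega>) / sqrt (real n))) b -
      cdf (distr M borel (\<lambda>\<omega>. real_of_int (pos n \<omega>) / sqrt (real n))) a) \<longlonglongrightarrow> d"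
    unfolding d_def by (intro tendsto_diff lim)
  then have "\<forall>\<^sub>F n in sequentially. d / 2 < cdf (distr M borel (\<lambda>\<omega>. real_of_int (pos n \<omega>) / sqrt (real n))) b -
      cdf (distr M borel (\<lambda>\<omega>. real_of_int (pos n \<omega>) / sqrt (real n))) a"
    using d by (intro order_tendstoD) auto
  then have "\<forall>\<^sub>F n in sequentially.
      prob {\<omega>\<in>space M. a * sqrt (real n) < real_of_int (pos n \<omega>) \<and> real_of_int (pos n \<omega>) \<le> b * sqrt (real n)} \<ge> d / 2"
    using eventually_gt_at_top[of 0]
  proof eventually_elim
    fix n :: nat assume n: "d / 2 < cdf (distr M borel (\<lambda>\<omega>. real_of_int (pos n \<omega>) / sqrt (real n))) b -
      cdf (distr M borel (\<lambda>\<omega>. real_of_int (pos n \<omega>) / sqrt (real n))) a" "n > 0"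
    interpret D: real_distribution "distr M borel (\<lambda>\<omega>. real_of_int (pos n \<omega>) / sqrt (real n))"
      by (rule real_distribution_distr) measurable
    have "cdf (distr M borel (\<lambda>\<omega>. real_of_int (pos n \<omega>) / sqrt (real n))) b -
      cdf (distr M borel (\<lambda>\<omega>. real_of_int (pos n \<omega>) / sqrt (real n))) a =
      measure (distr M borel (\<lambda>\<omega>. real_of_int (pos n \<omega>) / sqrt (real n))) {a<..b}"
      by (rule D.cdf_diff_eq[OF assms])
    also have "\<dots> = prob ((\<lambda>\<omega>. real_of_int (pos n \<omega>) / sqrt (real n)) -` {a<..b} \<inter> space M)"
      by (rule measure_distr) measurable
    also have "(\<lambda>\<omega>. real_of_int (pos n \<omega>) / sqrt (real n)) -` {a<..b} \<inter> space M =
        {\<omega>\<in>space M. a * sqrt (real n) < real_of_int (pos n \<omega>) \<and> real_of_int (pos n \<omega>) \<le> b * sqrt (real n)}"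
      using n(2) by (auto simp: pos_less_divide_eq pos_divide_le_eq)
    finally show "prob {\<omega>\<in>space M. a * sqrt (real n) < real_of_int (pos n \<omega>) \<and> real_of_int (pos n \<omega>) \<le> b * sqrt (real n)} \<ge> d / 2"
      using n(1) by simp
  qed
  then show ?thesis using d by (intro exI[of _ "d / 2"]) auto
qed

text \<open>Replaces a real time span \<open>h\<close> by a number \<open>n\<close> of steps: the
  square roots differ by \<open>\<bar>h - n\<bar> / (sqrt h + sqrt n)\<close>, at most
  \<open>1 / sqrt n\<close>, and the factor \<open>a\<close> costs at most
  \<open>e * n\<close>.\<close>

lemma sqrt_rescale:
  fixes h a e :: real and n :: nat
  assumes "n > 0" "h > 0" "\<bar>real n - h\<bar> \<le> 1" "\<bar>a\<bar> \<le> e * real n"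
  shows "\<bar>a * sqrt h - a * sqrt (real n)\<bar> \<le> e * sqrt (real n)"
proof -
  have s: "sqrt (real n) > 0" "sqrt h > 0" using assms by auto
  have "\<bar>sqrt h - sqrt (real n)\<bar> * sqrt (real n) \<le> \<bar>sqrt h - sqrt (real n)\<bar> * (sqrt h + sqrt (real n))"
    using s by (intro mult_left_mono) auto
  also have "\<dots> = \<bar>(sqrt h - sqrt (real n)) * (sqrt h + sqrt (real n))\<bar>" using s by (simp add: abs_mult)
  also have "(sqrt h - sqrt (real n)) * (sqrt h + sqrt (real n)) = h - real n"
    using assms by (simp add: algebra_simps)
  finally have 1: "\<bar>sqrt h - sqrt (real n)\<bar> * sqrt (real n) \<le> 1" using assms(3) by linarith
  have "\<bar>a * sqrt h - a * sqrt (real n)\<bar> = \<bar>a\<bar> * \<bar>sqrt h - sqrt (real n)\<bar>"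
    by (simp add: right_diff_distrib[symmetric] abs_mult)
  also have "\<dots> \<le> e * real n * \<bar>sqrt h - sqrt (real n)\<bar>" using assms(4) by (intro mult_right_mono) auto
  also have "e * real n * \<bar>sqrt h - sqrt (real n)\<bar> = e * sqrt (real n) * (\<bar>sqrt h - sqrt (real n)\<bar> * sqrt (real n))"
    by (simp add: mult_ac)
  also have "\<dots> \<le> e * sqrt (real n) * 1"
  proof (rule mult_left_mono[OF 1])
    have "e * real n \<ge> 0" using assms(4) by linarith
    then have "e \<ge> 0" using assms(1) by (simp add: zero_le_mult_iff)
    then show "e * sqrt (real n) \<ge> 0" by simp
  qed
  finally show ?thesis by simp
qed

context spider_model
begin

definition walk :: "real \<Rightarrow> 'a \<Rightarrow> real" where
  "walk t \<omega> = real_of_int (pos (nat \<lfloor>t\<rfloor>) \<omega>)"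

text \<open>Values up to time \<open>s\<close> use coins up to the integer part of \<open>s\<close>
  and later increments use the coins after it, so past and future depend on disjoint coordinates.
  The remaining work is to account for rounding.\<close>

lemma walk_indep_increments: "indep_increments M walk"
proof unfold_locales
  show "walk t \<in> borel_measurable M" for t unfolding walk_def by measurable
  show "walk 0 \<omega> = 0" for \<omega> by (simp add: walk_def)
  show "continuous (at_right t) (\<lambda>t. walk t \<omega>)" if "t \<ge> 0" for \<omega> t
    unfolding continuous_within
  proof (rule tendsto_eventually)
    have "t < real_of_int \<lfloor>t\<rfloor> + 1" by linarith
    moreover have "\<lfloor>s\<rfloor> = \<lfloor>t\<rfloor>" if "t < s" "s < real_of_int \<lfloor>t\<rfloor> + 1" for s
      using that by linarith
    ultimately show "\<forall>\<^sub>F s in at_right t. walk s \<omega> = walk t \<omega>"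
      unfolding eventually_at_right_field walk_def by metis
  qed
next
  fix s :: real and A C assume s: "s \<ge> 0" and A: "A \<in> sets (generated_algebra (space M) {0..s} walk)"
    and C: "C \<in> sets (generated_algebra (space M) {s..} (\<lambda>t \<omega>. walk t \<omega> - walk s \<omega>))"
  let ?n = "nat \<lfloor>s\<rfloor>"
  have "sets (generated_algebra (space M) {0..s} walk) \<subseteq> sets (coord ({True} \<times> {0<..?n}))"
  proof (rule sets_generated_algebra_subset)
    fix t assume "t \<in> {0..s}"
    then have "nat \<lfloor>t\<rfloor> \<le> ?n" by (auto intro!: nat_mono floor_mono)
    then show "walk t \<in> borel_measurable (coord ({True} \<times> {0<..?n}))"
      unfolding walk_def by (intro measurable_pos_coord) auto
  qed simp
  moreover have "sets (generated_algebra (space M) {s..} (\<lambda>t \<omega>. walk t \<omega> - walk s \<omega>)) \<subseteq> sets (coord ({True} \<times> {?n<..}))"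
  proof (rule sets_generated_algebra_subset)
    fix t assume "t \<in> {s..}"
    then have "?n \<le> nat \<lfloor>t\<rfloor>" by (auto intro!: nat_mono floor_mono)
    then have "(\<lambda>\<omega>. real_of_int (pos (nat \<lfloor>t\<rfloor>) \<omega> - pos ?n \<omega>)) \<in> borel_measurable (coord ({True} \<times> {?n<..}))"
      by (intro measurable_pos_diff_coord) auto
    then show "(\<lambda>\<omega>. walk t \<omega> - walk s \<omega>) \<in> borel_measurable (coord ({True} \<times> {?n<..}))"
      by (simp add: walk_def)
  qed simp
  ultimately show "prob (A \<inter> C) = prob A * prob C"
    using A C by (intro coord_indep[of "{True} \<times> {0<..?n}" "{True} \<times> {?n<..}"]) auto
next
  fix s t a :: real assume st: "0 \<le> s" "s \<le> t" "a > 0"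
  let ?n = "nat \<lfloor>s\<rfloor>" and ?m = "nat \<lfloor>t\<rfloor>"
  have nm: "?n \<le> ?m" using st by (auto intro!: nat_mono floor_mono)
  let ?D = "\<lambda>\<omega>. real_of_int (pos ?m \<omega> - pos ?n \<omega>)"
  have Dm [measurable]: "?D \<in> borel_measurable M" by simp
  have I: "integrable M (\<lambda>\<omega>. (?D \<omega>)\<^sup>2)"
  proof (rule integrable_const_bound[where B = "(real (?m - ?n))\<^sup>2"])
    have "(?D \<omega>)\<^sup>2 \<le> (real (?m - ?n))\<^sup>2" for \<omega>
    proof -
      have "\<bar>?D \<omega>\<bar> \<le> \<bar>real (?m - ?n)\<bar>" using abs_pos_diff_le[OF nm, of \<omega>] by linarith
      then show ?thesis by (simp only: abs_le_square_iff)
    qed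
    then show "AE \<omega> in M. norm ((?D \<omega>)\<^sup>2) \<le> (real (?m - ?n))\<^sup>2"
      by (intro AE_I2) (simp only: real_norm_def abs_power2)
  qed measurable
  have "prob {\<omega>\<in>space M. \<bar>walk t \<omega> - walk s \<omega>\<bar> \<ge> a} = prob {\<omega>\<in>space M. (?D \<omega>)\<^sup>2 \<ge> a\<^sup>2}"
  proof (rule arg_cong[where f = prob])
    have "a \<le> \<bar>?D \<omega>\<bar> \<longleftrightarrow> a\<^sup>2 \<le> (?D \<omega>)\<^sup>2" for \<omega>
      using st abs_le_square_iff[of a "?D \<omega>"] by (simp only: abs_of_pos)
    then show "{\<omega>\<in>space M. \<bar>walk t \<omega> - walk s \<omega>\<bar> \<ge> a} = {\<omega>\<in>space M. (?D \<omega>)\<^sup>2 \<ge> a\<^sup>2}"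
      by (simp only: walk_def of_int_diff)
  qed
  also have "\<dots> \<le> expectation (\<lambda>\<omega>. (?D \<omega>)\<^sup>2) / a\<^sup>2"
    using st by (intro integral_Markov_inequality_measure[OF I, of "{}"]) auto
  also have "\<dots> = real (?m - ?n) / a\<^sup>2" by (subst expectation_pos_diff_square[OF nm]) simp
  also have "\<dots> \<le> (t - s + 1) / a\<^sup>2"
  proof (rule divide_right_mono)
    have "real ?m = of_int \<lfloor>t\<rfloor>" "real ?n = of_int \<lfloor>s\<rfloor>" using st by auto
    then show "real (?m - ?n) \<le> t - s + 1" using nm by (simp add: of_nat_diff) linarith
  qed simp
  finally show "prob {\<omega>\<in>space M. \<bar>walk t \<omega> - walk s \<omega>\<bar> \<ge> a} \<le> (t - s + 1) / a\<^sup>2" .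
next
  fix a b :: real assume "a < b"
  \<comment> \<open>A quarter of the length leaves room to shrink the interval by \<open>e\<close>
    on the left and by \<open>2 * e\<close> on the right. Rescaling costs up to \<open>e\<close> on
    each side; the second \<open>e\<close> on the right turns the weak inequality into a strict
    one.\<close>
  define e where "e = (b - a) / 4"
  have e: "e > 0" using \<open>a < b\<close> by (simp add: e_def)
  have "a + e < b - 2 * e" using \<open>a < b\<close> by (simp add: e_def field_simps)
  from pos_interval_lower[OF this] obtain d K where d: "d > 0" and K: "\<And>n. n \<ge> K \<Longrightarrow>
    prob {\<omega>\<in>space M. (a + e) * sqrt (real n) < real_of_int (pos n \<omega>) \<and> real_of_int (pos n \<omega>) \<le> (b - 2 * e) * sqrt (real n)} \<ge> d"
    unfolding eventually_sequentially by blast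
  \<comment> \<open>Rounding changes the number of steps by at most one. The summand
    \<open>2\<close> therefore still leaves at least \<open>K\<close> steps, a positive number, and
    \<open>\<bar>a\<bar> + \<bar>b\<bar>\<close> at most \<open>e\<close> times as large.\<close>
  define H where "H = real K + (\<bar>a\<bar> + \<bar>b\<bar>) / e + 2"
  have H: "H \<ge> real K + 2" "H \<ge> (\<bar>a\<bar> + \<bar>b\<bar>) / e + 2" using e by (auto simp: H_def)
  have "prob {\<omega>\<in>space M. a * sqrt (t - s) < walk t \<omega> - walk s \<omega> \<and> walk t \<omega> - walk s \<omega> < b * sqrt (t - s)} \<ge> d"
    if st: "0 \<le> s" "t - s \<ge> H" for s t
  proof -
    define n k where "n = nat \<lfloor>s\<rfloor>" and "k = nat \<lfloor>t\<rfloor> - nat \<lfloor>s\<rfloor>"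
    have nm: "nat \<lfloor>s\<rfloor> \<le> nat \<lfloor>t\<rfloor>" using st H by (auto intro!: nat_mono floor_mono)
    have t: "nat \<lfloor>t\<rfloor> = n + k" using nm by (simp add: n_def k_def)
    have "real (nat \<lfloor>t\<rfloor>) = of_int \<lfloor>t\<rfloor>" "real (nat \<lfloor>s\<rfloor>) = of_int \<lfloor>s\<rfloor>" using st H by auto
    then have k: "\<bar>real k - (t - s)\<bar> \<le> 1" unfolding k_def using nm by (simp add: of_nat_diff) linarith
    then have "real k \<ge> real K" "real k > 0" and ke: "real k \<ge> (\<bar>a\<bar> + \<bar>b\<bar>) / e" using st H by linarith+
    then have kK: "k \<ge> K" "k > 0" by auto
    have ab: "\<bar>a\<bar> + \<bar>b\<bar> \<le> e * real k" using ke e by (simp add: pos_divide_le_eq mult.commute)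
    have ts: "t - s > 0" using st H by linarith
    have ra: "\<bar>a * sqrt (t - s) - a * sqrt (real k)\<bar> \<le> e * sqrt (real k)"
      and rb: "\<bar>b * sqrt (t - s) - b * sqrt (real k)\<bar> \<le> e * sqrt (real k)"
      using kK ts k ab by (auto intro!: sqrt_rescale)
    have sk: "e * sqrt (real k) > 0" using e kK by simp
    have "d \<le> prob {\<omega>\<in>space M. (a + e) * sqrt (real k) < real_of_int (pos k \<omega>) \<and> real_of_int (pos k \<omega>) \<le> (b - 2 * e) * sqrt (real k)}"
      by (rule K[OF kK(1)])
    also have "\<dots> = prob {\<omega>\<in>space M. pos k \<omega> \<in> {z. (a + e) * sqrt (real k) < real_of_int z \<and> real_of_int z \<le> (b - 2 * e) * sqrt (real k)}}"
      by simp
    also have "\<dots> = prob {\<omega>\<in>space M. pos (n + k) \<omega> - pos n \<omega> \<in> {z. (a + e) * sqrt (real k) < real_of_int z \<and> real_of_int z \<le> (b - 2 * e) * sqrt (real k)}}"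
      by (rule pos_diff_shift[symmetric])
    also have "\<dots> \<le> prob {\<omega>\<in>space M. a * sqrt (t - s) < walk t \<omega> - walk s \<omega> \<and> walk t \<omega> - walk s \<omega> < b * sqrt (t - s)}"
    proof (rule finite_measure_mono)
      show "{\<omega>\<in>space M. pos (n + k) \<omega> - pos n \<omega> \<in> {z. (a + e) * sqrt (real k) < real_of_int z \<and> real_of_int z \<le> (b - 2 * e) * sqrt (real k)}}
        \<subseteq> {\<omega>\<in>space M. a * sqrt (t - s) < walk t \<omega> - walk s \<omega> \<and> walk t \<omega> - walk s \<omega> < b * sqrt (t - s)}"
      proof safe
        fix \<omega> assume *: "(a + e) * sqrt (real k) < real_of_int (pos (n + k) \<omega> - pos n \<omega>)"
          "real_of_int (pos (n + k) \<omega> - pos n \<omega>) \<le> (b - 2 * e) * sqrt (real k)"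
        have w: "walk t \<omega> - walk s \<omega> = real_of_int (pos (n + k) \<omega> - pos n \<omega>)" by (simp add: walk_def t n_def)
        show "a * sqrt (t - s) < walk t \<omega> - walk s \<omega>" "walk t \<omega> - walk s \<omega> < b * sqrt (t - s)"
          using * ra rb sk unfolding w distrib_right left_diff_distrib by linarith+
      qed
      have [measurable]: "walk t \<in> borel_measurable M" for t unfolding walk_def by measurable
      show "{\<omega>\<in>space M. a * sqrt (t - s) < walk t \<omega> - walk s \<omega> \<and> walk t \<omega> - walk s \<omega> < b * sqrt (t - s)} \<in> events"
        by measurable
    qed
    finally show ?thesis .
  qed
  moreover have "H > 0" using H by linarith
  ultimately show "\<exists>d>0. \<exists>H>0. \<forall>s t. 0 \<le> s \<longrightarrow> t - s \<ge> H \<longrightarrow>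
      prob {\<omega>\<in>space M. a * sqrt (t - s) < walk t \<omega> - walk s \<omega> \<and> walk t \<omega> - walk s \<omega> < b * sqrt (t - s)} \<ge> d"
    using d by (intro exI[of _ d] conjI exI[of _ H]) auto
qed

end

text \<open>A monotone sequence is controlled between consecutive fourth powers by its value at the
  larger one. For \<open>k \<ge> 1\<close> these powers differ by a factor of at most
  \<open>16\<close>, whence \<open>e / 16\<close>.\<close>

lemma tendsto_zero_of_fourth_powers:
  fixes z :: "nat \<Rightarrow> real"
  assumes mono: "mono z" and nonneg: "\<And>n. z n \<ge> 0"
    and ev: "\<And>q :: nat. \<forall>\<^sub>F k in sequentially. z (Suc k ^ 4) < real (Suc k ^ 4) / real (Suc q)"
  shows "(\<lambda>n. z n / real n) \<longlonglongrightarrow> 0"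
proof (rule LIMSEQ_I)
  fix e :: real assume "e > 0"
  then obtain q where q: "inverse (real (Suc q)) < e / 16" using reals_Archimedean[of "e / 16"] by auto
  obtain K where K: "\<And>k. k \<ge> K \<Longrightarrow> z (Suc k ^ 4) < real (Suc k ^ 4) / real (Suc q)"
    using ev[of q] unfolding eventually_sequentially by blast
  have "norm (z n / real n - 0) < e" if n: "n \<ge> Suc (Suc K) ^ 4" for n
  proof -
    define k where "k = (LEAST m. n < Suc m ^ 4)"
    have "n < Suc n ^ 4" by (rule less_le_trans[of _ "Suc n"]) (auto intro: self_le_power)
    then have k: "n < Suc k ^ 4" unfolding k_def by (rule LeastI)
    have "Suc K < Suc k"
    proof (rule ccontr)
      assume "\<not> ?thesis"
      then have "Suc k ^ 4 \<le> Suc (Suc K) ^ 4" by (intro power_mono) auto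
      with k n show False by simp
    qed
    then have kK: "k \<ge> K" "k \<ge> 1" by auto
    have "\<not> n < Suc (k - 1) ^ 4" unfolding k_def by (rule not_less_Least) (use kK in \<open>auto simp: k_def\<close>)
    then have kn: "k ^ 4 \<le> n" using kK by simp
    have "0 < Suc (Suc K) ^ 4" by simp
    with n have npos: "n > 0" by linarith
    have "z n \<le> z (Suc k ^ 4)" using k by (intro monoD[OF mono]) auto
    also have "\<dots> \<le> real (Suc k ^ 4) * inverse (real (Suc q))"
      using K[OF kK(1)] by (simp add: divide_inverse)
    also have "\<dots> \<le> real ((2 * k) ^ 4) * inverse (real (Suc q))"
      using kK by (intro mult_right_mono of_nat_mono power_mono) auto
    also have "\<dots> = 16 * real (k ^ 4) * inverse (real (Suc q))" by (simp add: power_mult_distrib)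
    also have "\<dots> \<le> 16 * real n * inverse (real (Suc q))"
      using kn by (intro mult_right_mono mult_left_mono of_nat_mono) auto
    also have "\<dots> < 16 * real n * (e / 16)"
      using q npos by (intro mult_strict_left_mono) auto
    finally have "z n < real n * e" by simp
    then show ?thesis using npos nonneg[of n] by (simp add: pos_divide_less_eq mult.commute)
  qed
  then show "\<exists>no. \<forall>n\<ge>no. norm (z n / real n - 0) < e" by blast
qed

section \<open>Simple random walk is rarely at zero\<close>

context spider_model
begin

lemma pos_zero_event: "{\<omega>\<in>space M. pos n \<omega> = 0} \<in> events"
proof -
  have "{\<omega>\<in>space M. real_of_int (pos n \<omega>) = 0} \<in> events" by measurable
  then show ?thesis by simp
qed

text \<open>The discrete Tanaka formula: away from zero the distance changes by the sign times the
  step, which has mean zero, and at zero it grows by exactly one.\<close>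

lemma expectation_abs_pos_Suc:
  "expectation (\<lambda>\<omega>. \<bar>real_of_int (pos (Suc n) \<omega>)\<bar>) =
   expectation (\<lambda>\<omega>. \<bar>real_of_int (pos n \<omega>)\<bar>) + prob {\<omega>\<in>space M. pos n \<omega> = 0}"
proof -
  let ?P = "\<lambda>\<omega>. real_of_int (pos n \<omega>)"
  note [measurable] = pos_zero_event[of n]
  have Pm: "?P \<in> borel_measurable (coord ({True} \<times> {0<..n}))" by (rule measurable_pos_coord) simp
  then have sm: "(\<lambda>\<omega>. sgn (?P \<omega>)) \<in> borel_measurable (coord ({True} \<times> {0<..n}))" by measurable
  have sb: "\<bar>sgn (?P \<omega>)\<bar> \<le> 1" for \<omega> by (simp add: sgn_if)
  note c = expectation_times_step[OF sm _ sb, of "Suc n"]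
  have i1: "integrable M (\<lambda>\<omega>. \<bar>?P \<omega>\<bar>)"
    using abs_pos_le[of n] by (intro integrable_const_bound[where B = "real n"] AE_I2) (auto, metis of_int_abs of_int_le_iff of_int_of_nat_eq)
  have i2: "integrable M (\<lambda>\<omega>. indicator {\<omega>\<in>space M. pos n \<omega> = 0} \<omega> :: real)"
    by (intro integrable_real_indicator) (auto simp: emeasure_eq_measure)
  have "expectation (\<lambda>\<omega>. \<bar>real_of_int (pos (Suc n) \<omega>)\<bar>) =
      expectation (\<lambda>\<omega>. \<bar>?P \<omega>\<bar> + (sgn (?P \<omega>) * real_of_int (step (Suc n) \<omega>) + indicator {\<omega>\<in>space M. pos n \<omega> = 0} \<omega>))"
  proof (rule Bochner_Integration.integral_cong)
    fix \<omega> assume "\<omega> \<in> space M"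
    then show "\<bar>real_of_int (pos (Suc n) \<omega>)\<bar> =
        \<bar>?P \<omega>\<bar> + (sgn (?P \<omega>) * real_of_int (step (Suc n) \<omega>) + indicator {\<omega>\<in>space M. pos n \<omega> = 0} \<omega>)"
      using step_cases[of "Suc n" \<omega>] by (cases "pos n \<omega>" "0 :: int" rule: linorder_cases) auto
  qed simp
  also have "\<dots> = expectation (\<lambda>\<omega>. \<bar>?P \<omega>\<bar>) + prob {\<omega>\<in>space M. pos n \<omega> = 0}"
    using c i1 i2 by (simp add: Int_absorb1)
  finally show ?thesis .
qed

definition zeros :: "nat \<Rightarrow> 'a \<Rightarrow> real" where
  "zeros n \<omega> = (\<Sum>k=1..n. of_bool (pos k \<omega> = 0))"

lemma measurable_zeros [measurable]: "zeros n \<in> borel_measurable M"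
proof -
  have "(\<lambda>\<omega>. \<Sum>k=1..n. if real_of_int (pos k \<omega>) = 0 then 1 else 0 :: real) \<in> borel_measurable M"
    by measurable
  then show ?thesis unfolding zeros_def by (simp add: of_bool_def)
qed

lemma zeros_le: "zeros n \<omega> \<le> real n"
proof -
  have "zeros n \<omega> \<le> (\<Sum>k=1..n. 1)" unfolding zeros_def by (intro sum_mono) auto
  then show ?thesis by simp
qed

lemma integrable_zeros: "integrable M (zeros n)"
  using zeros_le[of n] by (intro integrable_const_bound[where B = "real n"]) (auto simp: zeros_def sum_nonneg)

text \<open>Summing the recursion for the mean distance counts the zeros; the \<open>+ 1\<close>
  below is the visit at time \<open>0\<close>. The mean distance is at most the root of the second
  moment \<open>Suc n\<close>.\<close>

lemma expectation_zeros: "expectation (zeros n) \<le> sqrt (real (Suc n))"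
proof -
  have "expectation (zeros n) + 1 = expectation (\<lambda>\<omega>. \<bar>real_of_int (pos (Suc n) \<omega>)\<bar>)"
  proof (induction n)
    case 0
    then show ?case using expectation_abs_pos_Suc[of 0] by (simp add: zeros_def prob_space)
  next
    case (Suc n)
    note ev = pos_zero_event[of "Suc n"]
    have "expectation (zeros (Suc n)) = expectation (\<lambda>\<omega>. zeros n \<omega> + indicator {\<omega>\<in>space M. pos (Suc n) \<omega> = 0} \<omega>)"
      by (intro Bochner_Integration.integral_cong) (auto simp: zeros_def indicator_def)
    also have "\<dots> = expectation (zeros n) + prob {\<omega>\<in>space M. pos (Suc n) \<omega> = 0}"
      using integrable_zeros[of n] ev
      by (subst Bochner_Integration.integral_add) (auto simp: emeasure_eq_measure Int_absorb1 simp del: pos.simps intro!: integrable_real_indicator)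
    finally show ?case using Suc expectation_abs_pos_Suc[of "Suc n"] by simp
  qed
  moreover have "(expectation (\<lambda>\<omega>. \<bar>real_of_int (pos (Suc n) \<omega>)\<bar>))\<^sup>2 \<le> real (Suc n)"
  proof -
    let ?X = "\<lambda>\<omega>. \<bar>real_of_int (pos (Suc n) \<omega>)\<bar>"
    have b: "?X \<omega> \<le> real (Suc n)" for \<omega> using abs_pos_le[of "Suc n" \<omega>] by linarith
    have [measurable]: "?X \<in> borel_measurable M" by (intro borel_measurable_abs measurable_pos)
    have i1: "integrable M ?X"
      using b by (intro integrable_const_bound[where B = "real (Suc n)"]) auto
    have i2: "integrable M (\<lambda>\<omega>. (?X \<omega>)\<^sup>2)"
    proof (intro integrable_const_bound[where B = "(real (Suc n))\<^sup>2"] AE_I2)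
      fix \<omega>
      have "(?X \<omega>)\<^sup>2 \<le> (real (Suc n))\<^sup>2" by (intro power_mono b) auto
      then show "norm ((?X \<omega>)\<^sup>2) \<le> (real (Suc n))\<^sup>2" by (simp only: real_norm_def abs_power2)
    qed measurable
    have "0 \<le> expectation (\<lambda>\<omega>. (?X \<omega>)\<^sup>2) - (expectation ?X)\<^sup>2"
      using variance_positive[of ?X] unfolding variance_eq[OF i1 i2] .
    moreover have "expectation (\<lambda>\<omega>. (?X \<omega>)\<^sup>2) = real (Suc n)"
      using expectation_pos_diff_square[of 0 "Suc n"] by (simp del: pos.simps(2) of_nat_Suc)
    ultimately show ?thesis by linarith
  qed
  then have "expectation (\<lambda>\<omega>. \<bar>real_of_int (pos (Suc n) \<omega>)\<bar>) \<le> sqrt (real (Suc n))"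
    by (rule real_le_rsqrt)
  ultimately show ?thesis by simp
qed

text \<open>At time \<open>k ^ 4\<close> the mean number of zeros is of the order
  \<open>k ^ 2\<close>, so Markov's inequality gives a summable bound of order
  \<open>1 / k ^ 2\<close>. Along squares of \<open>k\<close> the bound would only be
  harmonic.\<close>

lemma AE_zeros_negligible: "AE \<omega> in M. (\<lambda>n. zeros n \<omega> / real n) \<longlonglongrightarrow> 0"
proof -
  have "AE \<omega> in M. \<forall>\<^sub>F k in sequentially. zeros (Suc k ^ 4) \<omega> < real (Suc k ^ 4) / real (Suc q)" for q
  proof -
    define A where "A k = {\<omega>\<in>space M. zeros (Suc k ^ 4) \<omega> \<ge> real (Suc k ^ 4) / real (Suc q)}" for k
    have A_ev: "A k \<in> events" for k unfolding A_def by measurable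
    have "prob (A k) \<le> 2 * real (Suc q) * inverse (real (Suc k) ^ 2)" for k
    proof -
      define r where "r = real (Suc k)"
      have r: "r \<ge> 1" "real (Suc k ^ 4) = r ^ 4" by (simp_all add: r_def)
      have "prob (A k) \<le> expectation (zeros (Suc k ^ 4)) / (real (Suc k ^ 4) / real (Suc q))"
        unfolding A_def
        by (intro integral_Markov_inequality_measure[OF integrable_zeros, of "{}"]) (auto simp: zeros_def sum_nonneg)
      also have "\<dots> \<le> (2 * r\<^sup>2) / (real (Suc k ^ 4) / real (Suc q))"
      proof (rule divide_right_mono)
        have "expectation (zeros (Suc k ^ 4)) \<le> sqrt (r ^ 4 + 1)"
          using expectation_zeros[of "Suc k ^ 4"] r by (simp add: add.commute)
        also have "\<dots> \<le> sqrt ((2 * r\<^sup>2)\<^sup>2)"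
        proof (rule real_sqrt_le_mono)
          have "1 \<le> r ^ 4" using r by simp
          moreover have "(2 * r\<^sup>2)\<^sup>2 = 4 * r ^ 4" by (simp add: power_mult_distrib)
          ultimately show "r ^ 4 + 1 \<le> (2 * r\<^sup>2)\<^sup>2" by linarith
        qed
        also have "\<dots> = 2 * r\<^sup>2" by (subst real_sqrt_abs) simp
        finally show "expectation (zeros (Suc k ^ 4)) \<le> 2 * r\<^sup>2" .
      qed simp
      also have "\<dots> = 2 * real (Suc q) * inverse (r\<^sup>2)"
        unfolding r(2) using r(1) by (simp add: field_simps power4_eq_xxxx power2_eq_square)
      finally show ?thesis by (simp add: r_def)
    qed
    moreover have "summable (\<lambda>k. 2 * real (Suc q) * inverse (real (Suc k) ^ 2))"
      using inverse_power_summable[of 2, where 'a = real] by (intro summable_mult) (subst summable_Suc_iff, simp)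
    ultimately have "summable (\<lambda>k. prob (A k))"
      by (intro summable_comparison_test[of "\<lambda>k. prob (A k)" "\<lambda>k. 2 * real (Suc q) * inverse (real (Suc k) ^ 2)"] exI[of _ 0])
         (simp_all del: of_nat_Suc)
    then have "AE \<omega> in M. \<forall>\<^sub>F k in sequentially. \<omega> \<in> space M - A k"
      using A_ev by (intro borel_cantelli_AE1) (auto simp: emeasure_eq_measure)
    then show ?thesis by eventually_elim (auto simp: A_def not_le elim: eventually_mono)
  qed
  then have "AE \<omega> in M. \<forall>q. \<forall>\<^sub>F k in sequentially. zeros (Suc k ^ 4) \<omega> < real (Suc k ^ 4) / real (Suc q)"
    by (subst AE_all_countable) auto
  then show ?thesis
  proof eventually_elim
    fix \<omega> assume *: "\<forall>q. \<forall>\<^sub>F k in sequentially. zeros (Suc k ^ 4) \<omega> < real (Suc k ^ 4) / real (Suc q)"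
    show "(\<lambda>n. zeros n \<omega> / real n) \<longlonglongrightarrow> 0"
    proof (rule tendsto_zero_of_fourth_powers)
      show "mono (\<lambda>n. zeros n \<omega>)" unfolding zeros_def by (intro monoI sum_mono2) auto
      show "zeros n \<omega> \<ge> 0" for n by (simp add: zeros_def sum_nonneg)
    qed (use * in blast)
  qed
qed

text \<open>The value at time \<open>0\<close>, when the walk sits at the body, is a default that
  keeps labels within \<open>{1..N}\<close>. A label drawn on leaving zero carries the time of that
  first step as its index.\<close>

primrec lab :: "nat \<Rightarrow> 'a \<Rightarrow> nat" where
  "lab 0 \<omega> = 1"
| "lab (Suc n) \<omega> = (if pos n \<omega> = 0 then Z (False, Suc n) \<omega> else lab n \<omega>)"

definition model :: "nat \<Rightarrow> 'a \<Rightarrow> complex" where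
  "model n \<omega> = spider_point N (real_of_int \<bar>pos n \<omega>\<bar>) (lab n \<omega>)"

lemma lab_range: "\<omega> \<in> space M \<Longrightarrow> lab n \<omega> \<in> {1..N}"
  using N_pos label_range by (induction n) auto

primrec last_zero :: "nat \<Rightarrow> 'a \<Rightarrow> nat" where
  "last_zero 0 \<omega> = 0"
| "last_zero (Suc n) \<omega> = (if pos (Suc n) \<omega> = 0 then Suc n else last_zero n \<omega>)"

lemma last_zero_le: "last_zero n \<omega> \<le> n"
  by (induction n) (auto simp: le_SucI)

lemma last_zero_eq: "pos n \<omega> = 0 \<Longrightarrow> last_zero n \<omega> = n"
  by (cases n) auto

lemma pos_last_zero: "pos (last_zero n \<omega>) \<omega> = 0"
  by (induction n) auto

lemma last_zero_const:
  assumes "n \<le> m" "\<And>i. n < i \<Longrightarrow> i \<le> m \<Longrightarrow> pos i \<omega> \<noteq> 0"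
  shows "last_zero m \<omega> = last_zero n \<omega>"
  using assms
proof (induction m rule: dec_induct)
  case (step m)
  have "pos (Suc m) \<omega> \<noteq> 0" by (rule step.prems) (use step.hyps in auto)
  moreover have "last_zero m \<omega> = last_zero n \<omega>" by (rule step.IH, rule step.prems) auto
  ultimately show ?case by (simp del: pos.simps)
qed simp

lemma pos_after_last_zero: "last_zero n \<omega> < i \<Longrightarrow> i \<le> n \<Longrightarrow> pos i \<omega> \<noteq> 0"
  by (induction n) (auto simp del: pos.simps simp: le_Suc_eq split: if_splits)

lemma lab_eq: "pos n \<omega> \<noteq> 0 \<Longrightarrow> lab n \<omega> = Z (False, Suc (last_zero n \<omega>)) \<omega>"
proof (induction n)
  case (Suc n)
  then show ?case using last_zero_eq[of n \<omega>] by (auto simp del: pos.simps)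
qed simp

text \<open>Steps of size one cannot jump over zero.\<close>

lemma pos_same_sign:
  assumes "n \<le> m" "\<And>i. n \<le> i \<Longrightarrow> i \<le> m \<Longrightarrow> pos i \<omega> \<noteq> 0"
  shows "pos n \<omega> * pos m \<omega> > 0"
  using assms
proof (induction m rule: dec_induct)
  case base
  then show ?case by (simp add: zero_less_mult_iff) linarith
next
  case (step m)
  have 1: "pos n \<omega> * pos m \<omega> > 0" by (rule step.IH, rule step.prems) auto
  have "pos (Suc m) \<omega> \<noteq> 0" by (rule step.prems) (use step.hyps in auto)
  with 1 show ?case using step_cases[of "Suc m" \<omega>] by (auto simp: zero_less_mult_iff)
qed

end

section \<open>Occupation times of the model\<close>

context spider_model
begin

lemma model_in_spider: "\<omega> \<in> space M \<Longrightarrow> model n \<omega> \<in> spider N"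
  unfolding model_def spider_def using lab_range by fastforce

lemma model_eq_0_iff: "model n \<omega> = 0 \<longleftrightarrow> pos n \<omega> = 0"
  by (simp add: model_def)

lemma model_in_leg_iff:
  assumes "\<omega> \<in> space M" "pos n \<omega> \<noteq> 0" "j \<in> {1..N}"
  shows "model n \<omega> \<in> leg N j \<longleftrightarrow> lab n \<omega> = j"
  unfolding model_def using assms lab_range by (intro spider_point_in_leg_iff) auto

lemma sum_walk_occ_model:
  assumes "\<omega> \<in> space M"
  shows "(\<Sum>j\<in>{1..N}. walk_occ N (\<lambda>k. model k \<omega>) j n) = real n - zeros n \<omega>"
proof -
  have "(\<Sum>j\<in>{1..N}. walk_occ N (\<lambda>k. model k \<omega>) j n) = (\<Sum>k=1..n. \<Sum>j\<in>{1..N}. indicator (leg N j) (model k \<omega>))"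
    unfolding walk_occ_def by (rule sum.swap)
  also have "\<dots> = (\<Sum>k=1..n. 1 - of_bool (pos k \<omega> = 0))"
    using model_in_spider[OF assms] model_eq_0_iff by (intro sum.cong refl) (subst sum_indicator_leg, auto)
  finally show ?thesis by (simp add: sum_subtractf zeros_def)
qed

text \<open>The index of the label in force at time \<open>t\<close>, provided that the walk is not at zero.\<close>

definition start_index :: "real \<Rightarrow> 'a \<Rightarrow> nat" where
  "start_index t \<omega> = Suc (last_zero (nat \<lfloor>t\<rfloor>) \<omega>)"

lemma measurable_last_zero: "last_zero n \<in> measurable (coord ({True} \<times> UNIV)) (count_space UNIV)"
proof (induction n)
  case (Suc n)
  have [measurable]: "last_zero n \<in> measurable (coord ({True} \<times> UNIV)) (count_space UNIV)"
    "(\<lambda>\<omega>. real_of_int (pos (Suc n) \<omega>)) \<in> borel_measurable (coord ({True} \<times> UNIV))"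
    by (rule Suc, rule measurable_pos_coord) auto
  have "(\<lambda>\<omega>. if real_of_int (pos (Suc n) \<omega>) = 0 then Suc n else last_zero n \<omega>) \<in> measurable (coord ({True} \<times> UNIV)) (count_space UNIV)"
    by measurable
  then show ?case by (simp del: pos.simps)
qed simp

text \<open>Equal indices mean that the last zero up to \<open>t\<close> is already the last zero up
  to \<open>s\<close>. So the walk avoids zero from \<open>s\<close> to \<open>t\<close> and keeps
  its sign.\<close>

lemma start_index_separates:
  assumes "0 \<le> s" "s \<le> t'" "t' \<le> t" "walk s \<omega> \<noteq> 0" "start_index s \<omega> = start_index t \<omega>"
  shows "walk s \<omega> * walk t' \<omega> > 0"
proof -
  have le: "nat \<lfloor>s\<rfloor> \<le> nat \<lfloor>t'\<rfloor>" "nat \<lfloor>t'\<rfloor> \<le> nat \<lfloor>t\<rfloor>" using assms by (auto intro!: nat_mono floor_mono)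
  have lz: "last_zero (nat \<lfloor>t\<rfloor>) \<omega> = last_zero (nat \<lfloor>s\<rfloor>) \<omega>" using assms(5) by (simp add: start_index_def)
  have "last_zero (nat \<lfloor>s\<rfloor>) \<omega> \<noteq> nat \<lfloor>s\<rfloor>"
    using assms(4) pos_last_zero[of "nat \<lfloor>s\<rfloor>" \<omega>] by (auto simp: walk_def)
  then have "last_zero (nat \<lfloor>t\<rfloor>) \<omega> < nat \<lfloor>s\<rfloor>" unfolding lz using last_zero_le[of "nat \<lfloor>s\<rfloor>" \<omega>] by simp
  then have "pos i \<omega> \<noteq> 0" if "nat \<lfloor>s\<rfloor> \<le> i" "i \<le> nat \<lfloor>t'\<rfloor>" for i
    using that le by (intro pos_after_last_zero[of "nat \<lfloor>t\<rfloor>"]) auto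
  then have "pos (nat \<lfloor>s\<rfloor>) \<omega> * pos (nat \<lfloor>t'\<rfloor>) \<omega> > 0" by (intro pos_same_sign le)
  then show ?thesis by (simp add: walk_def flip: of_int_mult)
qed

lemma AE_frequently_matching_model:
  assumes p: "\<And>j. j \<in> {1..N} \<Longrightarrow> p j > 0" and \<theta>: "\<theta> > 0"
  shows "AE \<omega> in M. \<exists>\<^sub>F k in sequentially.
    matching N (bump_selection N \<theta> (\<lambda>t. start_index t \<omega>) (\<lambda>t. walk t \<omega>) k) (\<lambda>m. Z (False, m) \<omega>)"
proof (rule AE_frequently_matching[OF N_pos _ label p])
  interpret W: indep_increments M walk by (rule walk_indep_increments)
  show "indep_vars (\<lambda>_. count_space UNIV) (\<lambda>m. Z (False, m)) {1..}"
  proof -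
    have "indep_vars (\<lambda>m. PiM {(False, m)} (\<lambda>_. count_space UNIV)) (\<lambda>m \<omega>. restrict (\<lambda>j. Z j \<omega>) {(False, m)}) {1..}"
      by (intro indep_vars_restrict[OF indep_Z]) (auto simp: disjoint_family_on_def)
    then have "indep_vars (\<lambda>_. count_space UNIV) (\<lambda>m \<omega>. (\<lambda>f. f (False, m)) (restrict (\<lambda>j. Z j \<omega>) {(False, m)})) {1..}"
    proof (rule indep_vars_compose2)
      fix m
      show "(\<lambda>f. f (False, m)) \<in> measurable (PiM {(False, m)} (\<lambda>_. count_space (UNIV :: nat set))) (count_space UNIV)"
        by (rule measurable_component_singleton) simp
    qed
    then show ?thesis by simp
  qed
  show "space (coord ({True} \<times> UNIV)) = space M" by simp
  \<comment> \<open>Windows and indices are functions of the coins, the labels live on the other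
    coordinates.\<close>
  show "indep_set (generated_events M (count_space UNIV) {1..} (\<lambda>m. Z (False, m))) (sets (coord ({True} \<times> UNIV)))"
  proof -
    have m: "(\<lambda>\<omega>. \<lambda>m\<in>{1..}. Z (False, m) \<omega>) \<in> measurable (coord ({False} \<times> UNIV)) (PiM {1..} (\<lambda>_. count_space UNIV))"
      by (intro measurable_restrict measurable_Z_coord) auto
    have "generated_events M (count_space UNIV) {1..} (\<lambda>m. Z (False, m)) \<subseteq> sets (coord ({False} \<times> UNIV))"
      unfolding generated_events_def using measurable_sets[OF m]
      by (subst sets_vimage_algebra2) (auto simp: space_PiM)
    moreover have "indep_set (sets (coord ({False} \<times> UNIV))) (sets (coord ({True} \<times> UNIV)))"
      by (rule indep_set_coord) auto
    ultimately show ?thesis unfolding indep_sets2_eq by blast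
  qed
  show "{\<omega>\<in>space M. bump_selection N \<theta> (\<lambda>t. start_index t \<omega>) (\<lambda>t. walk t \<omega>) k = v} \<in> sets (coord ({True} \<times> UNIV))" for k v
  proof -
    have "sets (generated_algebra (space M) {0..} walk) \<subseteq> sets (coord ({True} \<times> UNIV))"
      unfolding walk_def by (intro sets_generated_algebra_subset measurable_pos_coord) auto
    then have "{\<omega>\<in>space (coord ({True} \<times> UNIV)). good_window N \<theta> (\<lambda>t. walk t \<omega>) k} \<in> sets (coord ({True} \<times> UNIV))"
      using W.good_window_sets[OF \<theta>, of N k] by auto
    moreover have "start_index t \<in> measurable (coord ({True} \<times> UNIV)) (count_space UNIV)" for t
      unfolding start_index_def using measurable_last_zero by measurable
    ultimately have "{\<omega>\<in>space (coord ({True} \<times> UNIV)). bump_selection N \<theta> (\<lambda>t. start_index t \<omega>) (\<lambda>t. walk t \<omega>) k = v} \<in> sets (coord ({True} \<times> UNIV))"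
      by (intro sets_bump_selection)
    then show ?thesis by simp
  qed
  show "AE \<omega> in M. valid_selection N (\<lambda>k. bump_selection N \<theta> (\<lambda>t. start_index t \<omega>) (\<lambda>t. walk t \<omega>) k)"
    using W.AE_frequently_good_window[OF \<theta>, of N]
  proof eventually_elim
    fix \<omega> assume freq: "\<exists>\<^sub>F k in sequentially. good_window N \<theta> (\<lambda>t. walk t \<omega>) k"
    show "valid_selection N (\<lambda>k. bump_selection N \<theta> (\<lambda>t. start_index t \<omega>) (\<lambda>t. walk t \<omega>) k)"
      using start_index_separates by (intro valid_bump_selection[OF \<theta> freq]) (auto simp: start_index_def)
  qed
qed auto

text \<open>The bump for leg \<open>j\<close> is a time interval of length
  \<open>scale N \<theta> k\<close>, which contains at least \<open>scale N \<theta> k - 1\<close>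
  integers; at all of them the model is on leg \<open>j\<close>.\<close>

lemma walk_occ_model_lower:
  assumes \<theta>: "\<theta> > 0" and \<omega>: "\<omega> \<in> space M" and j: "j \<in> {1..N}"
    and m: "matching N (bump_selection N \<theta> (\<lambda>t. start_index t \<omega>) (\<lambda>t. walk t \<omega>) k) (\<lambda>m. Z (False, m) \<omega>)"
  shows "walk_occ N (\<lambda>k. model k \<omega>) j (window (Suc k)) \<ge> scale N \<theta> k - 1"
proof -
  obtain l where l: "bump_selection N \<theta> (\<lambda>t. start_index t \<omega>) (\<lambda>t. walk t \<omega>) k = Some l"
      "\<And>i. i < N \<Longrightarrow> Z (False, l ! i) \<omega> = Suc i"
    using m by (auto simp: matching_def)
  then have good: "good_window N \<theta> (\<lambda>t. walk t \<omega>) k"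
    and l': "l = map (\<lambda>i. start_index (bump_time N \<theta> k (Suc i)) \<omega>) [0..<N]"
    by (auto simp: bump_selection_def split: if_splits)
  define v where "v = bump_time N \<theta> k j"
  have cj: "Z (False, start_index v \<omega>) \<omega> = j"
  proof -
    have "j - 1 < N" using j by auto
    from l(2)[OF this] show ?thesis using j \<open>j - 1 < N\<close> by (simp add: l' v_def)
  qed
  let ?s = "scale N \<theta> k"
  have s: "?s > 0" by (rule scale_pos[OF \<theta>])
  define u where "u = real (window k) + bump_start \<theta> j * ?s"
  have uv: "v - u = ?s" using j by (auto simp: u_def v_def bump_time_def bump_start_def algebra_simps)
  have "u \<ge> 0" using bump_start_ge[of \<theta> j] \<theta> s by (simp add: u_def)
  define A where "A = {nat \<lceil>u\<rceil>..nat \<lfloor>v\<rfloor>}"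
  have A: "u \<le> real i" "real i \<le> v" if "i \<in> A" for i
    using that \<open>u \<ge> 0\<close> uv s unfolding A_def by (auto simp: nat_le_iff le_nat_iff ceiling_le_iff le_floor_iff)
  have nz: "pos i \<omega> \<noteq> 0" if "i \<in> A" for i
  proof -
    have "(-1) ^ j * walk (real i) \<omega> \<ge> sqrt ?s"
      using good A[OF that] j unfolding good_window_def u_def v_def bump_time_def by auto
    moreover have "sqrt ?s > 0" using s by simp
    ultimately show ?thesis by (auto simp: walk_def)
  qed
  \<comment> \<open>No zero lies between \<open>i\<close> and the end \<open>v\<close> of the bump,
    so the label in force at \<open>i\<close> is the matched one.\<close>
  have leg: "model i \<omega> \<in> leg N j" if i: "i \<in> A" for i
  proof -
    have "last_zero (nat \<lfloor>v\<rfloor>) \<omega> = last_zero i \<omega>"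
      using i by (intro last_zero_const nz) (auto simp: A_def)
    then have "lab i \<omega> = j" using lab_eq[OF nz[OF i]] cj by (simp add: start_index_def)
    then show ?thesis using model_in_leg_iff[OF \<omega> nz[OF i] j] by simp
  qed
  have "v \<le> real (window (Suc k))"
    using bump_time_mono[OF \<theta>, of j N N k] j window_scale[OF \<theta>, of k N] by (simp add: v_def bump_time_def)
  then have sub: "A \<subseteq> {1..window (Suc k)}"
  proof safe
    fix i assume vw: "v \<le> real (window (Suc k))" and i: "i \<in> A"
    have "i \<noteq> 0" using nz[OF i] by (metis pos.simps(1))
    moreover have "real i \<le> real (window (Suc k))" using A[OF i] vw by linarith
    ultimately show "i \<in> {1..window (Suc k)}" by simp
  qed
  have "?s - 1 \<le> real (card A)"
  proof -
    have "real (nat \<lceil>u\<rceil>) < u + 1" "real (nat \<lfloor>v\<rfloor>) > v - 1"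
      using \<open>u \<ge> 0\<close> uv s by linarith+
    then show ?thesis unfolding A_def using uv by (simp add: of_nat_diff)
  qed
  also have "real (card A) = (\<Sum>i\<in>A. indicator (leg N j) (model i \<omega>))"
    using leg by simp
  also have "\<dots> \<le> walk_occ N (\<lambda>k. model k \<omega>) j (window (Suc k))"
    unfolding walk_occ_def using sub by (intro sum_mono2) auto
  finally show ?thesis .
qed

lemma model_occupation:
  assumes p: "\<And>j. j \<in> {1..N} \<Longrightarrow> p j > 0"
  shows "AE \<omega> in M.
    liminf (\<lambda>n. ereal (walk_occ_max N (\<lambda>k. model k \<omega>) n / real n)) = ereal (1 / real N) \<and>
    limsup (\<lambda>n. ereal (walk_occ_min N (\<lambda>k. model k \<omega>) n / real n)) = ereal (1 / real N)"
proof -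
  have "AE \<omega> in M. \<forall>q. \<exists>\<^sub>F k in sequentially.
    matching N (bump_selection N (1 / real (Suc q)) (\<lambda>t. start_index t \<omega>) (\<lambda>t. walk t \<omega>) k) (\<lambda>m. Z (False, m) \<omega>)"
    using AE_frequently_matching_model[OF p] by (subst AE_all_countable) auto
  with AE_zeros_negligible AE_space show ?thesis
  proof eventually_elim
    fix \<omega> assume z: "(\<lambda>n. zeros n \<omega> / real n) \<longlonglongrightarrow> 0" and \<omega>: "\<omega> \<in> space M"
      and freq: "\<forall>q. \<exists>\<^sub>F k in sequentially.
        matching N (bump_selection N (1 / real (Suc q)) (\<lambda>t. start_index t \<omega>) (\<lambda>t. walk t \<omega>) k) (\<lambda>m. Z (False, m) \<omega>)"
    let ?w = "\<lambda>k. model k \<omega>"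
    have total: "(\<lambda>n. (\<Sum>j\<in>{1..N}. walk_occ N ?w j n) / real n) \<longlonglongrightarrow> 1"
    proof (rule Lim_transform_eventually)
      show "(\<lambda>n. 1 - zeros n \<omega> / real n) \<longlonglongrightarrow> 1" using tendsto_diff[OF tendsto_const z, of 1] by simp
      show "\<forall>\<^sub>F n in sequentially. 1 - zeros n \<omega> / real n = (\<Sum>j\<in>{1..N}. walk_occ N ?w j n) / real n"
        using eventually_gt_at_top[of 0]
        by eventually_elim (subst sum_walk_occ_model[OF \<omega>], simp add: diff_divide_distrib)
    qed
    have bal: "\<exists>\<^sub>F n in sequentially. \<forall>j\<in>{1..N}. walk_occ N ?w j n / real n \<ge> c" if c: "c < 1 / real N" for c
    proof (rule frequently_balanced[OF N_pos filterlim_window _ _ c])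
      show "\<exists>\<^sub>F k in sequentially. \<forall>j\<in>{1..N}. walk_occ N ?w j (window (Suc k)) \<ge> scale N (1 / real (Suc q)) k - 1" for q
        using spec[OF freq, of q] by (rule frequently_elim1) (auto intro!: walk_occ_model_lower \<omega>)
    qed simp
    have pos: "\<forall>\<^sub>F n in sequentially. real n > 0"
      using eventually_gt_at_top[of 0] by eventually_elim simp
    note main = Liminf_Max_Limsup_Min[OF N_pos sequentially_bot pos total bal]
    show "liminf (\<lambda>n. ereal (walk_occ_max N ?w n / real n)) = ereal (1 / real N) \<and>
        limsup (\<lambda>n. ereal (walk_occ_min N ?w n / real n)) = ereal (1 / real N)"
      unfolding walk_occ_max_def walk_occ_min_def using main by blast
  qed
qed

end

section \<open>Comparison of laws\<close>

lemma (in product_prob_space) indep_vars_components: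
  assumes "I \<noteq> {}"
  shows "P.indep_vars M (\<lambda>i \<omega>. \<omega> i) I"
proof -
  have "distr (PiM I M) (PiM I M) (\<lambda>x. \<lambda>i\<in>I. x i) = distr (PiM I M) (PiM I M) (\<lambda>x. x)"
    by (rule distr_cong) (auto simp: space_PiM PiE_def extensional_restrict)
  also have "\<dots> = PiM I M" by simp
  also have "\<dots> = PiM I (\<lambda>i. distr (PiM I M) (M i) (\<lambda>x. x i))"
    by (rule PiM_cong) (auto simp: PiM_component)
  finally show ?thesis using assms by (subst P.indep_vars_iff_distr_eq_PiM') simp_all
qed

lemma spider_model_exists:
  assumes N: "N \<ge> 1" and p: "\<And>j. j \<in> {1..N} \<Longrightarrow> p j > 0" "(\<Sum>j=1..N. p j) = 1"
  shows "\<exists>(M :: (bool \<times> nat \<Rightarrow> nat) measure) Z. spider_model M N p Z"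
proof -
  define L where "L = embed_pmf (\<lambda>j. if j \<in> {1..N} then p j else 0)"
  have L: "pmf L j = (if j \<in> {1..N} then p j else 0)" for j
    unfolding L_def
  proof (rule pmf_embed_pmf)
    show "0 \<le> (if j \<in> {1..N} then p j else 0)" for j using p(1)[of j] by auto
    have "(\<integral>\<^sup>+j. ennreal (if j \<in> {1..N} then p j else 0) \<partial>count_space UNIV) = (\<Sum>j\<in>{1..N}. ennreal (if j \<in> {1..N} then p j else 0))"
      by (rule nn_integral_count_space') auto
    also have "\<dots> = (\<Sum>j\<in>{1..N}. ennreal (p j))" by (rule sum.cong) auto
    also have "\<dots> = 1" using p by (subst sum_ennreal) (auto simp: less_imp_le)
    finally show "(\<integral>\<^sup>+j. ennreal (if j \<in> {1..N} then p j else 0) \<partial>count_space UNIV) = 1" .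
  qed
  define C where "C = pmf_of_set {0, 1 :: nat}"
  define K where "K i = measure_pmf (if fst i then C else L)" for i :: "bool \<times> nat"
  interpret product_prob_space K UNIV
    by (rule product_prob_spaceI) (simp add: K_def measure_pmf.prob_space_axioms)
  \<comment> \<open>A label drawn from \<open>L\<close> lies in \<open>{1..N}\<close> only almost
    surely, whereas the model asks for it at every point of the space. Other values are sent to
    \<open>1\<close>, which changes no probability.\<close>
  define g where "g i x = (if fst i \<or> x \<in> {1..N} then x else 1 :: nat)" for i :: "bool \<times> nat" and x
  define Z where "Z i \<omega> = g i (\<omega> i)" for i :: "bool \<times> nat" and \<omega> :: "bool \<times> nat \<Rightarrow> nat"
  have setsK: "sets (K i) = UNIV" "space (K i) = UNIV" for i by (simp_all add: K_def)
  have Zp: "P.prob {\<omega>\<in>space (PiM UNIV K). Z i \<omega> = j} = measure (K i) {x. g i x = j}" for i j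
  proof -
    have "P.prob {\<omega>\<in>space (PiM UNIV K). Z i \<omega> = j} = measure (PiM UNIV K) ((\<lambda>\<omega>. \<omega> i) -` {x. g i x = j} \<inter> space (PiM UNIV K))"
      by (rule arg_cong[where f = "measure (PiM UNIV K)"]) (auto simp: Z_def)
    also have "\<dots> = measure (distr (PiM UNIV K) (K i) (\<lambda>\<omega>. \<omega> i)) {x. g i x = j}"
      by (rule measure_distr[symmetric]) (auto simp: setsK)
    also have "distr (PiM UNIV K) (K i) (\<lambda>\<omega>. \<omega> i) = K i" by (rule PiM_component) simp
    finally show ?thesis .
  qed
  have "spider_model (PiM UNIV K) N p Z"
  proof
    show "N \<ge> 1" by (rule N)
    have "P.indep_vars (\<lambda>_. count_space UNIV) (\<lambda>i \<omega>. g i (\<omega> i)) UNIV"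
      by (rule P.indep_vars_compose2[OF indep_vars_components[OF UNIV_not_empty]]) (auto simp: measurable_def setsK)
    moreover have "Z = (\<lambda>i \<omega>. g i (\<omega> i))" by (intro ext) (simp add: Z_def)
    ultimately show "P.indep_vars (\<lambda>_. count_space UNIV) Z UNIV" by simp
    show "P.prob {\<omega>\<in>space (PiM UNIV K). Z (True, n) \<omega> = 0} = 1 / 2" for n
    proof -
      have "{x. g (True, n) x = 0} = {0}" by (auto simp: g_def)
      then show ?thesis unfolding Zp by (simp add: K_def C_def measure_pmf_single)
    qed
    show "P.prob {\<omega>\<in>space (PiM UNIV K). Z (False, n) \<omega> = j} = p j" if j: "j \<in> {1..N}" for n j
    proof -
      have "measure (K (False, n)) {x. g (False, n) x = j} = measure_pmf.prob L {j}"
        unfolding K_def fst_conv if_False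
      proof (rule measure_pmf.finite_measure_eq_AE)
        show "AE x in L. x \<in> {x. g (False, n) x = j} \<longleftrightarrow> x \<in> {j}"
          by (rule AE_pmfI) (auto simp: g_def set_pmf_iff L)
      qed auto
      then show ?thesis unfolding Zp using j by (simp add: measure_pmf_single L)
    qed
    show "Z (False, n) \<omega> \<in> {1..N}" for n \<omega> using N by (auto simp: Z_def g_def)
  qed
  then show ?thesis by blast
qed

section \<open>Path probabilities and the law of a spider walk\<close>

context spider_model
begin

lemma measurable_lab_coord: "UNIV \<times> {0<..n} \<subseteq> A \<Longrightarrow> lab n \<in> measurable (coord A) (count_space UNIV)"
proof (induction n)
  case (Suc n)
  have [measurable]: "lab n \<in> measurable (coord A) (count_space UNIV)"
    using Suc.prems by (intro Suc.IH) auto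
  have [measurable]: "(\<lambda>\<omega>. real_of_int (pos n \<omega>)) \<in> borel_measurable (coord A)"
    using Suc.prems by (intro measurable_pos_coord) auto
  have [measurable]: "Z (False, Suc n) \<in> measurable (coord A) (count_space UNIV)"
    using Suc.prems by (intro measurable_Z_coord) auto
  have "(\<lambda>\<omega>. if real_of_int (pos n \<omega>) = 0 then Z (False, Suc n) \<omega> else lab n \<omega>) \<in> measurable (coord A) (count_space UNIV)"
    by measurable
  moreover have "lab (Suc n) = (\<lambda>\<omega>. if real_of_int (pos n \<omega>) = 0 then Z (False, Suc n) \<omega> else lab n \<omega>)"
    by (rule ext) simp
  ultimately show ?case by simp
next
  case 0
  have "lab 0 = (\<lambda>\<omega>. 1)" by (rule ext) simp
  then show ?case by simp
qed

lemma measurable_model_coord: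
  assumes "UNIV \<times> {0<..n} \<subseteq> A"
  shows "model n \<in> borel_measurable (coord A)"
  unfolding model_def
proof (rule measurable_compose_countable[OF _ measurable_lab_coord[OF assms]])
  fix j
  have [measurable]: "(\<lambda>\<omega>. real_of_int (pos n \<omega>)) \<in> borel_measurable (coord A)"
    using assms by (intro measurable_pos_coord) auto
  show "(\<lambda>\<omega>. spider_point N (real_of_int \<bar>pos n \<omega>\<bar>) j) \<in> borel_measurable (coord A)"
    unfolding spider_point_def of_int_abs by measurable
qed

lemma measurable_model [measurable]: "model n \<in> borel_measurable M"
  by (rule measurable_coord_M[OF measurable_model_coord[of n UNIV]]) simp

definition model_prefix :: "nat \<Rightarrow> (nat \<Rightarrow> complex) \<Rightarrow> 'a set" where
  "model_prefix n x = {\<omega>\<in>space M. \<forall>i\<le>n. model i \<omega> = x i}"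

lemma model_prefix_coord: "model_prefix n x \<in> sets (coord (UNIV \<times> {0<..n}))"
proof -
  have "{\<omega>\<in>space (coord (UNIV \<times> {0<..n})). model i \<omega> = x i} \<in> sets (coord (UNIV \<times> {0<..n}))" if "i \<in> {..n}" for i
  proof -
    have [measurable]: "model i \<in> borel_measurable (coord (UNIV \<times> {0<..n}))"
      using that by (intro measurable_model_coord) auto
    show ?thesis by measurable
  qed
  then have "{\<omega>\<in>space (coord (UNIV \<times> {0<..n})). \<forall>i\<in>{..n}. model i \<omega> = x i} \<in> sets (coord (UNIV \<times> {0<..n}))"
    by (rule sets.sets_Collect_finite_All[OF _ finite_atMost])
  then show ?thesis by (simp only: model_prefix_def atMost_iff Ball_def space_coord)
qed

lemma model_prefix_events: "model_prefix n x \<in> events"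
  using model_prefix_coord coord_subset by blast

text \<open>From zero both steps lead to distance one, so the next position is decided by the fresh
  label alone, which is independent of the path so far.\<close>

lemma model_prefix_Suc_zero:
  assumes x: "x n = 0" and j: "j \<in> {1..N}" "x (Suc n) = spider_point N 1 j"
  shows "prob (model_prefix (Suc n) x) = prob (model_prefix n x) * p j"
proof -
  have "model_prefix (Suc n) x = model_prefix n x \<inter> {\<omega>\<in>space M. Z (False, Suc n) \<omega> = j}"
  proof (intro set_eqI)
    fix \<omega>
    have "model (Suc n) \<omega> = x (Suc n) \<longleftrightarrow> Z (False, Suc n) \<omega> = j" if \<omega>: "\<omega> \<in> model_prefix n x"
    proof -
      have sp: "\<omega> \<in> space M" and "model n \<omega> = 0" using \<omega> x by (auto simp: model_prefix_def)
      then have "pos n \<omega> = 0" by (simp add: model_eq_0_iff)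
      then have "model (Suc n) \<omega> = spider_point N 1 (Z (False, Suc n) \<omega>)"
        using step_cases[of "Suc n" \<omega>] by (auto simp: model_def)
      then show ?thesis unfolding j(2) using spider_point_eq_iff[of 1 1 "Z (False, Suc n) \<omega>" N j] label_range[OF sp, of "Suc n"] j(1)
        by simp
    qed
    then show "\<omega> \<in> model_prefix (Suc n) x \<longleftrightarrow> \<omega> \<in> model_prefix n x \<inter> {\<omega>\<in>space M. Z (False, Suc n) \<omega> = j}"
      by (auto simp: model_prefix_def le_Suc_eq)
  qed
  also have "prob \<dots> = prob (model_prefix n x) * prob {\<omega>\<in>space M. Z (False, Suc n) \<omega> = j}"
  proof (rule coord_indep[OF _ model_prefix_coord])
    have [measurable]: "Z (False, Suc n) \<in> measurable (coord {(False, Suc n)}) (count_space UNIV)"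
      by (rule measurable_Z_coord) simp
    have "{\<omega>\<in>space (coord {(False, Suc n)}). Z (False, Suc n) \<omega> = j} \<in> sets (coord {(False, Suc n)})" by measurable
    then show "{\<omega>\<in>space M. Z (False, Suc n) \<omega> = j} \<in> sets (coord {(False, Suc n)})" by simp
  qed auto
  finally show ?thesis using label[OF j(1)] by simp
qed

text \<open>The position on the spider hides the sign of \<open>pos\<close>. Splitting by this sign,
  a move by \<delta> away from the body takes the step \<delta> on the positive side and the
  opposite step on the negative side, each with probability one half.\<close>

lemma model_prefix_Suc_nonzero:
  assumes r: "r \<ge> 1" and j: "j \<in> {1..N}" and x: "x n = spider_point N (real r) j"
    and \<delta>: "\<delta> = 1 \<or> \<delta> = -1" "x (Suc n) = spider_point N (real r + real_of_int \<delta>) j"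
  shows "prob (model_prefix (Suc n) x) = prob (model_prefix n x) / 2"
proof -
  define E where "E z = {\<omega>\<in>model_prefix n x. pos n \<omega> = z}" for z
  have E_coord: "E z \<in> sets (coord (UNIV \<times> {0<..n}))" for z
  proof -
    have [measurable]: "(\<lambda>\<omega>. real_of_int (pos n \<omega>)) \<in> borel_measurable (coord (UNIV \<times> {0<..n}))"
      by (rule measurable_pos_coord) auto
    have "{\<omega>\<in>space (coord (UNIV \<times> {0<..n})). real_of_int (pos n \<omega>) = real_of_int z} \<in> sets (coord (UNIV \<times> {0<..n}))"
      by measurable
    then have "model_prefix n x \<inter> {\<omega>\<in>space M. pos n \<omega> = z} \<in> sets (coord (UNIV \<times> {0<..n}))"
      using model_prefix_coord[of n x] by auto
    also have "model_prefix n x \<inter> {\<omega>\<in>space M. pos n \<omega> = z} = E z" by (auto simp: E_def model_prefix_def)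
    finally show ?thesis .
  qed
  have E_ev: "E z \<in> events" for z using E_coord coord_subset by blast
  define F where "F z = {\<omega>\<in>space M. step (Suc n) \<omega> = z}" for z
  have F_coord: "F z \<in> sets (coord {(True, Suc n)})" for z unfolding F_def by (rule step_sets_coord) simp
  have F_ev: "F z \<in> events" for z using F_coord coord_subset by blast
  have F_prob: "prob (F 1) = 1 / 2" "prob (F (-1)) = 1 / 2" unfolding F_def by (rule prob_step)+
  have state: "\<bar>pos n \<omega>\<bar> = int r \<and> lab n \<omega> = j" if \<omega>: "\<omega> \<in> model_prefix n x" for \<omega>
  proof -
    have sp: "\<omega> \<in> space M" and m: "model n \<omega> = spider_point N (real r) j" using \<omega> x by (auto simp: model_prefix_def)
    then have "model n \<omega> \<noteq> 0" using r by simp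
    then have "pos n \<omega> \<noteq> 0" by (simp add: model_eq_0_iff)
    then have "real_of_int \<bar>pos n \<omega>\<bar> = real r \<and> lab n \<omega> = j"
      using m r lab_range[OF sp, of n] j unfolding model_def by (subst (asm) spider_point_eq_iff) auto
    then show ?thesis by linarith
  qed
  have "model_prefix n x = E (int r) \<union> E (- int r)"
  proof -
    have "pos n \<omega> = int r \<or> pos n \<omega> = - int r" if "\<omega> \<in> model_prefix n x" for \<omega>
      using state[OF that] by linarith
    then show ?thesis unfolding E_def by blast
  qed
  moreover have "prob (E (int r) \<union> E (- int r)) = prob (E (int r)) + prob (E (- int r))"
    using r by (intro finite_measure_Union E_ev) (auto simp: E_def)
  ultimately have 1: "prob (model_prefix n x) = prob (E (int r)) + prob (E (- int r))" by simp
  have "model_prefix (Suc n) x = (E (int r) \<inter> F \<delta>) \<union> (E (- int r) \<inter> F (- \<delta>))"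
  proof (intro set_eqI)
    fix \<omega>
    have "model (Suc n) \<omega> = x (Suc n) \<longleftrightarrow> pos n \<omega> = int r \<and> step (Suc n) \<omega> = \<delta> \<or> pos n \<omega> = - int r \<and> step (Suc n) \<omega> = - \<delta>"
      if \<omega>: "\<omega> \<in> model_prefix n x"
    proof -
      have s: "\<bar>pos n \<omega>\<bar> = int r" "lab n \<omega> = j" using state[OF \<omega>] by auto
      then have l: "lab (Suc n) \<omega> = j" using r by auto
      have "model (Suc n) \<omega> = x (Suc n) \<longleftrightarrow> real_of_int \<bar>pos (Suc n) \<omega>\<bar> = real r + real_of_int \<delta>"
      proof
        assume "model (Suc n) \<omega> = x (Suc n)"
        then have "norm (model (Suc n) \<omega>) = norm (x (Suc n))" by simp
        then show "real_of_int \<bar>pos (Suc n) \<omega>\<bar> = real r + real_of_int \<delta>"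
          using r \<delta>(1) unfolding model_def \<delta>(2) norm_spider_point by auto
      next
        assume "real_of_int \<bar>pos (Suc n) \<omega>\<bar> = real r + real_of_int \<delta>"
        then show "model (Suc n) \<omega> = x (Suc n)" unfolding model_def \<delta>(2) l by simp
      qed
      also have "\<dots> \<longleftrightarrow> \<bar>pos (Suc n) \<omega>\<bar> = int r + \<delta>" by linarith
      also have "\<dots> \<longleftrightarrow> pos n \<omega> = int r \<and> step (Suc n) \<omega> = \<delta> \<or> pos n \<omega> = - int r \<and> step (Suc n) \<omega> = - \<delta>"
        using s(1) r \<delta>(1) step_cases[of "Suc n" \<omega>] by auto
      finally show ?thesis .
    qed
    then show "\<omega> \<in> model_prefix (Suc n) x \<longleftrightarrow> \<omega> \<in> (E (int r) \<inter> F \<delta>) \<union> (E (- int r) \<inter> F (- \<delta>))"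
      unfolding E_def F_def by (auto simp: model_prefix_def le_Suc_eq)
  qed
  also have "prob \<dots> = prob (E (int r) \<inter> F \<delta>) + prob (E (- int r) \<inter> F (- \<delta>))"
    using r E_ev F_ev by (intro finite_measure_Union) (auto simp: E_def)
  also have "\<dots> = prob (E (int r)) * prob (F \<delta>) + prob (E (- int r)) * prob (F (- \<delta>))"
    by (intro arg_cong2[where f = "(+)"] coord_indep[OF _ E_coord F_coord]) auto
  also have "\<dots> = prob (model_prefix n x) / 2"
    using \<delta>(1) unfolding 1 by (elim disjE) (simp_all add: F_prob add_divide_distrib)
  finally show ?thesis .
qed

text \<open>Multiplying transition probabilities along a path would give equality, but an inequality
  requires work only for paths that the model can take, and for these every transition is covered by
  the assumptions. Equality of laws follows later from complements.\<close>

lemma model_prefix_le: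
  assumes S: "random_walk_on_spider M' N p S" and p: "\<And>j. j \<in> {1..N} \<Longrightarrow> p j > 0"
  shows "prob (model_prefix n x) \<le> measure M' {\<omega>\<in>space M'. \<forall>i\<le>n. S i \<omega> = x i}"
proof -
  interpret R: prob_space M' using S unfolding random_walk_on_spider_def by blast
  have markov: "discrete_markov_chain M' S" and S0: "\<And>\<omega>. \<omega> \<in> space M' \<Longrightarrow> S 0 \<omega> = 0"
    and body: "\<And>n j. j \<in> {1..N} \<Longrightarrow> \<P>(\<omega> in M'. S n \<omega> = 0) > 0 \<Longrightarrow>
        \<P>(\<omega> in M'. S (Suc n) \<omega> = spider_point N 1 j \<bar> S n \<omega> = 0) = p j"
    and up: "\<And>n r j. r \<ge> 1 \<Longrightarrow> j \<in> {1..N} \<Longrightarrow> \<P>(\<omega> in M'. S n \<omega> = spider_point N (real r) j) > 0 \<Longrightarrow>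
        \<P>(\<omega> in M'. S (Suc n) \<omega> = spider_point N (real r + 1) j \<bar> S n \<omega> = spider_point N (real r) j) = 1 / 2"
    and down: "\<And>n r j. r \<ge> 1 \<Longrightarrow> j \<in> {1..N} \<Longrightarrow> \<P>(\<omega> in M'. S n \<omega> = spider_point N (real r) j) > 0 \<Longrightarrow>
        \<P>(\<omega> in M'. S (Suc n) \<omega> = spider_point N (real r - 1) j \<bar> S n \<omega> = spider_point N (real r) j) = 1 / 2"
    using S unfolding random_walk_on_spider_def by blast+
  have Sm [measurable]: "S n \<in> borel_measurable M'" for n
    using markov unfolding discrete_markov_chain_def by blast
  let ?A = "\<lambda>n. {\<omega>\<in>space M'. \<forall>i\<le>n. S i \<omega> = x i}"
  have Aev: "?A n \<in> sets M'" for n by measurable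
  show ?thesis
  proof (induction n)
    case 0
    show ?case
    proof (cases "x 0 = 0")
      case True
      then have "?A 0 = space M'" using S0 by auto
      then show ?thesis by (simp add: R.prob_space)
    next
      case False
      then have "model_prefix 0 x = {}" by (auto simp: model_prefix_def model_def)
      then show ?thesis by simp
    qed
  next
    case (Suc n)
    show ?case
    proof (cases "prob (model_prefix (Suc n) x) = 0")
      case True
      then show ?thesis by simp
    next
      case False
      \<comment> \<open>A sample point of the model realizing the path; its coordinates reveal which
        leg, which distance and which direction \<open>x\<close> prescribes.\<close>
      then obtain \<omega>0 where \<omega>0: "\<omega>0 \<in> model_prefix (Suc n) x" by fastforce
      then have \<omega>n: "\<omega>0 \<in> model_prefix n x" and sp: "\<omega>0 \<in> space M" by (auto simp: model_prefix_def)
      have x0: "model n \<omega>0 = x n" "model (Suc n) \<omega>0 = x (Suc n)" using \<omega>0 by (auto simp: model_prefix_def)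
      have "prob (model_prefix (Suc n) x) \<le> prob (model_prefix n x)"
        by (rule finite_measure_mono[OF _ model_prefix_events]) (auto simp: model_prefix_def)
      then have "prob (model_prefix n x) > 0" using False by (meson less_le_trans measure_nonneg order.not_eq_order_implies_strict zero_less_measure_iff)
      \<comment> \<open>The Markov property and the transition probabilities of \<open>S\<close> are
        available only given events of positive probability; the induction hypothesis supplies
        this.\<close>
      then have pos_A: "measure M' (?A n) > 0" using Suc.IH by linarith
      have pos_n: "\<P>(\<omega> in M'. S n \<omega> = x n) > 0"
        using pos_A R.finite_measure_mono[of "?A n" "{\<omega>\<in>space M'. S n \<omega> = x n}"] by fastforce
      have "\<P>(\<omega> in M'. S (Suc n) \<omega> = x (Suc n) \<bar> \<forall>i\<le>n. S i \<omega> = x i) =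
          \<P>(\<omega> in M'. S (Suc n) \<omega> = x (Suc n) \<bar> S n \<omega> = x n)"
        using markov pos_A unfolding discrete_markov_chain_def by blast
      moreover have "?A (Suc n) = {\<omega>\<in>space M'. S (Suc n) \<omega> = x (Suc n) \<and> (\<forall>i\<le>n. S i \<omega> = x i)}"
        by (auto simp: le_Suc_eq)
      ultimately have step_S: "measure M' (?A (Suc n)) =
          measure M' (?A n) * \<P>(\<omega> in M'. S (Suc n) \<omega> = x (Suc n) \<bar> S n \<omega> = x n)"
        using pos_A by (simp add: cond_prob_def field_simps)
      show ?thesis
      proof (cases "x n = 0")
        case True
        then have "pos n \<omega>0 = 0" using x0 by (simp add: model_eq_0_iff[symmetric])
        then have x1: "x (Suc n) = spider_point N 1 (Z (False, Suc n) \<omega>0)"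
          using x0(2) step_cases[of "Suc n" \<omega>0] by (auto simp: model_def)
        define j where "j = Z (False, Suc n) \<omega>0"
        have j: "j \<in> {1..N}" unfolding j_def by (rule label_range[OF sp])
        have "prob (model_prefix (Suc n) x) = prob (model_prefix n x) * p j"
          using model_prefix_Suc_zero[of x n j, OF True j] x1 by (simp add: j_def)
        also have "\<dots> \<le> measure M' (?A n) * p j" using Suc.IH p[OF j] by (intro mult_right_mono) auto
        also have "\<dots> = measure M' (?A (Suc n))"
          unfolding step_S using body[OF j, of n] pos_n True x1 by (simp add: j_def)
        finally show ?thesis .
      next
        case False
        define r j \<delta> where "r = nat \<bar>pos n \<omega>0\<bar>" and "j = lab n \<omega>0" and "\<delta> = sgn (pos n \<omega>0) * step (Suc n) \<omega>0"
        have nz: "pos n \<omega>0 \<noteq> 0" using False x0(1) model_eq_0_iff by metis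
        have r: "r \<ge> 1" "real r = real_of_int \<bar>pos n \<omega>0\<bar>" using nz by (auto simp: r_def)
        have j: "j \<in> {1..N}" unfolding j_def by (rule lab_range[OF sp])
        have xn: "x n = spider_point N (real r) j" using x0(1) r by (simp add: model_def j_def)
        have \<delta>: "\<delta> = 1 \<or> \<delta> = -1" using nz step_cases[of "Suc n" \<omega>0] by (auto simp: \<delta>_def sgn_if)
        have "\<bar>pos (Suc n) \<omega>0\<bar> = \<bar>pos n \<omega>0\<bar> + \<delta>"
          using nz step_cases[of "Suc n" \<omega>0] by (auto simp: \<delta>_def sgn_if)
        then have xS: "x (Suc n) = spider_point N (real r + real_of_int \<delta>) j"
          using x0(2) nz r(2) by (simp add: model_def j_def del: pos.simps of_int_abs flip: of_int_add)
        have "prob (model_prefix (Suc n) x) = prob (model_prefix n x) / 2"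
          by (rule model_prefix_Suc_nonzero[OF r(1) j xn \<delta> xS])
        also have "\<dots> \<le> measure M' (?A n) / 2" using Suc.IH by simp
        also have "\<dots> = measure M' (?A (Suc n))"
          unfolding step_S xn xS using up[OF r(1) j, of n] down[OF r(1) j, of n] pos_n[unfolded xn] \<delta> by auto
        finally show ?thesis .
      qed
    qed
  qed
qed

text \<open>Up to time \<open>n\<close> the model stays within distance \<open>n\<close> of the
  body, so it has only finitely many paths. The event is covered by their prefix events, each at
  most as probable as its counterpart for \<open>S\<close>, and these counterparts are disjoint
  parts of the event for \<open>S\<close>.\<close>

lemma model_law_le:
  assumes S: "random_walk_on_spider M' N p S" and p: "\<And>j. j \<in> {1..N} \<Longrightarrow> p j > 0"
    and ev: "{\<omega>\<in>space M'. Q (\<lambda>i\<in>{..n}. S i \<omega>)} \<in> sets M'"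
  shows "prob {\<omega>\<in>space M. Q (\<lambda>i\<in>{..n}. model i \<omega>)} \<le> measure M' {\<omega>\<in>space M'. Q (\<lambda>i\<in>{..n}. S i \<omega>)}"
proof -
  interpret R: prob_space M' using S unfolding random_walk_on_spider_def by blast
  have Sm [measurable]: "S n \<in> borel_measurable M'" for n
    using S unfolding random_walk_on_spider_def discrete_markov_chain_def by blast
  define V where "V = (\<lambda>(r, j). spider_point N (real r) j) ` ({..n} \<times> {1..N})"
  define X where "X = {x \<in> {..n} \<rightarrow>\<^sub>E V. Q x}"
  have "finite V" unfolding V_def by (intro finite_imageI finite_cartesian_product) auto
  then have "finite ({..n} \<rightarrow>\<^sub>E V)" by (intro finite_PiE) auto
  then have fin: "finite X" unfolding X_def by (rule rev_finite_subset) auto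
  define A where "A x = {\<omega>\<in>space M'. \<forall>i\<le>n. S i \<omega> = x i}" for x :: "nat \<Rightarrow> complex"
  have Aev: "A x \<in> sets M'" for x unfolding A_def by measurable
  have ext: "x = y" if "x \<in> X" "y \<in> X" "\<And>i. i \<le> n \<Longrightarrow> x i = y i" for x y
    using that unfolding X_def by (intro PiE_ext[of x "{..n}" "\<lambda>_. V" y]) auto
  have eqx: "(\<lambda>i\<in>{..n}. s i) = x" if "x \<in> X" "\<And>i. i \<le> n \<Longrightarrow> s i = x i" for x s
    using that by (auto simp: X_def PiE_def extensional_def fun_eq_iff)
  have inV: "model i \<omega> \<in> V" if "\<omega> \<in> space M" "i \<le> n" for i \<omega>
  proof -
    have "nat \<bar>pos i \<omega>\<bar> \<le> n" using abs_pos_le[of i \<omega>] that(2) by linarith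
    moreover have "model i \<omega> = spider_point N (real (nat \<bar>pos i \<omega>\<bar>)) (lab i \<omega>)" by (simp add: model_def)
    ultimately show ?thesis unfolding V_def using lab_range[OF that(1), of i] by (auto intro!: image_eqI[where x = "(nat \<bar>pos i \<omega>\<bar>, lab i \<omega>)"])
  qed
  have "{\<omega>\<in>space M. Q (\<lambda>i\<in>{..n}. model i \<omega>)} \<subseteq> (\<Union>x\<in>X. model_prefix n x)"
  proof
    fix \<omega> assume \<omega>: "\<omega> \<in> {\<omega>\<in>space M. Q (\<lambda>i\<in>{..n}. model i \<omega>)}"
    then have "(\<lambda>i\<in>{..n}. model i \<omega>) \<in> X" using inV by (auto simp: X_def)
    moreover have "\<omega> \<in> model_prefix n (\<lambda>i\<in>{..n}. model i \<omega>)" using \<omega> by (auto simp: model_prefix_def)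
    ultimately show "\<omega> \<in> (\<Union>x\<in>X. model_prefix n x)" by blast
  qed
  then have "prob {\<omega>\<in>space M. Q (\<lambda>i\<in>{..n}. model i \<omega>)} \<le> prob (\<Union>x\<in>X. model_prefix n x)"
    using fin model_prefix_events by (intro finite_measure_mono) auto
  also have "\<dots> \<le> (\<Sum>x\<in>X. prob (model_prefix n x))"
    using fin model_prefix_events by (intro finite_measure_subadditive_finite) auto
  also have "\<dots> \<le> (\<Sum>x\<in>X. measure M' (A x))"
    unfolding A_def by (intro sum_mono model_prefix_le S p)
  also have "\<dots> = measure M' (\<Union>x\<in>X. A x)"
  proof (rule R.finite_measure_finite_Union[symmetric, OF fin])
    show "disjoint_family_on A X"
      unfolding disjoint_family_on_def
    proof (intro ballI impI)
      fix x y assume xy: "x \<in> X" "y \<in> X" "x \<noteq> y"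
      show "A x \<inter> A y = {}"
      proof (rule ccontr)
        assume "A x \<inter> A y \<noteq> {}"
        then obtain \<omega> where "\<omega> \<in> A x" "\<omega> \<in> A y" by blast
        then have "\<forall>i\<le>n. S i \<omega> = x i" "\<forall>i\<le>n. S i \<omega> = y i" by (simp_all add: A_def)
        then have "x = y" by (intro ext xy) metis
        with xy show False by simp
      qed
    qed
  qed (use Aev in auto)
  also have "\<dots> \<le> measure M' {\<omega>\<in>space M'. Q (\<lambda>i\<in>{..n}. S i \<omega>)}"
  proof (rule R.finite_measure_mono[OF _ ev], safe)
    fix x \<omega> assume "x \<in> X" "\<omega> \<in> A x"
    then show "\<omega> \<in> space M'" "Q (\<lambda>i\<in>{..n}. S i \<omega>)"
      using eqx[of x "\<lambda>i. S i \<omega>"] by (auto simp: A_def X_def)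
  qed
  finally show ?thesis .
qed

text \<open>The one-sided bound, applied to a finite-dimensional event and to its complement, yields
  equality because both laws have total mass one. Finite-dimensional events determine a law on
  sequences.\<close>

lemma model_law:
  assumes S: "random_walk_on_spider M' N p S" and p: "\<And>j. j \<in> {1..N} \<Longrightarrow> p j > 0"
  shows "distr M (PiM UNIV (\<lambda>_. borel)) (\<lambda>\<omega> n. model n \<omega>) = distr M' (PiM UNIV (\<lambda>_. borel)) (\<lambda>\<omega> n. S n \<omega>)"
proof -
  interpret R: prob_space M' using S unfolding random_walk_on_spider_def by blast
  have Sm [measurable]: "S n \<in> borel_measurable M'" for n
    using S unfolding random_walk_on_spider_def discrete_markov_chain_def by blast
  let ?P = "PiM UNIV (\<lambda>_::nat. borel :: complex measure)"
  have mm: "(\<lambda>\<omega> n. model n \<omega>) \<in> measurable M ?P" "(\<lambda>\<omega> n. S n \<omega>) \<in> measurable M' ?P"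
    by (auto intro!: measurable_PiM_single')
  show ?thesis
  proof (rule measure_eqI_PiM_infinite)
    show "finite_measure (distr M ?P (\<lambda>\<omega> n. model n \<omega>))" by (rule finite_measure_distr[OF mm(1)])
    fix A :: "nat \<Rightarrow> complex set" and J :: "nat set"
    assume J: "finite J" "J \<subseteq> UNIV" and A: "\<And>i. i \<in> J \<Longrightarrow> A i \<in> sets borel"
    define n where "n = Max (insert 0 J)"
    have Jn: "J \<subseteq> {..n}" using J by (auto simp: n_def)
    define Q where "Q x \<longleftrightarrow> (\<forall>i\<in>J. x i \<in> A i)" for x :: "nat \<Rightarrow> complex"
    have Q: "Q (\<lambda>i\<in>{..n}. x i) \<longleftrightarrow> Q x" for x using Jn by (auto simp: Q_def)
    have emb: "prod_emb UNIV (\<lambda>_. borel) J (Pi\<^sub>E J A) \<in> sets ?P"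
      using J A by (intro sets_PiM_I) auto
    have emb_iff: "x \<in> prod_emb UNIV (\<lambda>_. borel) J (Pi\<^sub>E J A) \<longleftrightarrow> Q x" for x
      by (auto simp: prod_emb_def Q_def PiE_iff)
    have evM: "{\<omega>\<in>space M. Q (\<lambda>n. model n \<omega>)} \<in> events"
      unfolding Q_def
    proof (intro sets.sets_Collect_finite_All J)
      fix i assume "i \<in> J"
      with A show "{\<omega>\<in>space M. model i \<omega> \<in> A i} \<in> events" by measurable
    qed
    have evS: "{\<omega>\<in>space M'. Q (\<lambda>n. S n \<omega>)} \<in> sets M'"
      unfolding Q_def
    proof (intro sets.sets_Collect_finite_All J)
      fix i assume "i \<in> J"
      with A show "{\<omega>\<in>space M'. S i \<omega> \<in> A i} \<in> sets M'" by measurable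
    qed
    have 1: "prob {\<omega>\<in>space M. Q (\<lambda>n. model n \<omega>)} \<le> measure M' {\<omega>\<in>space M'. Q (\<lambda>n. S n \<omega>)}"
      using model_law_le[OF S p, of Q n] evS by (simp add: Q)
    have "prob {\<omega>\<in>space M. \<not> Q (\<lambda>n. model n \<omega>)} \<le> measure M' {\<omega>\<in>space M'. \<not> Q (\<lambda>n. S n \<omega>)}"
      using model_law_le[OF S p, of "\<lambda>x. \<not> Q x" n] sets.sets_Collect_neg[OF evS] by (simp add: Q)
    then have 2: "prob {\<omega>\<in>space M. Q (\<lambda>n. model n \<omega>)} \<ge> measure M' {\<omega>\<in>space M'. Q (\<lambda>n. S n \<omega>)}"
      using prob_neg[OF evM] R.prob_neg[OF evS] by simp
    have "emeasure (distr M ?P (\<lambda>\<omega> n. model n \<omega>)) (prod_emb UNIV (\<lambda>_. borel) J (Pi\<^sub>E J A)) =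
        emeasure M {\<omega>\<in>space M. Q (\<lambda>n. model n \<omega>)}"
      unfolding emeasure_distr[OF mm(1) emb] by (intro arg_cong[where f = "emeasure M"]) (auto simp: emb_iff)
    also have "\<dots> = emeasure M' {\<omega>\<in>space M'. Q (\<lambda>n. S n \<omega>)}"
      using 1 2 by (simp add: emeasure_eq_measure R.emeasure_eq_measure)
    also have "\<dots> = emeasure (distr M' ?P (\<lambda>\<omega> n. S n \<omega>)) (prod_emb UNIV (\<lambda>_. borel) J (Pi\<^sub>E J A))"
      unfolding emeasure_distr[OF mm(2) emb] by (intro arg_cong[where f = "emeasure M'"]) (auto simp: emb_iff)
    finally show "emeasure (distr M ?P (\<lambda>\<omega> n. model n \<omega>)) (prod_emb UNIV (\<lambda>_. borel) J (Pi\<^sub>E J A)) =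
        emeasure (distr M' ?P (\<lambda>\<omega> n. S n \<omega>)) (prod_emb UNIV (\<lambda>_. borel) J (Pi\<^sub>E J A))" .
  qed auto
qed

end

text \<open>The assertion is a measurable property of the path, so its probability depends only on
  the law of the walk and can be computed in the model.\<close>

theorem random_walk_on_spider_occupation:
  assumes N: "N \<ge> 1" and p: "\<And>j. j \<in> {1..N} \<Longrightarrow> p j > 0" "(\<Sum>j=1..N. p j) = 1"
    and S: "random_walk_on_spider M N p S"
  shows "AE \<omega> in M.
    liminf (\<lambda>n. ereal (walk_occ_max N (\<lambda>k. S k \<omega>) n / real n)) = ereal (1 / real N) \<and>
    limsup (\<lambda>n. ereal (walk_occ_min N (\<lambda>k. S k \<omega>) n / real n)) = ereal (1 / real N)"
proof -
  obtain M0 :: "(bool \<times> nat \<Rightarrow> nat) measure" and Z where "spider_model M0 N p Z"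
    using spider_model_exists[OF N p] by blast
  then interpret spider_model M0 N p Z .
  let ?P = "PiM UNIV (\<lambda>_::nat. borel :: complex measure)"
  have Sm [measurable]: "S n \<in> borel_measurable M" for n
    using S unfolding random_walk_on_spider_def discrete_markov_chain_def by blast
  have mm: "(\<lambda>\<omega> n. model n \<omega>) \<in> measurable M0 ?P" "(\<lambda>\<omega> n. S n \<omega>) \<in> measurable M ?P"
    by (auto intro!: measurable_PiM_single')
  define G where "G s \<longleftrightarrow> liminf (\<lambda>n. ereal (walk_occ_max N s n / real n)) = ereal (1 / real N) \<and>
    limsup (\<lambda>n. ereal (walk_occ_min N s n / real n)) = ereal (1 / real N)" for s
  have ne: "{1..N} \<noteq> {}" using N by auto
  have occ: "(\<lambda>s. walk_occ N s j n) \<in> borel_measurable ?P" for j n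
    unfolding walk_occ_def by measurable
  have [measurable]: "(\<lambda>s. walk_occ_max N s n) \<in> borel_measurable ?P" "(\<lambda>s. walk_occ_min N s n) \<in> borel_measurable ?P" for n
    unfolding walk_occ_max_def walk_occ_min_def
    using occ by (auto intro!: borel_measurable_Max borel_measurable_Min)
  have G: "{s\<in>space ?P. G s} \<in> sets ?P" unfolding G_def by measurable
  have "AE \<omega> in M0. G (\<lambda>n. model n \<omega>)" unfolding G_def by (rule model_occupation[OF p(1)])
  then have "AE s in distr M0 ?P (\<lambda>\<omega> n. model n \<omega>). G s" by (subst AE_distr_iff[OF mm(1) G])
  then have "AE s in distr M ?P (\<lambda>\<omega> n. S n \<omega>). G s" by (simp only: model_law[OF S p(1)])
  then have "AE \<omega> in M. G (\<lambda>n. S n \<omega>)" by (subst (asm) AE_distr_iff[OF mm(2) G])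
  then show ?thesis unfolding G_def .
qed

theorem theorem3p3:
  fixes N :: nat and p :: "nat \<Rightarrow> real"
    and M :: "'a measure" and S :: "nat \<Rightarrow> 'a \<Rightarrow> complex"
    and M' :: "'b measure" and W :: "real \<Rightarrow> 'b \<Rightarrow> complex"
  assumes "N \<ge> 1"
    and "\<And>j. j \<in> {1..N} \<Longrightarrow> p j > 0"
    and "(\<Sum>j=1..N. p j) = 1"
    and "random_walk_on_spider M N p S"
    and "brownian_spider M' N p W"
  shows "(AE \<omega> in M.
            liminf (\<lambda>n. ereal (walk_occ_max N (\<lambda>k. S k \<omega>) n / real n)) = ereal (1 / real N) \<and>
            limsup (\<lambda>n. ereal (walk_occ_min N (\<lambda>k. S k \<omega>) n / real n)) = ereal (1 / real N)) \<and>
         (AE \<omega> in M'.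
            Liminf at_top (\<lambda>t. ereal (brownian_occ_max N (\<lambda>s. W s \<omega>) t / t)) = ereal (1 / real N) \<and>
            Limsup at_top (\<lambda>t. ereal (brownian_occ_min N (\<lambda>s. W s \<omega>) t / t)) = ereal (1 / real N))"
  using random_walk_on_spider_occupation[OF assms(1-4)] brownian_spider_occupation[OF assms(1,2,5)]
  by (rule conjI)

end
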